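(* Let $p\equiv 3\pmod 4$ be a prime, let $N=2m=2m_1m_2\cdots m_r$ where $p_1,\dots,p_r$ are distinct odd primes, $u_i\ge1$ and $m_i=p_i^{u_i}$, and suppose $f=\mathrm{ord}_N(p)$ is odd. Assume $(N,f,p)\in\mathcal{P}^\ast$ and that $(N,f,p)$ has property $(\star)$. Let $Y=\{h>1 : h \text{ divides } \prod_{i=2}^r m_i\}$ and let $I$ be an $m$-subset of $\{0,1,\dots,N-1\}$ such that (1) $\{x \bmod m : x\in I\}=\{0,1,\dots,m-1\}$, and (2) $\sum_{x\in I}\zeta_{2h}^x=0$ for every $h\in Y$. Then for every odd positive integer $s$, the set $D=\bigcup_{x\in I}C_x^{(N,p^{fs})}$ is a skew Hadamard difference set in $(\mathbb{F}_{p^{fs}},+)$. Moreover its dual is $D^\perp=\{\psi_a : a\in\bigcup_{i\in I'}C_i^{(N,p^{fs})}\}$, where $I'=\{-x+2As \bmod N : x\in I\}$ and $A=\sum_{i=1}^r s_i\prod_{j\neq i}m_j$.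
   Context: $\zeta_k=\exp(2\pi i/k)$. For a prime power $q$, $\psi_{\mathbb{F}_q}(x)=\zeta_p^{\mathrm{Tr}_{q/p}(x)}$ is the canonical additive character of $\mathbb{F}_q$ and $\psi_a(x)=\psi_{\mathbb{F}_q}(ax)$; for a multiplicative character $\eta$ of $\mathbb{F}_{p^f}$, $G_{p^f}(\eta)=\sum_{x\in\mathbb{F}_{p^f}^\ast}\psi_{\mathbb{F}_{p^f}}(x)\eta(x)$. For $n\mid p^f-1$, the Gauss sum $G_{p^f}(\eta_n)$ ($\eta_n$ of order $n$) is pure if $p^{-f/2}G_{p^f}(\eta_n)$ is a root of unity (independent of the choice of $\eta_n$); $\mathcal{P}$ is the set of triples $(n,f,p)$ with $n\mid p^f-1$ for which it is pure, and $\mathcal{P}^\ast=\{(n,f,p)\in\mathcal{P}:\mathrm{ord}_n(p)=f\}$. Property $(\star)$: $(2\prod_{i\in J}m_i,f,p)\in\mathcal{P}$ for every subset $J\subseteq\{1,\dots,r\}$ with $1\in J$. A subset $D$ of an abelian group $G$ of order $v$ is a skew Hadamard difference set if $D\cup -D=G\setminus\{0\}$, $D\cap -D=\emptyset$, and every nonzero element of $G$ is represented the same number of times as $x-y$ with $x,y\in D$; its dual is $D^\perp=\{\psi \text{ nontrivial character}: \psi(D)=(-1+\sqrt{-v})/2\}$. Fix a primitive element $\gamma$ of $\mathbb{F}_{p^{fs}}$; the cyclotomic classes are $C_i^{(N,p^{fs})}=\gamma^i\langle\gamma^N\rangle$. Let $\omega=\gamma^{(p^{fs}-1)/(p^f-1)}$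 (a primitive element of $\mathbb{F}_{p^f}$) and let $\eta_N$ be the multiplicative character of $\mathbb{F}_{p^f}$ with $\eta_N(\omega)=\zeta_N$. For $J\subseteq\{1,\dots,r\}$ let $m_J=\prod_{i\in J}m_i$, $n_J=m/m_J$, and $\eta_{2m_J}=\eta_N^{n_J\cdot \mathrm{inv}(n_J,2m_J)}$, where $\mathrm{inv}(x,y)$ is an integer with $x\cdot\mathrm{inv}(x,y)\equiv1\pmod y$; $\eta_2$ is the quadratic character of $\mathbb{F}_{p^f}$. The integers $s_1,\dots,s_r$ are defined by $s_1=0$ and $G_{p^f}(\eta_{2m_1m_i})=\zeta_{m_i}^{s_i}G_{p^f}(\eta_{2m_1})$ for $2\le i\le r$ (under the hypotheses, $G_{p^f}(\eta_{2m_1})=G_{p^f}(\eta_2)$ and such $s_i$ exist).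
   Formalization: In the definition of the dual, √(−v) with v = p^{fs} is read as (i√p)^{fs}, i.e. −i√v when fs ≡ 3 (mod 4); with √(−v) = i√v the stated formula for the dual fails there (e.g. p=11, N=14, f=3, s=1, I the even residues). *)

theory Defs
  imports Complex_Main "HOL-Library.Cardinality" "HOL-Number_Theory.Number_Theory"
begin

definition zeta :: "nat \<Rightarrow> complex" where
  "zeta k = exp (2 * of_real pi * \<i> / of_nat k)"


section \<open>Characters and Gauss sums of a finite field\<close>

definition field_degree :: "'a::finite_field itself \<Rightarrow> nat" where
  "field_degree _ = (THE n. CARD('a) = CHAR('a) ^ n)"

text \<open>The absolute trace, as an element of the field itself (it lies in the prime field).\<close>

definition trace :: "'a::finite_field \<Rightarrow> 'a" where
  "trace x = (\<Sum>i<field_degree TYPE('a). x ^ (CHAR('a) ^ i))"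

text \<open>The exponent is the representative of the trace in \<open>{0..<p}\<close>.\<close>

definition canonical_char :: "'a::finite_field \<Rightarrow> complex" where
  "canonical_char x = zeta CHAR('a) ^ (THE k. k < CHAR('a) \<and> of_nat k = trace x)"

definition canonical_char_at :: "'a::finite_field \<Rightarrow> 'a \<Rightarrow> complex" where
  "canonical_char_at a = (\<lambda>x. canonical_char (a * x))"

text \<open>A multiplicative character is a character of the group of nonzero elements; its value at
  \<open>0\<close> is left unconstrained and is never used.\<close>

definition mult_char :: "('a::finite_field \<Rightarrow> complex) \<Rightarrow> bool" where
  "mult_char \<eta> \<longleftrightarrow> \<eta> 1 = 1 \<and> (\<forall>x y. x \<noteq> 0 \<longrightarrow> y \<noteq> 0 \<longrightarrow> \<eta> (x * y) = \<eta> x * \<eta> y)"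

definition mult_char_order :: "('a::finite_field \<Rightarrow> complex) \<Rightarrow> nat" where
  "mult_char_order \<eta> = (LEAST n. n > 0 \<and> (\<forall>x. x \<noteq> 0 \<longrightarrow> \<eta> x ^ n = 1))"

definition gauss_sum :: "('a::finite_field \<Rightarrow> complex) \<Rightarrow> complex" where
  "gauss_sum \<eta> = (\<Sum>x \<in> UNIV - {0}. canonical_char x * \<eta> x)"

definition root_of_unity :: "complex \<Rightarrow> bool" where
  "root_of_unity z \<longleftrightarrow> (\<exists>k::nat. k > 0 \<and> z ^ k = 1)"

text \<open>The type argument is the model of the field with \<open>p ^ f\<close> elements in which the Gauss sums
  are formed; finite fields of equal order being isomorphic, it only matters through its
  cardinality, which fixes \<open>p\<close> and \<open>f\<close>.\<close>

definition pure_triples :: "'a::finite_field itself \<Rightarrow> (nat \<times> nat \<times> nat) set" where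
  "pure_triples _ = {(n, f, p).
     prime p \<and> CARD('a) = p ^ f \<and> n dvd p ^ f - 1 \<and>
     (\<forall>\<eta>::'a \<Rightarrow> complex. mult_char \<eta> \<longrightarrow> mult_char_order \<eta> = n \<longrightarrow>
        root_of_unity (of_real (real p powr (- real f / 2)) * gauss_sum \<eta>))}"

definition pure_triples_star :: "'a::finite_field itself \<Rightarrow> (nat \<times> nat \<times> nat) set" where
  "pure_triples_star T = {(n, f, p). (n, f, p) \<in> pure_triples T \<and> ord n p = f}"

definition property_star ::
    "'a::finite_field itself \<Rightarrow> (nat \<Rightarrow> nat) \<Rightarrow> nat \<Rightarrow> nat \<Rightarrow> nat \<Rightarrow> bool" where
  "property_star T ms r f p \<longleftrightarrow>
     (\<forall>J \<subseteq> {1..r}. 1 \<in> J \<longrightarrow> (2 * (\<Prod>i\<in>J. ms i), f, p) \<in> pure_triples T)"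

text \<open>The character \<open>\<eta>\<^bsub>2m\<^sub>J\<^esub> = \<eta>\<^sub>N ^ (n\<^sub>J inv(n\<^sub>J, 2m\<^sub>J))\<close>, where
  \<open>m\<^sub>J = \<Prod>\<^bsub>i\<in>J\<^esub> m\<^sub>i\<close> and \<open>n\<^sub>J = m / m\<^sub>J\<close>; note that
  \<^const>\<open>modular_inverse\<close> takes the modulus first.\<close>

definition sub_char ::
    "('a::finite_field \<Rightarrow> complex) \<Rightarrow> (nat \<Rightarrow> nat) \<Rightarrow> nat \<Rightarrow> nat set \<Rightarrow> 'a \<Rightarrow> complex" where
  "sub_char \<eta> ms r J = (\<lambda>x.
     let mJ = (\<Prod>i\<in>J. int (ms i)); nJ = (\<Prod>i\<in>{1..r}. int (ms i)) div mJ
     in \<eta> x powi (nJ * modular_inverse (2 * mJ) nJ))"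


section \<open>Cyclotomic classes\<close>

definition primitive_element :: "'a::finite_field \<Rightarrow> bool" where
  "primitive_element g \<longleftrightarrow> g \<noteq> 0 \<and> (\<forall>x. x \<noteq> 0 \<longrightarrow> (\<exists>k::nat. x = g ^ k))"

text \<open>Nonnegative powers suffice, since \<open>g\<close> has finite multiplicative order.\<close>

definition cyclotomic_class :: "'a::finite_field \<Rightarrow> nat \<Rightarrow> nat \<Rightarrow> 'a set" where
  "cyclotomic_class g N i = range (\<lambda>j::nat. g ^ i * (g ^ N) ^ j)"

definition field_embedding :: "('b::field \<Rightarrow> 'a::field) \<Rightarrow> bool" where
  "field_embedding \<iota> \<longleftrightarrow> \<iota> 1 = 1 \<and>
     (\<forall>x y. \<iota> (x + y) = \<iota> x + \<iota> y) \<and> (\<forall>x y. \<iota> (x * y) = \<iota> x * \<iota> y)"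


section \<open>Skew Hadamard difference sets\<close>

definition skew_hadamard_difference_set :: "'a::{finite,ab_group_add} set \<Rightarrow> bool" where
  "skew_hadamard_difference_set D \<longleftrightarrow>
     D \<union> uminus ` D = UNIV - {0} \<and> D \<inter> uminus ` D = {} \<and>
     (\<exists>l. \<forall>g. g \<noteq> 0 \<longrightarrow> card {(x, y). x \<in> D \<and> y \<in> D \<and> x - y = g} = l)"

definition nontrivial_char :: "('a::{finite,ab_group_add} \<Rightarrow> complex) \<Rightarrow> bool" where
  "nontrivial_char \<psi> \<longleftrightarrow>
     \<psi> 0 = 1 \<and> (\<forall>x y. \<psi> (x + y) = \<psi> x * \<psi> y) \<and> (\<exists>x. \<psi> x \<noteq> 1)"

text \<open>The dual depends on which square root of \<open>-v\<close> is meant by \<open>\<surd>(-v)\<close>; this choice is the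
  parameter \<open>w\<close>.  Replacing \<open>w\<close> by \<open>-w\<close> replaces the dual of a skew Hadamard difference set by
  its complement in the set of nontrivial characters.\<close>

definition dual :: "complex \<Rightarrow> 'a::{finite,ab_group_add} set \<Rightarrow> ('a \<Rightarrow> complex) set" where
  "dual w D = {\<psi>. nontrivial_char \<psi> \<and> (\<Sum>x\<in>D. \<psi> x) = (- 1 + w) / 2}"

text \<open>For \<open>v = p ^ n\<close> with \<open>n\<close> odd, \<open>\<surd>(-v)\<close> is read as \<open>(\<surd>(-p)) ^ n = (\<i> \<surd>p) ^ n\<close>, that is
  \<open>\<i> \<surd>v\<close> if \<open>n mod 4 = 1\<close> and \<open>-\<i> \<surd>v\<close> if \<open>n mod 4 = 3\<close>.  For \<open>p mod 4 = 3\<close> this is the value of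
  the quadratic Gauss sum of the field with \<open>v\<close> elements with respect to
  \<^const>\<open>canonical_char\<close>.\<close>

definition sqrt_neg_power :: "nat \<Rightarrow> nat \<Rightarrow> complex" where
  "sqrt_neg_power p n = csqrt (- of_nat p) ^ n"

end

theory Submission
  imports Defs "HOL-Algebra.Algebraic_Closure_Type" "HOL-Computational_Algebra.Computational_Algebra"
begin

hide_const (open) Polynomials.degree Polynomials.lead_coeff Divisibility.prime
  UnivPoly.up_ring.monom UnivPoly.up_ring.coeff Module.module.smult

text \<open>Let \<open>Q = p ^ (f * s)\<close> and let \<open>\<chi>\<close> be the character of order \<open>N\<close> of the field with \<open>Q\<close> elements
  that lifts \<open>\<eta>\<close>.  Fourier inversion on the cyclotomic classes writes \<open>N \<psi>(\<gamma>\<^sup>c D)\<close> as the sum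
  over \<open>j < N\<close> of \<open>G(\<chi>\<^sup>j) \<Sum>\<^bsub>x\<in>I\<^esub> \<zeta>\<^sub>N ^ (- j (x + c))\<close>.  The inner sum vanishes for even
  \<open>j \<noteq> 0\<close> by (1), and for odd \<open>j\<close> divisible by \<open>m\<^sub>1\<close> but not by \<open>m\<close> by (2).  In the remaining
  odd cases \<open>G(\<eta>\<^sup>j) = \<zeta>\<^sub>m ^ (j A) G(\<eta>\<^sub>2)\<close>, and the lifting theorem of Davenport and Hasse
  carries this to \<open>\<chi>\<close>; summing over \<open>j\<close> gives \<open>\<psi>(\<gamma>\<^sup>c D) = (- 1 \<plusminus> G\<^sub>Q(\<eta>\<^sub>2)) / 2\<close>, with
  the sign \<open>+\<close> if and only if \<open>c\<close> lies in \<open>I'\<close> modulo \<open>N\<close>, where \<open>G\<^sub>Q(\<eta>\<^sub>2)\<close> is evaluated by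
  Gauss's \<open>q\<close>-binomial identity.

  For the evaluation of \<open>G(\<eta>\<^sup>j)\<close> put \<open>G(\<eta>\<^sup>j) = \<epsilon>\<^sub>j G(\<eta>\<^sub>2)\<close>.  Galois conjugation shows that
  a root of unity \<open>\<epsilon>\<^sub>j\<close> satisfies \<open>\<epsilon>\<^sub>j ^ N = 1\<close> and \<open>\<epsilon>\<^bsub>cj\<^esub> = \<epsilon>\<^sub>j ^ c\<close> for \<open>c\<close> prime to \<open>N\<close>, and
  congruences modulo \<open>p\<^sub>i\<close> compare \<open>\<epsilon>\<^sub>j ^ m\<^sub>i\<close> and \<open>\<epsilon>\<^sub>k ^ m\<^sub>i\<close> whenever \<open>j m\<^sub>i\<close> and \<open>k m\<^sub>i\<close> agree
  modulo \<open>N\<close>.  Together with the integers \<open>s\<^sub>i\<close> this determines \<open>\<epsilon>\<^sub>j\<close> when the order of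
  \<open>\<eta>\<^sup>j\<close> is \<open>2 \<Prod>\<^bsub>i\<in>J\<^esub> m\<^sub>i\<close>; the product formula of Davenport and Hasse reduces the other
  orders to these.\<close>

section \<open>Galois conjugation and congruences for integer polynomials in a root of unity\<close>

text \<open>Purity is assumed only for orders 2 \<Prod> m_i over index sets containing 1, and index
  1 is the anchor. If p_1 divided p - 1, a character of order 2 p_1 would be lifted from the prime
  field, and purity would force it to be quadratic; so m_1 is prime to p - 1. For order 2 m_1 the
  congruence modulo p_1 gives \<epsilon>^m_1 = 1 and Frobenius gives \<epsilon>^(p-1) = 1, whence
  \<epsilon> = 1. For order 2 m_1 m_i the congruences leave an m_i-th root of unity open, which s_i
  records. With a third prime, two coprime powers of the error are 1, which leaves no freedom. The
  product formula costs a sign, removed by an odd-power congruence. Where only 2 and primes other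
  than p_1 divide the order, nothing is known about the Gauss sum unless the character is quadratic;
  condition (2) removes exactly those terms.

  Dividing by G(\<eta>_2) rather than p^(f/2) makes conjugation of \<zeta>_p act on the quotient
  through character values alone, so the quotient stays within N-th roots of unity. Both fields sit
  in one algebraic closure, and a character is recorded by its value z at a generator; lifting it
  keeps z. The sign of the quadratic Gauss sum decides which half of the characters forms the
  dual.\<close>

definition ipoly :: "int poly \<Rightarrow> complex \<Rightarrow> complex" where
  "ipoly P x = poly (map_poly of_int P) x"

lemma ipoly_0 [simp]: "ipoly 0 x = 0"
  and ipoly_pCons [simp]: "ipoly (pCons a P) x = of_int a + x * ipoly P x"
  by (simp_all add: ipoly_def map_poly_pCons)

lemma ipoly_1 [simp]: "ipoly 1 x = 1"
  by (simp add: one_pCons)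

lemma ipoly_add [simp]: "ipoly (P + Q) x = ipoly P x + ipoly Q x"
  by (induction P Q rule: poly_induct2) (simp_all add: algebra_simps)

lemma ipoly_smult [simp]: "ipoly (smult a P) x = of_int a * ipoly P x"
  by (induction P) (simp_all add: algebra_simps)

lemma ipoly_minus [simp]: "ipoly (- P) x = - ipoly P x"
  by (induction P) (simp_all add: algebra_simps)

lemma ipoly_diff [simp]: "ipoly (P - Q) x = ipoly P x - ipoly Q x"
  using ipoly_add[of P "- Q" x] by simp

lemma ipoly_mult [simp]: "ipoly (P * Q) x = ipoly P x * ipoly Q x"
  by (induction P) (simp_all add: algebra_simps)

lemma ipoly_power [simp]: "ipoly (P ^ n) x = ipoly P x ^ n"
  by (induction n) simp_all

lemma ipoly_sum [simp]: "ipoly (sum F A) x = (\<Sum>i\<in>A. ipoly (F i) x)"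
  by (induction A rule: infinite_finite_induct) simp_all

lemma ipoly_monom [simp]: "ipoly (monom a n) x = of_int a * x ^ n"
  by (induction n) (simp_all add: monom_0 monom_Suc algebra_simps)

lemma ipoly_of_nat [simp]: "ipoly (of_nat n) x = of_nat n"
  by (simp add: of_nat_poly)

lemma ipoly_pcompose [simp]: "ipoly (pcompose P Q) x = ipoly P (ipoly Q x)"
  by (induction P) (simp_all add: pcompose_pCons)

text \<open>Take an integer polynomial of least degree vanishing at \<xi> and divide it by its
  content. Pseudo-division and multiplicativity of the content (Gauss's lemma) give divisibility
  over the integers, and as a divisor of X^M - 1 it has leading coefficient 1 or -1.\<close>

lemma primitive_root_minimal_polynomial:
  fixes \<xi> :: complex
  assumes "M > 0" "\<xi> ^ M = 1"
  obtains f where "lead_coeff f = 1" "degree f > 0" "ipoly f \<xi> = 0"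
    "\<And>P. ipoly P \<xi> = 0 \<Longrightarrow> f dvd P"
proof -
  define Xp where "Xp = (monom 1 M - 1 :: int poly)"
  have degX: "degree Xp = M"
    unfolding Xp_def diff_conv_add_uminus using assms(1)
    by (subst degree_add_eq_left) (simp_all add: degree_monom_eq)
  have lcX: "lead_coeff Xp = 1"
    unfolding degX unfolding Xp_def using assms(1) by simp
  have X0: "Xp \<noteq> 0" using degX assms(1) by auto
  have Xroot: "ipoly Xp \<xi> = 0" unfolding Xp_def using assms by simp
  define Q where "Q = (\<lambda>d. \<exists>f. f \<noteq> 0 \<and> ipoly f \<xi> = 0 \<and> degree f = d)"
  have "Q M" unfolding Q_def using degX X0 Xroot by blast
  define d where "d = (LEAST d. Q d)"
  have "Q d" unfolding d_def by (rule LeastI[of Q, OF \<open>Q M\<close>])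
  have minimal: "f = 0" if "ipoly f \<xi> = 0" "degree f < d" for f
    using that not_less_Least[of "degree f" Q] unfolding Q_def d_def by blast
  obtain f0 where f0: "f0 \<noteq> 0" "ipoly f0 \<xi> = 0" "degree f0 = d"
    using \<open>Q d\<close> unfolding Q_def by blast
  define f1 where "f1 = primitive_part f0"
  have cp: "f0 = smult (content f0) f1" unfolding f1_def by simp
  have c0: "content f0 \<noteq> 0" using f0(1) by simp
  have f1: "f1 \<noteq> 0" "ipoly f1 \<xi> = 0" "degree f1 = d" "content f1 = 1"
  proof -
    show "f1 \<noteq> 0" using f0(1) by (simp add: f1_def)
    have "of_int (content f0) * ipoly f1 \<xi> = 0" using cp f0(2) by (metis ipoly_smult)
    thus "ipoly f1 \<xi> = 0" using c0 by simp
    show "degree f1 = d" using f0(3) by (simp add: f1_def)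
    show "content f1 = 1" using f0(1) by (simp add: f1_def)
  qed
  have dvd: "f1 dvd P" if "ipoly P \<xi> = 0" for P
  proof -
    obtain q r where qr: "pseudo_divmod P f1 = (q, r)" by fastforce
    define c where "c = lead_coeff f1 ^ (Suc (degree P) - degree f1)"
    have c: "c \<noteq> 0" unfolding c_def using f1(1) by simp
    have eq: "smult c P = f1 * q + r" unfolding c_def by (rule pseudo_divmod(1)[OF f1(1) qr])
    have "ipoly (smult c P) \<xi> = ipoly (f1 * q + r) \<xi>" by (simp only: eq)
    hence "ipoly r \<xi> = 0" using that f1(2) by simp
    moreover have "r = 0 \<or> degree r < degree f1"
      by (rule pseudo_divmod(2)[OF f1(1) qr])
    ultimately have "r = 0" using minimal f1(3) by auto
    hence eq': "smult c P = f1 * q" using eq by simp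
    hence "content q = content (smult c P)" by (simp add: content_mult f1(4))
    hence "c dvd content q" by simp
    hence "[:c:] dvd q" by (simp add: const_poly_dvd_iff_dvd_content)
    then obtain q' where q': "q = smult c q'" by (auto elim!: dvdE)
    have "smult c (P - f1 * q') = 0" using eq' q' by (simp add: smult_diff_right)
    hence "P = f1 * q'" using c by simp
    thus ?thesis by simp
  qed
  have "f1 dvd Xp" using dvd Xroot by blast
  then obtain g where "Xp = f1 * g" by blast
  hence "lead_coeff f1 * lead_coeff g = 1" using lcX by (metis lead_coeff_mult)
  hence l: "lead_coeff f1 = 1 \<or> lead_coeff f1 = -1" using zmult_eq_1_iff by auto
  have dpos: "d > 0"
  proof (rule ccontr)
    assume "\<not> d > 0"
    then obtain a where "f1 = [:a:]" using f1(3) by (metis degree_eq_zeroE not_gr_zero)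
    thus False using f1(1,2) by simp
  qed
  define f where "f = smult (lead_coeff f1) f1"
  have "lead_coeff f = 1" "degree f > 0" "ipoly f \<xi> = 0"
    using l dpos f1 by (auto simp: f_def)
  moreover have "f dvd P" if "ipoly P \<xi> = 0" for P
    using dvd[OF that] l by (auto simp: f_def)
  ultimately show ?thesis using that by blast
qed

text \<open>Reducing \<open>P\<close> modulo the monic minimal polynomial leaves a remainder of
  smaller degree, and a polynomial of such degree vanishing at \<xi> is zero, so constant
  coefficients can be compared. This brings congruences in Z[\<xi>] down to the integers.\<close>

lemma dvd_of_eq_mult_ipoly:
  fixes \<xi> :: complex and a b :: int
  assumes "M > 0" "\<xi> ^ M = 1" "of_int a = of_int b * ipoly P \<xi>"
  shows "b dvd a"
proof -
  obtain f where f: "lead_coeff f = 1" "degree f > 0" "ipoly f \<xi> = 0"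
    "\<And>P. ipoly P \<xi> = 0 \<Longrightarrow> f dvd P"
    using primitive_root_minimal_polynomial[OF assms(1,2)] by metis
  have "f \<noteq> 0" using f(2) by auto
  obtain q r where qr: "pseudo_divmod P f = (q, r)" by fastforce
  have eq: "P = f * q + r" using pseudo_divmod(1)[OF \<open>f \<noteq> 0\<close> qr] f(1) by simp
  have dr: "r = 0 \<or> degree r < degree f"
    by (rule pseudo_divmod(2)[OF \<open>f \<noteq> 0\<close> qr])
  define h where "h = [:a:] - smult b r"
  have "ipoly h \<xi> = 0" using assms(3) f(3) by (simp add: h_def eq)
  hence "f dvd h" using f(4) by blast
  moreover have "degree h < degree f"
    unfolding h_def using f(2) dr
    by (intro degree_diff_less) (auto intro: le_less_trans[OF degree_smult_le])
  ultimately have "h = 0" by (metis dvd_imp_degree_le leD)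
  hence "coeff [:a:] 0 = coeff (smult b r) 0" by (simp add: h_def)
  thus ?thesis by simp
qed

lemma freshman_dream_dvd:
  fixes u v :: "'a::comm_ring_1"
  assumes "prime l"
  shows "of_nat l dvd (u + v) ^ l - u ^ l - v ^ l"
proof -
  have l: "l > 0" using assms prime_gt_0_nat by blast
  have "(u + v) ^ l = (\<Sum>k\<le>l. of_nat (l choose k) * u ^ k * v ^ (l - k))"
    by (rule binomial_ring)
  also have "{..l} = insert 0 (insert l {0<..<l})" using l by auto
  also have "(\<Sum>k\<in>\<dots>. of_nat (l choose k) * u ^ k * v ^ (l - k)) =
      v ^ l + (u ^ l + (\<Sum>k\<in>{0<..<l}. of_nat (l choose k) * u ^ k * v ^ (l - k)))"
    using l by (subst sum.insert; simp)+
  finally have "(u + v) ^ l - u ^ l - v ^ l = (\<Sum>k\<in>{0<..<l}. of_nat (l choose k) * u ^ k * v ^ (l - k))"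
    by simp
  moreover have "of_nat l dvd (of_nat (l choose k) * u ^ k * v ^ (l - k) :: 'a)" if "k \<in> {0<..<l}" for k
  proof -
    have "l dvd (l choose k)" using that by (intro dvd_choose_prime assms) auto
    hence "of_nat l dvd (of_nat (l choose k) :: 'a)" by (metis dvd_def of_nat_mult)
    thus ?thesis by (simp add: mult.assoc)
  qed
  ultimately show ?thesis by (metis (no_types, lifting) dvd_sum)
qed

lemma dvd_diff_power:
  fixes u v d :: "'a::comm_ring_1"
  assumes "d dvd u - v"
  shows "d dvd u ^ n - v ^ n"
proof (induction n)
  case (Suc n)
  have "u ^ Suc n - v ^ Suc n = u * (u ^ n - v ^ n) + (u - v) * v ^ n" by (simp add: algebra_simps)
  thus ?case using Suc assms by simp
qed simp

lemma freshman_dream_sum_dvd: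
  fixes a :: "'b \<Rightarrow> 'a::comm_ring_1"
  assumes l: "prime l" and "finite A"
  shows "of_nat l dvd (\<Sum>i\<in>A. a i) ^ (l ^ k) - (\<Sum>i\<in>A. a i ^ (l ^ k))"
proof (induction k)
  case (Suc k)
  have one: "of_nat l dvd (\<Sum>i\<in>A. b i) ^ l - (\<Sum>i\<in>A. b i ^ l)" for b :: "'b \<Rightarrow> 'a"
    using \<open>finite A\<close>
  proof (induction A)
    case empty
    then show ?case using prime_gt_0_nat[OF l] by (simp add: zero_power)
  next
    case (insert x A)
    have "(b x + sum b A) ^ l - (b x ^ l + (\<Sum>i\<in>A. b i ^ l)) =
       ((b x + sum b A) ^ l - b x ^ l - sum b A ^ l) + (sum b A ^ l - (\<Sum>i\<in>A. b i ^ l))"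
      by simp
    thus ?case using insert freshman_dream_dvd[OF l, of "b x" "sum b A"] by (simp only: sum.insert[OF insert.hyps(1,2)] dvd_add)
  qed
  have "(\<Sum>i\<in>A. a i) ^ (l ^ Suc k) - (\<Sum>i\<in>A. a i ^ (l ^ Suc k)) =
     (((\<Sum>i\<in>A. a i) ^ (l ^ k)) ^ l - (\<Sum>i\<in>A. a i ^ (l ^ k)) ^ l) +
     ((\<Sum>i\<in>A. a i ^ (l ^ k)) ^ l - (\<Sum>i\<in>A. (a i ^ (l ^ k)) ^ l))"
    by (simp add: power_mult [symmetric] mult.commute)
  thus ?case using dvd_diff_power[OF Suc] one by (metis dvd_add)
qed simp

lemma fermat_int_dvd:
  fixes a :: int
  assumes "prime l"
  shows "int l dvd a ^ l - a"
proof -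
  have step: "int l dvd (a + 1) ^ l - (a + 1) \<longleftrightarrow> int l dvd a ^ l - a" for a :: int
  proof -
    have "int l dvd (a + 1) ^ l - a ^ l - 1 ^ l" using freshman_dream_dvd[OF assms, of a 1] by simp
    moreover have "(a + 1) ^ l - (a + 1) = ((a + 1) ^ l - a ^ l - 1 ^ l) + (a ^ l - a)" by simp
    ultimately show ?thesis by (metis dvd_add_right_iff)
  qed
  show ?thesis
  proof (induction a rule: int_induct[where k = 0])
    case base
    then show ?case using prime_gt_0_nat[OF assms] by (simp add: zero_power)
  next
    case (step1 i)
    then show ?case using step by simp
  next
    case (step2 i)
    then show ?case using step[of "i - 1"] by simp
  qed
qed

text \<open>The l-th power map is additive modulo l and fixes integer coefficients by Fermat, so
  only the exponents change.\<close>

lemma int_poly_power_prime_dvd: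
  fixes g :: "int poly"
  assumes "prime l"
  shows "of_nat l dvd g ^ l - pcompose g (monom 1 l)"
proof (induction g)
  case 0
  then show ?case using prime_gt_0_nat[OF assms] by (simp add: zero_power)
next
  case (pCons a g)
  define Xp where "Xp = (monom 1 1 :: int poly)"
  have eq: "pCons a g = [:a:] + Xp * g" by (simp add: Xp_def monom_Suc monom_0)
  have Xl: "Xp ^ l = monom 1 l" by (simp add: Xp_def monom_power)
  have 1: "of_nat l dvd ([:a:] + Xp * g) ^ l - [:a:] ^ l - (Xp * g) ^ l"
    by (rule freshman_dream_dvd[OF assms])
  have "int l dvd a ^ l - a" by (rule fermat_int_dvd[OF assms])
  hence "[:int l:] dvd [:a ^ l - a:]" by simp
  hence 2: "of_nat l dvd [:a:] ^ l - [:a:]" by (simp add: poly_const_pow of_nat_poly)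
  have 3: "of_nat l dvd Xp ^ l * (g ^ l - pcompose g (monom 1 l))" using pCons by simp
  have "([:a:] + Xp * g) ^ l - pcompose (pCons a g) (monom 1 l) =
     (([:a:] + Xp * g) ^ l - [:a:] ^ l - (Xp * g) ^ l) + ([:a:] ^ l - [:a:]) + Xp ^ l * (g ^ l - pcompose g (monom 1 l))"
    by (simp add: pcompose_pCons Xl algebra_simps power_mult_distrib)
  thus ?case using 1 2 3 unfolding eq by (metis dvd_add)
qed

text \<open>Dedekind's argument for the irreducibility of cyclotomic polynomials: \<xi>^l is a root
  of f g = X^M - 1, and if it were a root of the cofactor g, then g(\<xi>)^l would be a multiple of
  l in Z[\<xi>].\<close>

lemma ipoly_root_power_prime:
  fixes \<xi> :: complex
  assumes "M > 0" "\<xi> ^ M = 1" "prime l" "\<not> l dvd M" "ipoly P \<xi> = 0"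
  shows "ipoly P (\<xi> ^ l) = 0"
proof -
  obtain f where f: "lead_coeff f = 1" "degree f > 0" "ipoly f \<xi> = 0"
    "\<And>P. ipoly P \<xi> = 0 \<Longrightarrow> f dvd P"
    using primitive_root_minimal_polynomial[OF assms(1,2)] by metis
  have "ipoly (monom 1 M - 1) \<xi> = 0" using assms by simp
  then obtain g where g: "monom 1 M - 1 = f * g" using f(4) by (meson dvdE)
  have "ipoly (monom 1 M - 1) (\<xi> ^ l) = 0"
    using assms(2) by (simp flip: power_mult) (simp add: power_mult mult.commute[of l])
  hence "ipoly f (\<xi> ^ l) = 0 \<or> ipoly g (\<xi> ^ l) = 0" by (simp add: g)
  moreover have "ipoly g (\<xi> ^ l) \<noteq> 0"
  proof
    assume gl: "ipoly g (\<xi> ^ l) = 0"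
    obtain h where h: "g ^ l - pcompose g (monom 1 l) = of_nat l * h"
      using int_poly_power_prime_dvd[OF assms(3)] by (meson dvdE)
    have "ipoly (g ^ l - pcompose g (monom 1 l)) \<xi> = ipoly (of_nat l * h) \<xi>" by (simp only: h)
    hence gl': "ipoly g \<xi> ^ l = of_nat l * ipoly h \<xi>" using gl by simp
    \<comment> \<open>Differentiation at \<xi> gives M \<xi>^(M-1) = f'(\<xi>) g(\<xi>). Its l-th
      power shows that l divides M^l; this takes the place of separability modulo l.\<close>
    have "pderiv (monom 1 M - 1) = pderiv (f * g)" by (simp only: g)
    hence "monom (of_nat M) (M - 1) = pderiv f * g + f * pderiv g"
      by (simp add: pderiv_diff pderiv_monom pderiv_mult algebra_simps)
    hence "ipoly (monom (of_nat M) (M - 1)) \<xi> = ipoly (pderiv f * g + f * pderiv g) \<xi>" by simp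
    hence "of_nat M * \<xi> ^ (M - 1) = ipoly (pderiv f) \<xi> * ipoly g \<xi>" using f(3) by simp
    hence "of_nat M * (\<xi> ^ (M - 1) * \<xi>) = \<xi> * ipoly (pderiv f) \<xi> * ipoly g \<xi>"
      by (metis mult.assoc mult.commute)
    moreover have "\<xi> ^ (M - 1) * \<xi> = 1" using assms(1,2) by (metis power_minus_mult)
    ultimately have "of_nat M = \<xi> * ipoly (pderiv f) \<xi> * ipoly g \<xi>" by (simp only: mult_1_right)
    hence "of_nat M ^ l = (\<xi> * ipoly (pderiv f) \<xi>) ^ l * (of_nat l * ipoly h \<xi>)"
      by (simp add: power_mult_distrib gl')
    hence "of_int (int M ^ l) = of_int (int l) * ipoly ((monom 1 1 * pderiv f) ^ l * h) \<xi>"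
      by (simp add: mult_ac)
    hence "int l dvd int M ^ l" by (rule dvd_of_eq_mult_ipoly[OF assms(1,2)])
    hence "l dvd M" using assms(3) by (metis prime_dvd_power of_nat_dvd_iff of_nat_power)
    thus False using assms by simp
  qed
  ultimately have "ipoly f (\<xi> ^ l) = 0" by blast
  thus ?thesis using f(4)[OF assms(5)] by auto
qed

text \<open>Composing the prime case along the factorization of \<open>c\<close>. This serves as the
  Galois action: an integral polynomial relation at a root of unity survives replacing the root by a
  coprime power.\<close>

theorem ipoly_root_power_coprime:
  fixes \<xi> :: complex
  assumes "M > 0" "\<xi> ^ M = 1" "coprime c M" "ipoly P \<xi> = 0"
  shows "ipoly P (\<xi> ^ c) = 0"
proof (cases "c = 0")
  case True
  hence "\<xi> = 1" using assms by auto
  thus ?thesis using assms True by simp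
next
  case False
  hence "c > 0" by simp
  thus ?thesis using assms(3)
  proof (induction c rule: prime_divisors_induct)
    case (factor l c)
    hence "coprime c M" "\<not> l dvd M"
      by (auto simp: coprime_mult_left_iff coprime_absorb_left)
    hence "ipoly P (\<xi> ^ c) = 0" using factor by auto
    moreover have "(\<xi> ^ c) ^ M = 1" using assms(2) by (metis mult.commute power_mult power_one)
    ultimately have "ipoly P ((\<xi> ^ c) ^ l) = 0"
      using \<open>prime l\<close> \<open>\<not> l dvd M\<close> \<open>ipoly P (\<xi> ^ c) = 0\<close> assms(1)
      by (intro ipoly_root_power_prime[where M = M and \<xi> = "\<xi> ^ c"])
    thus ?case by (metis mult.commute power_mult)
  next
    case (unit c)
    then show ?case using assms by simp
  qed simp
qed

section \<open>Gauss sums in logarithmic form\<close>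

lemma zeta_power_eq_cis: "zeta k ^ j = cis (2 * pi * real j / real k)"
  by (simp add: zeta_def cis_conv_exp exp_of_nat_mult [symmetric] mult_ac)

lemma zeta_power_self [simp]: "k > 0 \<Longrightarrow> zeta k ^ k = 1"
  by (simp add: zeta_power_eq_cis)

lemma zeta_nonzero [simp]: "zeta k \<noteq> 0"
  by (simp add: zeta_def)

lemma zeta_mult_power: "k > 0 \<Longrightarrow> zeta (n * k) ^ k = zeta n"
  using zeta_power_eq_cis[of n 1] by (simp add: zeta_power_eq_cis)

lemma power_eq_power_if_cong:
  fixes z :: "'a::field"
  assumes "z ^ n = 1" "[a = b] (mod n)"
  shows "z ^ a = z ^ b"
proof -
  have *: "z ^ a = z ^ (a mod n)" for a
    by (metis assms(1) mod_mult_div_eq mult.right_neutral power_add power_mult power_one mult.commute)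
  show ?thesis using * assms(2) unfolding cong_def by metis
qed

lemma bij_betw_zeta_power:
  assumes "n > 0"
  shows "bij_betw (\<lambda>a. zeta n ^ a) {..<n} {z. z ^ n = 1}"
  using bij_betw_roots_unity[OF assms] by (simp add: zeta_power_eq_cis)

lemma zeta_power_eq_1_iff:
  assumes "n > 0"
  shows "zeta n ^ a = 1 \<longleftrightarrow> n dvd a"
proof
  assume "zeta n ^ a = 1"
  moreover have "zeta n ^ a = zeta n ^ (a mod n)"
    using assms by (intro power_eq_power_if_cong[of _ n]) (auto simp: cong_def)
  ultimately have "zeta n ^ (a mod n) = zeta n ^ 0" by simp
  hence "a mod n = 0"
    using inj_onD[OF bij_betw_imp_inj_on[OF bij_betw_zeta_power[OF assms]], of "a mod n" 0] assms by simp
  thus "n dvd a" by blast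
qed (use assms in \<open>auto simp: power_mult elim!: dvdE\<close>)

lemma root_of_unity_eq_zeta_power:
  fixes z :: complex
  assumes "n > 0" "z ^ n = 1"
  shows "\<exists>a<n. z = zeta n ^ a"
proof -
  have "z \<in> (\<lambda>a. zeta n ^ a) ` {..<n}"
    using bij_betw_zeta_power[OF assms(1)] assms(2) by (simp add: bij_betw_def)
  thus ?thesis by auto
qed

lemma sum_periodic_shift:
  fixes f :: "nat \<Rightarrow> 'a::comm_monoid_add"
  assumes "\<And>i. f (i + n) = f i"
  shows "(\<Sum>i<n. f (i + e)) = (\<Sum>i<n. f i)"
proof (induction e)
  case (Suc e)
  have "(\<Sum>i<n. f (i + Suc e)) = (\<Sum>i<n. f (Suc i + e))" by simp
  also have "\<dots> = (\<Sum>i<n. f (i + e))"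
  proof (cases n)
    case (Suc k)
    have "(\<Sum>i<n. f (i + e)) = f e + (\<Sum>i<k. f (Suc i + e))"
      by (simp only: Suc sum.lessThan_Suc_shift) simp
    moreover have "(\<Sum>i<n. f (Suc i + e)) = (\<Sum>i<k. f (Suc i + e)) + f (e + n)"
      by (simp add: Suc add_ac)
    ultimately show ?thesis using assms by (simp add: add_ac)
  qed simp
  finally show ?case using Suc by simp
qed simp

lemma sum_periodic_mult:
  fixes f :: "nat \<Rightarrow> 'a::comm_monoid_add"
  assumes per: "\<And>i. f (i + n) = f i" and c: "coprime c n" and "n > 0"
  shows "(\<Sum>i<n. f (c * i)) = (\<Sum>i<n. f i)"
proof -
  have f_mod: "f (i mod n) = f i" for i
  proof -
    have "f (j + k * n) = f j" for j k
    proof (induction k)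
      case (Suc k)
      have "f (j + Suc k * n) = f ((j + k * n) + n)" by (simp add: add_ac)
      thus ?case using Suc per by simp
    qed simp
    from this[of "i mod n" "i div n"] show ?thesis by (simp add: add.commute)
  qed
  have inj: "inj_on (\<lambda>i. c * i mod n) {..<n}"
  proof (rule inj_onI)
    fix x y assume xy: "x \<in> {..<n}" "y \<in> {..<n}" "c * x mod n = c * y mod n"
    hence "[c * x = c * y] (mod n)" by (simp add: cong_def)
    hence "[x = y] (mod n)" using c by (simp add: cong_mult_lcancel_nat)
    thus "x = y" using xy by (simp add: cong_def)
  qed
  have img: "(\<lambda>i. c * i mod n) ` {..<n} = {..<n}"
    by (rule endo_inj_surj) (use inj \<open>n > 0\<close> in auto)
  have "(\<Sum>i<n. f i) = (\<Sum>i\<in>(\<lambda>i. c * i mod n) ` {..<n}. f i)" by (simp add: img)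
  also have "\<dots> = (\<Sum>i<n. f (c * i mod n))" using inj by (simp add: sum.reindex)
  finally show ?thesis by (simp add: f_mod)
qed

text \<open>\<open>\<tau>\<close> is the trace in logarithmic form: \<open>\<tau> i\<close> represents the absolute trace of \<open>g ^ i\<close>
  for a generator \<open>g\<close> of the multiplicative group, which has order \<open>q1\<close>.\<close>

locale log_trace =
  fixes p q1 :: nat and \<tau> :: "nat \<Rightarrow> nat"
  assumes p_prime: "prime p" and p_odd: "odd p" and q1_pos: "q1 > 0" and q1_even: "even q1"
    and p_q1: "\<not> p dvd q1"
    and periodic: "\<And>i. \<tau> (i + q1) = \<tau> i"
    and scale: "\<And>c. \<not> p dvd c \<Longrightarrow> \<exists>e. \<forall>i. [\<tau> (i + e) = c * \<tau> i] (mod p)"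
    and frob: "\<And>i. \<tau> (p * i) = \<tau> i"
begin

text \<open>For z with \<open>z ^ q1 = 1\<close> this is the Gauss sum of the multiplicative
  character sending the generator to z.\<close>

definition GS :: "complex \<Rightarrow> complex" where
  "GS z = (\<Sum>i<q1. zeta p ^ \<tau> i * z ^ i)"

lemma p_gt_2: "p > 2"
  using p_prime p_odd prime_ge_2_nat[OF p_prime] by (cases "p = 2") auto

lemma GS_frobenius:
  assumes "z ^ q1 = 1"
  shows "GS (z ^ p) = GS z"
proof -
  have "GS (z ^ p) = (\<Sum>i<q1. zeta p ^ \<tau> (p * i) * z ^ (p * i))"
    by (simp add: GS_def frob power_mult)
  also have "\<dots> = GS z" unfolding GS_def
    by (rule sum_periodic_mult) (use periodic assms p_q1 p_prime q1_pos in
      \<open>auto simp: power_add prime_imp_coprime\<close>)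
  finally show ?thesis .
qed

lemma GS_shift:
  assumes "z ^ q1 = 1"
  shows "z ^ e * (\<Sum>i<q1. zeta p ^ \<tau> (i + e) * z ^ i) = GS z"
proof -
  have "GS z = (\<Sum>i<q1. zeta p ^ \<tau> (i + e) * z ^ (i + e))"
    unfolding GS_def by (rule sum_periodic_shift [symmetric]) (simp add: periodic power_add assms)
  thus ?thesis by (simp add: sum_distrib_left power_add mult_ac)
qed

text \<open>Written as one integer polynomial at \<open>zeta M\<close>, the sum shows its
  conjugates: replacing \<open>zeta M\<close> by its c-th power raises both the additive and the
  multiplicative character to the power c.\<close>

lemma GS_as_ipoly:
  assumes "p dvd M" "M > 0" "z = zeta M ^ a"
  shows "ipoly (\<Sum>i<q1. monom 1 (M div p * \<tau> i + a * i)) (zeta M ^ c)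
       = (\<Sum>i<q1. zeta p ^ (c * \<tau> i) * z ^ (c * i))"
proof -
  have "zeta p = zeta M ^ (M div p)"
    using zeta_mult_power[of "M div p" p] assms p_prime by (auto elim!: dvdE)
  thus ?thesis using assms(3)
    by (simp add: power_add power_mult [symmetric] mult_ac distrib_left)
qed

text \<open>With M = k n p all of \<epsilon>, z, w and \<open>zeta p\<close> are powers of
  \<open>zeta M\<close>, so the assumed relation is the vanishing of an integer polynomial there and
  can be conjugated.\<close>

lemma GS_galois:
  assumes "k > 0" "n > 0" "\<epsilon> ^ k = 1" "z ^ n = 1" "w ^ n = 1" "GS z = \<epsilon> * GS w"
    and c: "coprime c k" "coprime c n" "coprime c p"
  shows "(\<Sum>i<q1. zeta p ^ (c * \<tau> i) * z ^ (c * i)) = \<epsilon> ^ c * (\<Sum>i<q1. zeta p ^ (c * \<tau> i) * w ^ (c * i))"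
proof -
  define M where "M = k * n * p"
  have M: "M > 0" "p dvd M" using assms(1,2) p_prime by (auto simp: M_def prime_gt_0_nat)
  obtain e where e: "\<epsilon> = zeta k ^ e" using root_of_unity_eq_zeta_power assms by blast
  obtain a where a: "z = zeta n ^ a" using root_of_unity_eq_zeta_power assms by blast
  obtain b where b: "w = zeta n ^ b" using root_of_unity_eq_zeta_power assms by blast
  have zk: "zeta k = zeta M ^ (n * p)"
    using zeta_mult_power[of "n * p" k] assms(2) p_prime by (simp add: M_def mult_ac prime_gt_0_nat)
  have zn: "zeta n = zeta M ^ (k * p)"
    using zeta_mult_power[of "k * p" n] assms(1) p_prime by (simp add: M_def mult_ac prime_gt_0_nat)
  define P where "P = (\<lambda>a. \<Sum>i<q1. monom 1 (M div p * \<tau> i + a * i) :: int poly)"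
  have P: "ipoly (P a) (zeta M ^ c) = (\<Sum>i<q1. zeta p ^ (c * \<tau> i) * y ^ (c * i))"
    if "y = zeta M ^ a" for a c y
    unfolding P_def by (rule GS_as_ipoly) (use M that in auto)
  have z': "z = zeta M ^ (k * p * a)" and w': "w = zeta M ^ (k * p * b)"
    and e': "\<epsilon> = zeta M ^ (n * p * e)"
    by (simp_all add: a b e zk zn power_mult)
  define F where "F = P (k * p * a) - monom 1 (n * p * e) * P (k * p * b)"
  have F: "ipoly F (zeta M ^ c) = (\<Sum>i<q1. zeta p ^ (c * \<tau> i) * z ^ (c * i))
      - \<epsilon> ^ c * (\<Sum>i<q1. zeta p ^ (c * \<tau> i) * w ^ (c * i))" for c
    unfolding F_def using P[OF z', of c] P[OF w', of c]
    by (simp add: e' power_mult [symmetric] mult_ac)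
  have "ipoly F (zeta M) = 0" using F[of 1] assms(6) by (simp add: GS_def)
  hence "ipoly F (zeta M ^ c) = 0"
    using ipoly_root_power_coprime[of M "zeta M" c F] M c by (simp add: M_def)
  thus ?thesis using F by simp
qed

text \<open>Multiplying all traces by c is the index shift by e, because \<open>g ^ e\<close> is the
  prime field element c. The shift is undone at the cost of the character value at c, for z and w
  alike.\<close>

lemma GS_galois_scaled:
  assumes "k > 0" "n > 0" "\<epsilon> ^ k = 1" "z ^ n = 1" "w ^ n = 1" "n dvd q1" "GS z = \<epsilon> * GS w"
    and c: "coprime c k" "coprime c n" "coprime c p"
    and e: "\<forall>i. [\<tau> (i + e) = c * \<tau> i] (mod p)"
  shows "w ^ (c * e) * GS (z ^ c) = \<epsilon> ^ c * z ^ (c * e) * GS (w ^ c)"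
proof -
  have eq: "y ^ (c * e) * (\<Sum>i<q1. zeta p ^ (c * \<tau> i) * y ^ (c * i)) = GS (y ^ c)" if "y ^ n = 1" for y
  proof -
    have "y ^ q1 = 1" using that assms(6) by (auto elim!: dvdE simp: power_mult)
    hence "(y ^ c) ^ q1 = 1" by (metis mult.commute power_mult power_one)
    moreover have "zeta p ^ (c * \<tau> i) = zeta p ^ \<tau> (i + e)" for i
      using e p_prime by (intro power_eq_power_if_cong[of _ p]) (auto simp: cong_sym_eq prime_gt_0_nat)
    ultimately show ?thesis using GS_shift[of "y ^ c" e] by (simp add: power_mult)
  qed
  have "w ^ (c * e) * GS (z ^ c) =
      w ^ (c * e) * (z ^ (c * e) * (\<Sum>i<q1. zeta p ^ (c * \<tau> i) * z ^ (c * i)))"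
    using eq[OF assms(4)] by simp
  also have "(\<Sum>i<q1. zeta p ^ (c * \<tau> i) * z ^ (c * i)) =
     \<epsilon> ^ c * (\<Sum>i<q1. zeta p ^ (c * \<tau> i) * w ^ (c * i))"
    by (rule GS_galois[where k = k and n = n]) (use assms in auto)
  also have "w ^ (c * e) * (z ^ (c * e) * (\<epsilon> ^ c * (\<Sum>i<q1. zeta p ^ (c * \<tau> i) * w ^ (c * i)))) =
     \<epsilon> ^ c * z ^ (c * e) * GS (w ^ c)"
    using eq[OF assms(5)] by (simp add: mult_ac)
  finally show ?thesis .
qed

end

section \<open>Exponents that fix some roots of unity and move others\<close>

lemma coprime_one_plus_mult: "coprime (1 + t * h) (h::nat)"
proof (rule coprimeI)
  fix d assume d: "d dvd 1 + t * h" "d dvd h"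
  hence "d dvd t * h" by simp
  thus "is_unit d" using d(1) dvd_add_left_iff by blast
qed

text \<open>It supplies an automorphism fixing the n-th roots of unity but moving a primitive k-th
  one. For a prime l dividing lcm(k, n) / n put h = lcm(k, n) / l: then 1 + h is prime to h, and
  only l can spoil coprimality with k. In that case l is odd, as n is even, and 2 h works
  instead.\<close>

lemma exists_coprime_one_mod:
  fixes k n :: nat
  assumes "k > 0" "n > 0" "even n" "\<not> k dvd n"
  shows "\<exists>h. n dvd h \<and> coprime (1 + h) k \<and> \<not> k dvd h"
proof -
  define K where "K = lcm k n"
  have "n dvd K" "k dvd K" "K > 0" using assms by (auto simp: K_def intro: lcm_pos_nat)
  have "K \<noteq> n" using assms(4) \<open>k dvd K\<close> by auto
  hence "K div n \<noteq> 1" using \<open>n dvd K\<close> by (metis dvd_mult_div_cancel mult.right_neutral)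
  then obtain l where l: "prime l" "l dvd K div n" using prime_factor_nat by blast
  obtain h where h: "K = l * h" "n dvd h"
  proof -
    obtain t where t: "K div n = l * t" using l(2) by blast
    hence "K = l * (n * t)" using \<open>n dvd K\<close> by (metis dvd_mult_div_cancel mult.left_commute)
    thus ?thesis using that[of "n * t"] by auto
  qed
  have nk: "\<not> k dvd h"
  proof
    assume "k dvd h"
    hence "K dvd h" using h(2) by (simp add: K_def)
    moreover have "h > 0" "h < K" using h(1) \<open>K > 0\<close> prime_gt_1_nat[OF l(1)] by auto
    ultimately show False using dvd_imp_le by fastforce
  qed
  have cop: "coprime (1 + t * h) k" if "\<not> l dvd 1 + t * h" for t
  proof -
    have "coprime (1 + t * h) h" by (rule coprime_one_plus_mult)
    moreover have "coprime (1 + t * h) l"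
      using l(1) that by (metis coprime_commute prime_imp_coprime)
    ultimately have "coprime (1 + t * h) K" by (simp add: h(1))
    thus ?thesis using \<open>k dvd K\<close> by (metis coprime_divisors dvd_refl)
  qed
  show ?thesis
  proof (cases "l dvd 1 + h")
    case False
    thus ?thesis using cop[of 1] h(2) nk by auto
  next
    case True
    hence "\<not> l dvd h" using l(1) by (metis dvd_add_left_iff not_prime_unit)
    have "even h" using assms(3) h(2) by (rule dvd_trans)
    hence "odd l" using True l(1) by (metis \<open>\<not> l dvd h\<close> dvd_trans even_plus_one_iff odd_one primes_dvd_imp_eq two_is_prime_nat even_add)
    have "\<not> l dvd 1 + 2 * h"
    proof
      assume "l dvd 1 + 2 * h"
      hence "l dvd 2 * (1 + h) - (1 + 2 * h)" 
        by (intro dvd_diff_nat dvd_mult True)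
      thus False using l(1) by simp
    qed
    moreover have "\<not> k dvd 2 * h"
    proof
      assume "k dvd 2 * h"
      have "l dvd k"
      proof (rule ccontr)
        assume "\<not> l dvd k"
        have "k dvd l * h" using \<open>k dvd K\<close> h(1) by simp
        hence "k dvd h" using \<open>\<not> l dvd k\<close> l(1) by (metis coprime_commute coprime_dvd_mult_right_iff prime_imp_coprime)
        thus False using nk by simp
      qed
      hence "l dvd 2 * h" using \<open>k dvd 2 * h\<close> by (rule dvd_trans)
      hence "l dvd 2" using \<open>\<not> l dvd h\<close> l(1) prime_dvd_mult_iff by blast
      thus False using \<open>odd l\<close> l(1) by (metis primes_dvd_imp_eq two_is_prime_nat dvd_refl)
    qed
    ultimately show ?thesis using cop[of 2] h(2) by (intro exI[of _ "2 * h"]) auto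
  qed
qed

section \<open>The root of unity relating a pure Gauss sum to the quadratic one\<close>

context log_trace begin

lemma coprime_p_N:
  assumes "N dvd q1"
  shows "coprime N p"
  using assms p_q1 p_prime by (metis coprime_commute dvd_trans prime_imp_coprime)

text \<open>\<open>-1\<close> is the value at \<open>g\<close> of the quadratic character, so \<open>GS (-1)\<close> is the
  quadratic Gauss sum.\<close>

lemma pure_ratio_pow:
  assumes "N > 0" "even N" "N dvd q1" "z ^ N = 1" "root_of_unity \<epsilon>" "GS z = \<epsilon> * GS (-1)"
    "GS (-1) \<noteq> 0"
  shows "\<epsilon> ^ N = 1"
proof -
  have m1: "(-1::complex) ^ N = 1" using assms(2) by simp
  have cop: "coprime N p" using coprime_p_N assms(3) .
  obtain k0 where k0: "k0 > 0" "\<epsilon> ^ k0 = 1" using assms(5) unfolding root_of_unity_def by blast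
  define k where "k = (LEAST k. k > 0 \<and> \<epsilon> ^ k = 1)"
  have k: "k > 0" "\<epsilon> ^ k = 1"
    using LeastI[of "\<lambda>k. k > 0 \<and> \<epsilon> ^ k = 1" k0] k0 unfolding k_def by auto
  have k_dvd: "k dvd a" if "\<epsilon> ^ a = 1" for a
  proof -
    have "\<epsilon> ^ (a mod k) = 1"
      using that k(2) by (metis mod_mult_div_eq mult.right_neutral power_add power_mult power_one mult.commute)
    hence "a mod k = 0" using not_less_Least[of "a mod k" "\<lambda>k. k > 0 \<and> \<epsilon> ^ k = 1"] k(1)
      unfolding k_def by (metis (mono_tags, lifting) gr0I mod_less_divisor)
    thus ?thesis by blast
  qed
  \<comment> \<open>\<open>k\<close> is the order of \<epsilon>. Otherwise some automorphism would
    fix the N-th and p-th roots of unity, hence both Gauss sums, and yet move \<epsilon>.\<close>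
  have "k dvd N * p"
  proof (rule ccontr)
    assume "\<not> k dvd N * p"
    then obtain h where h: "N * p dvd h" "coprime (1 + h) k" "\<not> k dvd h"
      using exists_coprime_one_mod[of k "N * p"] k(1) assms(1,2) p_prime prime_gt_0_nat by auto
    define c where "c = 1 + h"
    have c: "coprime c N" "coprime c p"
    proof -
      have "coprime (1 + h) h" using coprime_one_plus_mult[of 1 h] by simp
      thus "coprime c N" "coprime c p" unfolding c_def using h(1)
        by (meson coprime_divisors dvd_refl dvd_mult_left dvd_mult_right)+
    qed
    have red: "(\<Sum>i<q1. zeta p ^ (c * \<tau> i) * y ^ (c * i)) = GS y" if "y ^ N = 1" for y
    proof -
      have c1: "[c = 1] (mod n)" if "n dvd h" for n
        using cong_add[OF cong_refl[of 1 n], of h 0] that by (simp add: c_def cong_0_iff)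
      have "zeta p ^ (c * \<tau> i) = zeta p ^ \<tau> i" for i
        using cong_scalar_right[OF c1[of p], of "\<tau> i"] h(1) p_prime
        by (intro power_eq_power_if_cong[of _ p]) (auto simp: prime_gt_0_nat dest: dvd_mult_right)
      moreover have "y ^ (c * i) = y ^ i" for i
        using cong_scalar_right[OF c1[of N], of i] h(1) that
        by (intro power_eq_power_if_cong[of _ N]) (auto dest: dvd_mult_left)
      ultimately show ?thesis by (simp add: GS_def)
    qed
    have "coprime c k" using h(2) by (simp add: c_def)
    hence "GS z = \<epsilon> ^ c * GS (-1)"
      using GS_galois[OF k(1) assms(1) k(2) assms(4) m1 assms(6) _ c]
      by (simp only: red[OF assms(4)] red[OF m1])
    hence "\<epsilon> ^ c = \<epsilon>" using assms(6,7) by simp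
    moreover have "\<epsilon> \<noteq> 0" using k by (auto simp: zero_power)
    ultimately have "\<epsilon> ^ h = 1" by (simp add: c_def)
    thus False using k_dvd h(3) by blast
  qed
  hence Np: "\<epsilon> ^ (N * p) = 1" using k(2) by (metis dvdE power_mult power_one)
  \<comment> \<open>Conjugating only \<open>zeta p\<close> multiplies Gauss sums by character
    values, which are N-th roots of unity. Hence \<epsilon>^N is fixed by an exponent that also
    inverts it, being a p-th root of unity; its square and its p-th power are 1, and p is
    odd.\<close>
  obtain c where c: "[c = 1] (mod N)" "[c = p - 1] (mod p)"
    using binary_chinese_remainder_nat[OF cop] by blast
  have c': "coprime c N" "coprime c p"
  proof -
    show "coprime c N" using c(1) by (metis cong_imp_coprime cong_sym coprime_1_left)
    have "coprime (p - 1) p" using p_gt_2 by (metis coprime_diff_one_left_nat order.strict_trans zero_less_numeral)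
    thus "coprime c p" using c(2) by (metis cong_imp_coprime cong_sym)
  qed
  have "\<not> p dvd c" using c'(2) p_prime by (meson coprime_common_divisor dvd_refl not_prime_unit)
  then obtain e where e: "\<forall>i. [\<tau> (i + e) = c * \<tau> i] (mod p)" using scale by blast
  have zc: "z ^ c = z" "(-1::complex) ^ c = -1"
    using power_eq_power_if_cong[OF assms(4) c(1)] power_eq_power_if_cong[OF m1 c(1)] by simp_all
  have "(-1) ^ (c * e) * GS (z ^ c) = \<epsilon> ^ c * z ^ (c * e) * GS ((-1) ^ c)"
    by (rule GS_galois_scaled[where k = "N * p" and n = N])
      (use assms c' e Np m1 p_prime prime_gt_0_nat in auto)
  hence "(-1) ^ (c * e) * (\<epsilon> * GS (-1)) = \<epsilon> ^ c * z ^ (c * e) * GS (-1)"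
    by (simp add: zc assms(6))
  hence "(-1) ^ (c * e) * \<epsilon> = \<epsilon> ^ c * z ^ (c * e)" using assms(7) by simp
  hence "((-1) ^ (c * e) * \<epsilon>) ^ N = (\<epsilon> ^ c * z ^ (c * e)) ^ N" by simp
  hence "((-1) ^ N) ^ (c * e) * \<epsilon> ^ N = (\<epsilon> ^ N) ^ c * (z ^ N) ^ (c * e)"
    by (simp only: power_mult_distrib power_mult [symmetric] mult_ac)
  hence d: "(\<epsilon> ^ N) ^ c = \<epsilon> ^ N" using assms(4) m1 by simp
  have "(\<epsilon> ^ N) ^ p = 1" using Np by (simp add: power_mult)
  hence "(\<epsilon> ^ N) ^ c = (\<epsilon> ^ N) ^ (p - 1)" using c(2) by (rule power_eq_power_if_cong)
  hence "\<epsilon> ^ N * \<epsilon> ^ N = (\<epsilon> ^ N) ^ (p - 1) * \<epsilon> ^ N" using d by simp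
  also have "\<dots> = 1" using \<open>(\<epsilon> ^ N) ^ p = 1\<close> p_gt_2 by (metis power_minus_mult zero_less_numeral order.strict_trans)
  finally have "(\<epsilon> ^ N) ^ 2 = 1" by (simp add: power2_eq_square)
  moreover have "(\<epsilon> ^ N) ^ p = ((\<epsilon> ^ N) ^ 2) ^ (p div 2) * \<epsilon> ^ N"
    using p_odd by (metis power_mult power_Suc2 odd_two_times_div_two_succ Suc_eq_plus1)
  ultimately show ?thesis using \<open>(\<epsilon> ^ N) ^ p = 1\<close> by simp
qed

text \<open>The two independent Galois actions, on \<open>\<zeta>\<^sub>N\<close> and on \<open>\<zeta>\<^sub>p\<close>.\<close>

lemma pure_ratio_galois:
  assumes "N > 0" "even N" "N dvd q1" "z ^ N = 1" "\<epsilon> ^ N = 1" "GS z = \<epsilon> * GS (-1)" "coprime c N"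
  shows "GS (z ^ c) = \<epsilon> ^ c * GS (-1)"
proof -
  have m1: "(-1::complex) ^ N = 1" using assms(2) by simp
  have cop: "coprime N p" using coprime_p_N assms(3) .
  obtain d where d: "[d = c] (mod N)" "[d = 1] (mod p)"
    using binary_chinese_remainder_nat[OF cop] by blast
  have d': "coprime d N" "coprime d p"
    using d assms(7) by (metis cong_imp_coprime cong_sym coprime_1_left)+
  have red: "(\<Sum>i<q1. zeta p ^ (d * \<tau> i) * y ^ (d * i)) = GS (y ^ c)" if "y ^ N = 1" for y
  proof -
    have "zeta p ^ (d * \<tau> i) = zeta p ^ \<tau> i" for i
      using d(2) p_prime cong_scalar_right[OF d(2), of "\<tau> i"]
      by (intro power_eq_power_if_cong[of _ p]) (auto simp: prime_gt_0_nat)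
    moreover have "y ^ (d * i) = (y ^ c) ^ i" for i
      using power_eq_power_if_cong[OF that d(1)] by (simp add: power_mult)
    ultimately show ?thesis by (simp add: GS_def)
  qed
  have "odd c" using assms(2,7) by (metis coprime_common_divisor odd_one)
  hence "GS ((-1) ^ c) = GS (-1)" by simp
  moreover have "\<epsilon> ^ d = \<epsilon> ^ c" using power_eq_power_if_cong[OF assms(5) d(1)] .
  ultimately show ?thesis
    using GS_galois[OF assms(1) assms(1) assms(5) assms(4) m1 assms(6) d'(1) d']
    by (simp only: red[OF assms(4)] red[OF m1])
qed

text \<open>An automorphism that is trivial on N-th roots of unity and raises \<open>zeta p\<close>
  to the power c fixes \<epsilon>, so both Gauss sums acquire the same factor. Thus a character with
  pure Gauss sum agrees with the quadratic character on the prime field.\<close>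

lemma pure_char_on_prime_field:
  assumes "N > 0" "even N" "N dvd q1" "z ^ N = 1" "\<epsilon> ^ N = 1" "GS z = \<epsilon> * GS (-1)"
    "GS (-1) \<noteq> 0" "\<not> p dvd c" "\<forall>i. [\<tau> (i + e) = c * \<tau> i] (mod p)"
  shows "z ^ e = (-1) ^ e"
proof -
  have m1: "(-1::complex) ^ N = 1" using assms(2) by simp
  have cop: "coprime N p" using coprime_p_N assms(3) .
  obtain d where d: "[d = 1] (mod N)" "[d = c] (mod p)"
    using binary_chinese_remainder_nat[OF cop] by blast
  have cp: "coprime c p" using assms(8) p_prime by (metis coprime_commute prime_imp_coprime)
  have d': "coprime d N" "coprime d p"
    using d cp by (metis cong_imp_coprime cong_sym coprime_1_left)+
  have "\<forall>i. [\<tau> (i + e) = d * \<tau> i] (mod p)"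
    using assms(9) d(2) by (meson cong_scalar_right cong_sym cong_trans)
  hence "(-1) ^ (d * e) * GS (z ^ d) = \<epsilon> ^ d * z ^ (d * e) * GS ((-1) ^ d)"
    by (intro GS_galois_scaled[where k = N and n = N]) (use assms d' m1 in auto)
  moreover have "z ^ d = z" "(-1::complex) ^ d = -1" "\<epsilon> ^ d = \<epsilon>"
    using power_eq_power_if_cong[OF assms(4) d(1)] power_eq_power_if_cong[OF m1 d(1)]
      power_eq_power_if_cong[OF assms(5) d(1)] by simp_all
  moreover have "\<epsilon> \<noteq> 0" using assms(1,5) by (auto simp: zero_power)
  ultimately show ?thesis using assms(6,7) by (simp add: power_mult)
qed

text \<open>The Gauss sums at z and z^p coincide because the trace is Frobenius invariant, while
  conjugation by p takes \<epsilon> to \<epsilon>^p.\<close>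

lemma pure_ratio_frobenius:
  assumes "N > 0" "even N" "N dvd q1" "z ^ N = 1" "\<epsilon> ^ N = 1" "GS z = \<epsilon> * GS (-1)" "GS (-1) \<noteq> 0"
  shows "\<epsilon> ^ p = \<epsilon>"
proof -
  have "coprime p N" using coprime_p_N[OF assms(3)] by (simp add: coprime_commute)
  hence "GS (z ^ p) = \<epsilon> ^ p * GS (-1)" by (intro pure_ratio_galois[OF assms(1-6)])
  moreover have "z ^ q1 = 1" using assms(3,4) by (auto simp: power_mult elim!: dvdE)
  ultimately show ?thesis using GS_frobenius assms(6,7) by simp
qed

text \<open>Modulo l the l^k-th power of a Gauss sum is taken term by term and so depends on z only
  through z^(l^k). The two ratios therefore have congruent l^k-th powers, once the factor
  \<open>GS (-1)\<close>, whose square is an integer prime to l, is accounted for. Their quotient is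
  a d-th root of unity with d prime to l, and distinct ones of these stay distinct modulo l.\<close>

lemma pure_ratio_cong:
  assumes "N > 0" "even N" "N dvd q1" "z ^ N = 1" "\<epsilon> ^ N = 1" "GS z = \<epsilon> * GS (-1)"
    and "y ^ N = 1" "\<delta> ^ N = 1" "GS y = \<delta> * GS (-1)"
    and l: "prime l" and yz: "z ^ (l ^ k) = y ^ (l ^ k)"
    and d: "N dvd l ^ k * d" "\<not> l dvd d"
    and Q: "GS (-1) ^ 2 = of_int Q" "\<not> int l dvd Q"
  shows "\<epsilon> ^ (l ^ k) = \<delta> ^ (l ^ k)"
proof (rule ccontr)
  define P where "P = l ^ k"
  assume "\<epsilon> ^ (l ^ k) \<noteq> \<delta> ^ (l ^ k)"
  hence neq: "\<epsilon> ^ P \<noteq> \<delta> ^ P" by (simp add: P_def)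
  define M where "M = N * p"
  have M: "M > 0" "p dvd M" using assms(1) p_prime by (auto simp: M_def prime_gt_0_nat)
  have zN: "zeta N = zeta M ^ p"
    using zeta_mult_power[of p N] p_prime by (simp add: M_def prime_gt_0_nat)
  have ex: "\<exists>a. x = zeta M ^ a" if "x ^ N = 1" for x
    using root_of_unity_eq_zeta_power[OF assms(1) that] zN by (metis power_mult)
  have delta_inv: "\<exists>a. inverse \<delta> ^ P = zeta M ^ a"
  proof -
    have "inverse \<delta> ^ N = 1" using assms(8) by (simp add: power_inverse)
    then obtain a where "inverse \<delta> = zeta M ^ a" using ex by blast
    hence "inverse \<delta> ^ P = zeta M ^ (a * P)" by (simp only: power_mult)
    thus ?thesis by blast
  qed
  obtain a b c where abc: "z = zeta M ^ a" "y = zeta M ^ b" "-1 = zeta M ^ c"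
    using ex[of z] ex[of y] ex[of "-1"] assms(2,4,7) by auto
  define F where "F = (\<lambda>a. \<Sum>i<q1. monom 1 (M div p * \<tau> i + a * i) :: int poly)"
  have F: "ipoly (F a) (zeta M) = GS x" if "x = zeta M ^ a" for a x
    unfolding F_def using GS_as_ipoly[OF M(2,1) that, of 1] by (simp add: GS_def)
  have expand: "\<exists>H. GS x ^ P = (\<Sum>i<q1. (zeta p ^ \<tau> i * x ^ i) ^ P) + of_nat l * ipoly H (zeta M)"
    if "x = zeta M ^ a" for a x
  proof -
    define t where "t = (\<lambda>i. monom 1 (M div p * \<tau> i + a * i) :: int poly)"
    have t: "ipoly (t i) (zeta M) = zeta p ^ \<tau> i * x ^ i" for i
    proof -
      have "zeta p = zeta M ^ (M div p)"
        using zeta_mult_power[of "M div p" p] M p_prime by (auto elim!: dvdE)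
      thus ?thesis using that by (simp add: t_def power_add power_mult [symmetric] mult_ac)
    qed
    obtain H where "(\<Sum>i<q1. t i) ^ P - (\<Sum>i<q1. t i ^ P) = of_nat l * H"
      using freshman_dream_sum_dvd[OF l, of "{..<q1}" t k] unfolding P_def by (auto elim!: dvdE)
    hence "ipoly ((\<Sum>i<q1. t i) ^ P - (\<Sum>i<q1. t i ^ P)) (zeta M) = ipoly (of_nat l * H) (zeta M)"
      by simp
    hence "GS x ^ P - (\<Sum>i<q1. (zeta p ^ \<tau> i * x ^ i) ^ P) = of_nat l * ipoly H (zeta M)"
      by (simp add: t GS_def)
    thus ?thesis by (intro exI[of _ H]) (simp add: algebra_simps)
  qed
  obtain H1 where H1: "GS z ^ P = (\<Sum>i<q1. (zeta p ^ \<tau> i * z ^ i) ^ P) + of_nat l * ipoly H1 (zeta M)"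
    using expand[OF abc(1)] by blast
  obtain H2 where H2: "GS y ^ P = (\<Sum>i<q1. (zeta p ^ \<tau> i * y ^ i) ^ P) + of_nat l * ipoly H2 (zeta M)"
    using expand[OF abc(2)] by blast
  have "(z ^ i) ^ P = (y ^ i) ^ P" for i
    using yz unfolding P_def by (metis mult.commute power_mult)
  hence sums: "(\<Sum>i<q1. (zeta p ^ \<tau> i * z ^ i) ^ P) = (\<Sum>i<q1. (zeta p ^ \<tau> i * y ^ i) ^ P)"
    by (simp only: power_mult_distrib)
  have "GS z ^ P - GS y ^ P = of_nat l * ipoly (H1 - H2) (zeta M)"
    unfolding H1 H2 sums by (simp add: right_diff_distrib)
  hence diff: "(\<epsilon> ^ P - \<delta> ^ P) * GS (-1) ^ P = of_nat l * ipoly (H1 - H2) (zeta M)"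
    by (simp only: assms(6,9) power_mult_distrib left_diff_distrib)
  define \<rho> where "\<rho> = \<epsilon> ^ P * inverse \<delta> ^ P"
  have d0: "\<delta> \<noteq> 0" using assms(1,8) by (auto simp: zero_power)
  have rho1: "\<rho> \<noteq> 1" using neq d0 by (auto simp: \<rho>_def field_simps power_inverse)
  have rhod: "\<rho> ^ d = 1"
  proof -
    have "x ^ (P * d) = 1" if "x ^ N = 1" for x :: complex
      using d(1) that unfolding P_def by (metis dvdE power_mult power_one)
    moreover have "(inverse \<delta>) ^ N = 1" using assms(8) by (simp add: power_inverse)
    ultimately show ?thesis using assms(5)
      by (simp add: \<rho>_def power_mult_distrib power_mult)
  qed
  obtain r where r: "\<rho> = zeta M ^ r"
  proof -
    obtain a1 where "\<epsilon> = zeta M ^ a1" using ex assms(5) by blast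
    moreover obtain a2 where "inverse \<delta> ^ P = zeta M ^ a2" using delta_inv by blast
    ultimately have "\<rho> = zeta M ^ (a1 * P + a2)" by (simp add: \<rho>_def power_add power_mult)
    thus ?thesis using that by blast
  qed
  \<comment> \<open>An explicit cofactor showing that \<rho> - 1 divides d in
    Z[\<open>zeta M\<close>].\<close>
  have geo: "(\<rho> - 1) * (\<Sum>j<d. of_nat j * \<rho> ^ j) = of_nat d"
  proof -
    have "(\<rho> - 1) * (\<Sum>j<n. of_nat j * \<rho> ^ j) = of_nat n * \<rho> ^ n - \<rho> * (\<Sum>j<n. \<rho> ^ j)" for n
      by (induction n) (simp_all add: algebra_simps)
    moreover have "(\<Sum>j<d. \<rho> ^ j) = 0" using rho1 rhod by (simp add: geometric_sum)
    ultimately show ?thesis using rhod by simp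
  qed
  obtain s where s: "inverse \<delta> ^ P = zeta M ^ s" using delta_inv by blast
  have sum_rho: "(\<Sum>j<d. of_nat j * \<rho> ^ j) = ipoly (\<Sum>j<d. of_nat j * monom 1 (r * j)) (zeta M)"
    by (simp add: r power_mult)
  \<comment> \<open>The cofactor in d Q^P = l \<open>ipoly W (zeta M)\<close>. The additional factor
    \<open>GS (-1) ^ P\<close> completes a square, so that the left side is a rational
    integer.\<close>
  define W where "W = monom 1 s * (\<Sum>j<d. of_nat j * monom 1 (r * j)) * F c ^ P * (H1 - H2)"
  have "of_int (int d * Q ^ P) = of_nat d * (GS (-1) ^ P * GS (-1) ^ P)"
    using Q(1) by (simp add: power_mult [symmetric] power_add [symmetric] mult_2_right flip: power2_eq_square)
      (metis mult.commute mult_2 power_mult of_int_power)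
  also have "\<dots> = (\<rho> - 1) * (\<Sum>j<d. of_nat j * \<rho> ^ j) * (GS (-1) ^ P * GS (-1) ^ P)"
    by (simp only: geo)
  also have "\<dots> = inverse \<delta> ^ P * (\<Sum>j<d. of_nat j * \<rho> ^ j) * GS (-1) ^ P * ((\<epsilon> ^ P - \<delta> ^ P) * GS (-1) ^ P)"
    using d0 by (simp add: \<rho>_def field_simps power_inverse)
  also have "\<dots> = inverse \<delta> ^ P * (\<Sum>j<d. of_nat j * \<rho> ^ j) * GS (-1) ^ P * (of_nat l * ipoly (H1 - H2) (zeta M))"
    by (simp only: diff)
  also have "\<dots> = of_int (int l) * ipoly W (zeta M)"
    unfolding W_def s sum_rho ipoly_mult ipoly_power F[OF abc(3)] by simp
  finally have "int l dvd int d * Q ^ P"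
    using M zeta_power_self by (intro dvd_of_eq_mult_ipoly[of M "zeta M" _ _ W]) auto
  moreover have "prime (int l)" using l by simp
  ultimately have "int l dvd int d \<or> int l dvd Q"
    using prime_dvd_mult_iff prime_dvd_power by blast
  thus False using d(2) Q(2) by simp
qed

end

section \<open>Generating functions of Frobenius-stable multisets\<close>

text \<open>Frobenius-stable multisets play the role of effective divisors of the affine line,
  \<open>orb k x\<close> that of the norm to the ground field of a point of degree dividing \<open>k\<close>.\<close>

locale stable_multisets =
  fixes \<phi> :: "'a \<Rightarrow> 'a"
  assumes inj_phi: "inj \<phi>" and finite_fixed: "\<And>k. k > 0 \<Longrightarrow> finite {x. (\<phi> ^^ k) x = x}"
begin

definition stable :: "'a multiset \<Rightarrow> bool" where
  "stable M \<longleftrightarrow> image_mset \<phi> M = M"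

definition orb :: "nat \<Rightarrow> 'a \<Rightarrow> 'a multiset" where
  "orb k x = image_mset (\<lambda>i. (\<phi> ^^ i) x) (mset_set {..<k})"

definition SM :: "nat \<Rightarrow> 'a multiset set" where
  "SM k = {M. stable M \<and> size M = k}"

definition Fix :: "nat \<Rightarrow> 'a set" where
  "Fix k = {x. (\<phi> ^^ k) x = x}"

lemma finite_Fix: "k > 0 \<Longrightarrow> finite (Fix k)"
  unfolding Fix_def by (rule finite_fixed)

lemma size_orb [simp]: "size (orb k x) = k"
  by (simp add: orb_def)

lemma orb_0 [simp]: "orb 0 x = {#}"
  by (simp add: orb_def)

lemma orb_Suc: "orb (Suc k) x = add_mset ((\<phi> ^^ k) x) (orb k x)"
  by (simp add: orb_def lessThan_Suc)

lemma orb_add: "orb (j + k) x = orb j x + orb k ((\<phi> ^^ j) x)"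
  by (induction k) (simp_all add: orb_Suc funpow_add[symmetric, THEN fun_cong, simplified] add.commute)

lemma image_mset_orb: "image_mset \<phi> (orb k x) = orb k (\<phi> x)"
  by (induction k) (simp_all add: orb_Suc funpow_swap1)

lemma stable_orb:
  assumes "(\<phi> ^^ k) x = x"
  shows "stable (orb k x)"
proof -
  have "add_mset x (image_mset \<phi> (orb k x)) = orb (1 + k) x"
    using orb_add[of 1 k x] by (simp add: image_mset_orb orb_Suc)
  also have "\<dots> = add_mset x (orb k x)" using assms by (simp add: orb_Suc)
  finally show ?thesis by (simp add: stable_def)
qed

lemma stable_empty [simp]: "stable {#}"
  by (simp add: stable_def)

lemma stable_add_iff: "stable M \<Longrightarrow> stable (M + M') \<longleftrightarrow> stable M'"
  by (simp add: stable_def)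

lemma count_stable:
  assumes "stable M"
  shows "count M (\<phi> x) = count M x"
proof -
  have "count (image_mset \<phi> M) (\<phi> x) = count M x"
    using inj_phi by (induction M) (auto dest: injD)
  thus ?thesis using assms by (simp add: stable_def)
qed

lemma count_stable_funpow: "stable M \<Longrightarrow> count M ((\<phi> ^^ i) x) = count M x"
  by (induction i) (simp_all add: count_stable)

lemma inj_funpow: "(\<phi> ^^ i) x = (\<phi> ^^ i) y \<Longrightarrow> x = y"
  using inj_phi by (induction i) (auto dest: injD)

text \<open>A stable finite multiset contains the whole forward orbit of each member, so the orbit
  is finite, and injectivity makes it purely periodic.\<close>

lemma period_exists:
  assumes "stable M" "x \<in># M"
  obtains d where "0 < d" "\<And>k. (\<phi> ^^ k) x = x \<longleftrightarrow> d dvd k" "inj_on (\<lambda>i. (\<phi> ^^ i) x) {..<d}"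
proof -
  have mem: "(\<phi> ^^ i) x \<in># M" for i
    using count_stable_funpow[OF assms(1), of i x] assms(2) by (metis count_greater_zero_iff)
  have "\<not> inj (\<lambda>i. (\<phi> ^^ i) x)"
  proof
    assume "inj (\<lambda>i. (\<phi> ^^ i) x)"
    hence "infinite (range (\<lambda>i. (\<phi> ^^ i) x))" by (simp add: finite_image_iff)
    moreover have "range (\<lambda>i. (\<phi> ^^ i) x) \<subseteq> set_mset M" using mem by auto
    ultimately show False using finite_subset finite_set_mset by blast
  qed
  have shift: "(\<phi> ^^ (j - i)) x = x" if "(\<phi> ^^ i) x = (\<phi> ^^ j) x" "i < j" for i j
  proof -
    have "(\<phi> ^^ i) ((\<phi> ^^ (j - i)) x) = (\<phi> ^^ i) x"
      using that by (simp add: funpow_add[symmetric, THEN fun_cong, simplified])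
    thus ?thesis by (rule inj_funpow)
  qed
  obtain i j where ij: "i < j" "(\<phi> ^^ i) x = (\<phi> ^^ j) x"
  proof -
    obtain a b where "(\<phi> ^^ a) x = (\<phi> ^^ b) x" "a \<noteq> b"
      using \<open>\<not> inj _\<close> by (auto simp: inj_def)
    thus ?thesis using that[of a b] that[of b a] by (cases "a < b") auto
  qed
  define d where "d = (LEAST d. d > 0 \<and> (\<phi> ^^ d) x = x)"
  have "\<exists>d. d > 0 \<and> (\<phi> ^^ d) x = x" using shift[OF ij(2,1)] ij(1) by (intro exI[of _ "j - i"]) auto
  from LeastI_ex[OF this] have d: "d > 0" "(\<phi> ^^ d) x = x" unfolding d_def by auto
  have mult: "(\<phi> ^^ (d * k)) x = x" for k
    using d(2) by (induction k) (simp_all add: funpow_add)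
  have least: "\<not> (0 < k \<and> k < d \<and> (\<phi> ^^ k) x = x)" for k
    unfolding d_def using not_less_Least by blast
  have "(\<phi> ^^ k) x = x \<longleftrightarrow> d dvd k" for k
  proof
    assume k: "(\<phi> ^^ k) x = x"
    have "(\<phi> ^^ k) x = (\<phi> ^^ (k mod d)) ((\<phi> ^^ (d * (k div d))) x)"
      by (simp add: funpow_add[symmetric, THEN fun_cong, simplified])
    hence "(\<phi> ^^ (k mod d)) x = x" using k mult by simp
    hence "k mod d = 0" using least[of "k mod d"] d(1) by auto
    thus "d dvd k" by blast
  qed (auto simp: mult elim!: dvdE)
  moreover have "inj_on (\<lambda>i. (\<phi> ^^ i) x) {..<d}"
  proof (rule inj_onI)
    fix a b assume ab: "a \<in> {..<d}" "b \<in> {..<d}" "(\<phi> ^^ a) x = (\<phi> ^^ b) x"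
    show "a = b"
    proof (rule ccontr)
      assume "a \<noteq> b"
      hence "a < b \<or> b < a" by auto
      thus False using shift[of a b] shift[of b a] ab least[of "b - a"] least[of "a - b"] by auto
    qed
  qed
  ultimately show ?thesis using that d(1) by blast
qed

text \<open>If d is the period of x, the admissible k are the multiples d j, and
  \<open>orb (d * j) x\<close> consists of j copies of \<open>orb d x\<close>. It fits into
  \<open>M\<close> exactly for j up to \<open>count M x\<close>, as stability makes the multiplicity
  constant on the orbit.\<close>

lemma card_orbits_containing:
  assumes "stable M" "x \<in># M"
  shows "card {k \<in> {1..size M}. x \<in> Fix k \<and> orb k x \<subseteq># M} = count M x"
proof -
  obtain d where d: "0 < d" "\<And>k. (\<phi> ^^ k) x = x \<longleftrightarrow> d dvd k" "inj_on (\<lambda>i. (\<phi> ^^ i) x) {..<d}"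
    using period_exists[OF assms] by metis
  have orb_mult: "orb (d * j) x = repeat_mset j (orb d x)" for j
  proof (induction j)
    case (Suc j)
    have "orb (d * Suc j) x = orb d x + orb (d * j) ((\<phi> ^^ d) x)"
      using orb_add[of d "d * j" x] by (simp add: algebra_simps)
    thus ?case using Suc d(2)[of d] by simp
  qed simp
  have count_orb: "count (orb d x) y = (if \<exists>i<d. y = (\<phi> ^^ i) x then 1 else 0)" for y
  proof -
    have "orb d x = mset_set ((\<lambda>i. (\<phi> ^^ i) x) ` {..<d})"
      unfolding orb_def by (rule image_mset_mset_set[OF d(3)])
    thus ?thesis by (auto simp: count_mset_set')
  qed
  have sub: "orb (d * j) x \<subseteq># M \<longleftrightarrow> j \<le> count M x" for j
  proof
    assume "orb (d * j) x \<subseteq># M"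
    hence "count (orb (d * j) x) x \<le> count M x" by (simp add: subseteq_mset_def)
    moreover have "\<exists>i<d. x = (\<phi> ^^ i) x" using d(1) by (intro exI[of _ 0]) simp
    ultimately show "j \<le> count M x" using orb_mult count_orb[of x] by simp
  next
    assume "j \<le> count M x"
    thus "orb (d * j) x \<subseteq># M"
      unfolding subseteq_mset_def orb_mult using count_orb count_stable_funpow[OF assms(1)]
      by auto
  qed
  have "{k \<in> {1..size M}. x \<in> Fix k \<and> orb k x \<subseteq># M} = (\<lambda>j. d * j) ` {1..count M x}"
  proof (intro equalityI subsetI)
    fix k assume k: "k \<in> {k \<in> {1..size M}. x \<in> Fix k \<and> orb k x \<subseteq># M}"
    then obtain j where "k = d * j" using d(2) by (auto simp: Fix_def elim: dvdE)
    thus "k \<in> (\<lambda>j. d * j) ` {1..count M x}" using k sub[of j] by (intro image_eqI[of _ _ j]) (cases j; simp)+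
  next
    fix k assume "k \<in> (\<lambda>j. d * j) ` {1..count M x}"
    then obtain j where j: "k = d * j" "1 \<le> j" "j \<le> count M x" by (metis imageE atLeastAtMost_iff)
    have "orb k x \<subseteq># M" using sub j by simp
    moreover from this have "k \<le> size M" using size_mset_mono by fastforce
    ultimately show "k \<in> {k \<in> {1..size M}. x \<in> Fix k \<and> orb k x \<subseteq># M}"
      using j d(1) d(2)[of k] by (auto simp: Fix_def)
  qed
  moreover have "inj_on (\<lambda>j. d * j) {1..count M x}" using d(1) by (auto intro: inj_onI)
  ultimately show ?thesis by (simp add: card_image)
qed

lemma finite_SM: "finite (SM n)"
proof -
  define B where "B = (\<Union>k\<in>{1..n}. Fix k)"
  have "finite B" unfolding B_def using finite_Fix by auto
  have "SM n \<subseteq> multisets_of_size B n"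
  proof
    fix M assume "M \<in> SM n"
    hence M: "stable M" "size M = n" by (auto simp: SM_def)
    have "x \<in> B" if "x \<in># M" for x
    proof -
      have "card {k \<in> {1..size M}. x \<in> Fix k \<and> orb k x \<subseteq># M} > 0"
        using card_orbits_containing[OF M(1) that] that by simp
      hence "{k \<in> {1..size M}. x \<in> Fix k \<and> orb k x \<subseteq># M} \<noteq> {}"
        unfolding card_gt_0_iff by blast
      thus ?thesis using M(2) by (auto simp: B_def)
    qed
    thus "M \<in> multisets_of_size B n" using M(2) by (auto simp: multisets_of_size_def)
  qed
  thus ?thesis using \<open>finite B\<close> finite_multisets_of_size finite_subset by blast
qed

text \<open>The coefficients of the L-series of \<open>lam\<close>; those of its logarithmic
  derivative are the sums \<open>Sp\<close> over points of degree dividing k.\<close>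

definition Lam :: "('a multiset \<Rightarrow> complex) \<Rightarrow> nat \<Rightarrow> complex" where
  "Lam lam k = (\<Sum>M\<in>SM k. lam M)"

definition Sp :: "('a multiset \<Rightarrow> complex) \<Rightarrow> nat \<Rightarrow> complex" where
  "Sp lam k = (\<Sum>x\<in>Fix k. lam (orb k x))"

text \<open>Double counting of pairs consisting of a stable M of size n and an orbit contained in
  it: by \<open>card_orbits_containing\<close> the element x contributes \<open>count M x\<close> of
  them, and these multiplicities add up to n. No factorization into primes is needed.\<close>

theorem Lam_recursion:
  assumes mult: "\<And>M M'. stable M \<Longrightarrow> stable M' \<Longrightarrow> lam (M + M') = lam M * lam M'"
  shows "of_nat n * Lam lam n = (\<Sum>k=1..n. Sp lam k * Lam lam (n - k))"
proof -
  have inner: "(\<Sum>M'\<in>SM (n - k). lam (orb k x) * lam M') =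
      (\<Sum>M\<in>SM n. if orb k x \<subseteq># M then lam M else 0)"
    if k: "k \<in> {1..n}" and x: "x \<in> Fix k" for k x
  proof -
    have st: "stable (orb k x)" using x by (intro stable_orb) (simp add: Fix_def)
    have "(\<Sum>M\<in>SM n. if orb k x \<subseteq># M then lam M else 0) = (\<Sum>M\<in>{M\<in>SM n. orb k x \<subseteq># M}. lam M)"
      using finite_SM by (simp add: sum.inter_filter)
    also have "\<dots> = (\<Sum>M'\<in>SM (n - k). lam (orb k x + M'))"
    proof (rule sum.reindex_bij_witness[where i = "\<lambda>M'. orb k x + M'" and j = "\<lambda>M. M - orb k x"])
      fix M assume M: "M \<in> {M \<in> SM n. orb k x \<subseteq># M}"
      show "orb k x + (M - orb k x) = M" using M by simp
      thus "M - orb k x \<in> SM (n - k)"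
        using M stable_add_iff[OF st, of "M - orb k x"] by (auto simp: SM_def size_Diff_submset)
      show "lam (orb k x + (M - orb k x)) = lam M" using M by simp
    next
      fix M' assume M': "M' \<in> SM (n - k)"
      show "orb k x + M' - orb k x = M'" by simp
      show "orb k x + M' \<in> {M \<in> SM n. orb k x \<subseteq># M}"
        using M' k stable_add_iff[OF st, of M'] by (auto simp: SM_def)
    qed
    also have "\<dots> = (\<Sum>M'\<in>SM (n - k). lam (orb k x) * lam M')"
      using mult[OF st] by (intro sum.cong) (auto simp: SM_def)
    finally show ?thesis by simp
  qed
  have "(\<Sum>k=1..n. Sp lam k * Lam lam (n - k)) =
        (\<Sum>k=1..n. \<Sum>x\<in>Fix k. \<Sum>M\<in>SM n. if orb k x \<subseteq># M then lam M else 0)"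
    unfolding Sp_def Lam_def using inner
    by (intro sum.cong refl) (simp add: sum_product)
  also have "\<dots> = (\<Sum>k=1..n. \<Sum>M\<in>SM n. \<Sum>x\<in>Fix k. if orb k x \<subseteq># M then lam M else 0)"
    by (intro sum.cong refl sum.swap)
  also have "\<dots> = (\<Sum>M\<in>SM n. \<Sum>k=1..n. \<Sum>x\<in>Fix k. if orb k x \<subseteq># M then lam M else 0)"
    by (rule sum.swap)
  also have "\<dots> = (\<Sum>M\<in>SM n. of_nat n * lam M)"
  proof (rule sum.cong[OF refl])
    fix M assume "M \<in> SM n"
    hence M: "stable M" "size M = n" by (auto simp: SM_def)
    have "(\<Sum>x\<in>Fix k. if orb k x \<subseteq># M then lam M else 0) =
          (\<Sum>x\<in>set_mset M. if x \<in> Fix k \<and> orb k x \<subseteq># M then lam M else 0)"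
      if k: "k \<in> {1..n}" for k
    proof -
      have "x \<in># M" if "orb k x \<subseteq># M" for x
      proof -
        have "x \<in># orb k x" unfolding orb_def using k
          by (auto intro!: image_eqI[of _ _ 0])
        thus ?thesis using that by (rule mset_subset_eqD[rotated])
      qed
      thus ?thesis using finite_Fix[of k] k
        by (simp add: sum.If_cases) (intro disjI2 arg_cong[of _ _ card], auto)
    qed
    hence "(\<Sum>k=1..n. \<Sum>x\<in>Fix k. if orb k x \<subseteq># M then lam M else 0) =
       (\<Sum>k=1..n. \<Sum>x\<in>set_mset M. if x \<in> Fix k \<and> orb k x \<subseteq># M then lam M else 0)"
      by (rule sum.cong[OF refl])
    also have "\<dots> = (\<Sum>x\<in>set_mset M. \<Sum>k=1..n. if x \<in> Fix k \<and> orb k x \<subseteq># M then lam M else 0)"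
      by (rule sum.swap)
    also have "\<dots> = (\<Sum>x\<in>set_mset M. of_nat (count M x) * lam M)"
    proof (rule sum.cong[OF refl])
      fix x assume x: "x \<in># M"
      have "(\<Sum>k=1..n. if x \<in> Fix k \<and> orb k x \<subseteq># M then lam M else 0) =
            (\<Sum>k\<in>{k\<in>{1..n}. x \<in> Fix k \<and> orb k x \<subseteq># M}. lam M)"
        by (rule sum.inter_filter[symmetric]) simp
      also have "\<dots> = of_nat (count M x) * lam M"
        using card_orbits_containing[OF M(1) x] M(2) by simp
      finally show "(\<Sum>k=1..n. if x \<in> Fix k \<and> orb k x \<subseteq># M then lam M else 0) = of_nat (count M x) * lam M" .
    qed
    also have "\<dots> = of_nat (size M) * lam M"
      by (simp add: size_multiset_overloaded_eq sum_distrib_right)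
    finally show "(\<Sum>k=1..n. \<Sum>x\<in>Fix k. if orb k x \<subseteq># M then lam M else 0) = of_nat n * lam M"
      using M(2) by simp
  qed
  finally show ?thesis by (simp add: Lam_def sum_distrib_left)
qed

lemma Lam_0: "Lam lam 0 = lam {#}"
proof -
  have "SM 0 = {{#}}" by (auto simp: SM_def)
  thus ?thesis by (simp add: Lam_def)
qed

lemma Lam_fps_deriv:
  assumes "\<And>M M'. stable M \<Longrightarrow> stable M' \<Longrightarrow> lam (M + M') = lam M * lam M'"
  shows "fps_deriv (Abs_fps (Lam lam)) = Abs_fps (\<lambda>k. Sp lam (Suc k)) * Abs_fps (Lam lam)"
proof (rule fps_ext)
  fix n
  have "fps_deriv (Abs_fps (Lam lam)) $ n = of_nat (Suc n) * Lam lam (Suc n)" by simp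
  also have "\<dots> = (\<Sum>k=1..Suc n. Sp lam k * Lam lam (Suc n - k))" by (rule Lam_recursion[OF assms])
  also have "\<dots> = (\<Sum>k=0..n. Sp lam (Suc k) * Lam lam (n - k))"
    by (simp only: One_nat_def sum.shift_bounds_cl_Suc_ivl diff_Suc_Suc)
  finally show "fps_deriv (Abs_fps (Lam lam)) $ n = (Abs_fps (\<lambda>k. Sp lam (Suc k)) * Abs_fps (Lam lam)) $ n"
    by (simp add: fps_mult_nth)
qed

end

text \<open>In characteristic zero the differential equation determines each coefficient from the
  earlier ones. Identities of L-series thereby reduce to identities of the sums
  \<open>Sp\<close>.\<close>

lemma fps_log_deriv_unique:
  fixes f g s :: "complex fps"
  assumes "fps_deriv f = s * f" "fps_deriv g = s * g" "f $ 0 = g $ 0"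
  shows "f = g"
proof (rule fps_ext)
  fix n show "f $ n = g $ n"
  proof (induction n rule: less_induct)
    case (less n)
    show ?case
    proof (cases n)
      case (Suc k)
      have "of_nat (Suc k) * f $ Suc k = (\<Sum>i=0..k. s $ i * f $ (k - i))"
        using arg_cong[OF assms(1), of "\<lambda>h. h $ k"] by (simp add: fps_mult_nth)
      also have "\<dots> = (\<Sum>i=0..k. s $ i * g $ (k - i))"
        using less Suc by (intro sum.cong) auto
      also have "\<dots> = of_nat (Suc k) * g $ Suc k"
        using arg_cong[OF assms(2), of "\<lambda>h. h $ k"] by (simp add: fps_mult_nth)
      finally have "of_nat (Suc k) * (f $ Suc k) = of_nat (Suc k) * (g $ Suc k)" .
      moreover have "(of_nat (Suc k) :: complex) \<noteq> 0" by (rule of_nat_neq_0)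
      ultimately show ?thesis unfolding Suc using mult_left_cancel by blast
    qed (simp add: assms(3))
  qed
qed

lemma fps_log_deriv_prod:
  fixes f s :: "'i \<Rightarrow> complex fps"
  assumes "finite A" "\<And>i. i \<in> A \<Longrightarrow> fps_deriv (f i) = s i * f i"
  shows "fps_deriv (\<Prod>i\<in>A. f i) = (\<Sum>i\<in>A. s i) * (\<Prod>i\<in>A. f i)"
  using assms by (induction A) (simp_all add: algebra_simps)

section \<open>The Davenport--Hasse lifting theorem\<close>

definition mpoly :: "'a::comm_ring_1 multiset \<Rightarrow> 'a poly" where
  "mpoly M = (\<Prod>x\<in>#M. [:- x, 1:])"

lemma mpoly_empty [simp]: "mpoly {#} = 1"
  and mpoly_add_mset [simp]: "mpoly (add_mset x M) = [:- x, 1:] * mpoly M"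
  by (simp_all add: mpoly_def)

lemma
  fixes M :: "'a::idom multiset"
  shows lead_coeff_mpoly [simp]: "lead_coeff (mpoly M) = 1"
    and degree_mpoly [simp]: "degree (mpoly M) = size M"
proof -
  have "lead_coeff (mpoly M) = 1 \<and> degree (mpoly M) = size M"
  proof (induction M)
    case (add x M)
    hence "mpoly M \<noteq> 0" by auto
    hence "degree ([:- x, 1:] * mpoly M) = 1 + size M" using add by (subst degree_mult_eq) auto
    moreover have "lead_coeff ([:- x, 1:] * mpoly M) = 1" using add by (subst lead_coeff_mult) auto
    ultimately show ?case by (simp del: mult_pCons_left)
  qed simp
  thus "lead_coeff (mpoly M) = 1" "degree (mpoly M) = size M" by auto
qed

lemma mpoly_nonzero [simp]: "mpoly (M :: 'a::idom multiset) \<noteq> 0"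
  using lead_coeff_mpoly[of M] by fastforce

lemma proots_mpoly [simp]: "proots (mpoly (M :: 'a::idom multiset)) = M"
  by (induction M) (simp_all add: proots_mult del: mult_pCons_left)

lemma coeff_0_mpoly: "coeff (mpoly (M :: 'a::idom multiset)) 0 = (- 1) ^ size M * prod_mset M"
  by (induction M) (simp_all add: coeff_mult_0 del: mult_pCons_left)

lemma coeff_subleading_mpoly:
  "M \<noteq> {#} \<Longrightarrow> coeff (mpoly (M :: 'a::idom multiset)) (size M - 1) = - sum_mset M"
proof (induction M)
  case (add x M)
  have lc: "coeff (mpoly M) (size M) = 1" using lead_coeff_mpoly[of M] by simp
  show ?case
  proof (cases "M = {#}")
    case False
    hence "coeff (mpoly (add_mset x M)) (size (add_mset x M) - 1) = - x * coeff (mpoly M) (size M) + coeff (mpoly M) (size M - 1)"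
      by (cases "size M") (simp_all add: coeff_pCons)
    thus ?thesis using add False lc by simp
  qed simp
qed simp

lemma mpoly_surj:
  fixes g :: "'a::alg_closed_field poly"
  assumes "lead_coeff g = 1"
  obtains M where "mpoly M = g" "size M = degree g"
proof -
  have "g \<noteq> 0" using assms by auto
  then obtain A where "size A = degree g" "g = smult (lead_coeff g) (\<Prod>x\<in>#A. [:-x, 1:])"
    using alg_closed_imp_factorization by blast
  thus ?thesis using that[of A] assms by (simp add: mpoly_def)
qed

text \<open>The model is the q-power Frobenius of an algebraic closure. The fixed points of its k-th
  iterate are then the extension of degree k of the ground field.\<close>

locale field_endo =
  fixes \<phi> :: "'a::alg_closed_field \<Rightarrow> 'a"
  assumes phi_1 [simp]: "\<phi> 1 = 1" and phi_add: "\<phi> (x + y) = \<phi> x + \<phi> y"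
    and phi_mult: "\<phi> (x * y) = \<phi> x * \<phi> y"
    and finite_fix: "\<And>k. k > 0 \<Longrightarrow> finite {x. (\<phi> ^^ k) x = x}"
begin

lemma phi_0 [simp]: "\<phi> 0 = 0"
  using phi_add[of 0 0] by (metis add_cancel_right_left add.right_neutral)

lemma phi_minus: "\<phi> (- x) = - \<phi> x"
  using phi_add[of x "- x"] by (simp add: eq_neg_iff_add_eq_0 add.commute)

lemma phi_diff: "\<phi> (x - y) = \<phi> x - \<phi> y"
  using phi_add[of x "- y"] by (simp add: phi_minus)

lemma phi_eq_0_iff [simp]: "\<phi> x = 0 \<longleftrightarrow> x = 0"
proof
  assume "\<phi> x = 0"
  show "x = 0"
  proof (rule ccontr)
    assume "x \<noteq> 0"
    hence "\<phi> x * \<phi> (inverse x) = 1" by (simp flip: phi_mult)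
    thus False using \<open>\<phi> x = 0\<close> by simp
  qed
qed simp

sublocale stable_multisets \<phi>
proof
  show "inj \<phi>"
  proof (rule injI)
    fix x y assume "\<phi> x = \<phi> y"
    hence "\<phi> (x + - y) = 0" by (simp only: phi_add phi_minus) simp
    thus "x = y" by simp
  qed
qed (rule finite_fix)

definition K :: "'a set" where "K = {x. \<phi> x = x}"

lemma K_closed:
  "0 \<in> K" "1 \<in> K" "x \<in> K \<Longrightarrow> y \<in> K \<Longrightarrow> x + y \<in> K" "x \<in> K \<Longrightarrow> - x \<in> K"
  "x \<in> K \<Longrightarrow> y \<in> K \<Longrightarrow> x * y \<in> K"
  by (auto simp: K_def phi_add phi_minus phi_mult)

lemma K_power: "x \<in> K \<Longrightarrow> x ^ n \<in> K"
  by (induction n) (auto intro: K_closed)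

definition PK :: "nat \<Rightarrow> 'a poly set" where
  "PK k = {g. lead_coeff g = 1 \<and> degree g = k \<and> (\<forall>i. coeff g i \<in> K)}"

lemma map_poly_mpoly: "map_poly \<phi> (mpoly M) = mpoly (image_mset \<phi> M)"
proof (induction M)
  case (add x M)
  have "map_poly \<phi> ([:- x, 1:] * g) = [:- \<phi> x, 1:] * map_poly \<phi> g" for g
    by (rule poly_eqI) (auto simp: coeff_map_poly coeff_pCons phi_diff phi_minus phi_mult split: nat.splits)
  thus ?case using add by simp
qed (simp add: one_pCons map_poly_pCons)

text \<open>Applying \<phi> to the coefficients of a monic polynomial applies it to the roots, so
  the coefficients lie in \<open>K\<close> exactly when the multiset of roots is stable.\<close>

lemma bij_betw_mpoly: "bij_betw mpoly (SM k) (PK k)"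
proof (rule bij_betw_imageI)
  show "inj_on mpoly (SM k)" by (rule inj_onI) (metis proots_mpoly)
  have "mpoly M \<in> PK k" if "M \<in> SM k" for M
  proof -
    have M: "image_mset \<phi> M = M" "size M = k" using that by (auto simp: SM_def stable_def)
    have "coeff (map_poly \<phi> (mpoly M)) i = coeff (mpoly M) i" for i by (simp add: map_poly_mpoly M)
    thus ?thesis using M(2) lead_coeff_mpoly[of M] by (simp add: PK_def K_def coeff_map_poly)
  qed
  moreover have "g \<in> mpoly ` SM k" if "g \<in> PK k" for g
  proof -
    have g: "lead_coeff g = 1" "degree g = k" "\<And>i. \<phi> (coeff g i) = coeff g i"
      using that by (auto simp: PK_def K_def)
    obtain M where M: "mpoly M = g" "size M = degree g" using mpoly_surj[OF g(1)] by blast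
    have "map_poly \<phi> g = g" by (rule poly_eqI) (simp add: coeff_map_poly g(3))
    hence "mpoly (image_mset \<phi> M) = mpoly M" using map_poly_mpoly[of M] M(1) by simp
    hence "image_mset \<phi> M = M" by (metis proots_mpoly)
    thus ?thesis using M g(2) by (auto simp: SM_def stable_def)
  qed
  ultimately show "mpoly ` SM k = PK k" by blast
qed

lemma Lam_eq_sum_PK:
  "Lam lam k = (\<Sum>g\<in>PK k. lam (proots g))"
  unfolding Lam_def by (rule sum.reindex_bij_betw[OF bij_betw_mpoly, of "\<lambda>g. lam (proots g)" k, simplified])

lemma sum_prod_roots_in_K:
  assumes "stable M"
  shows "sum_mset M \<in> K" "prod_mset M \<in> K"
proof -
  have "\<phi> (sum_mset M) = sum_mset (image_mset \<phi> M)" for M by (induction M) (simp_all add: phi_add)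
  moreover have "\<phi> (prod_mset M) = prod_mset (image_mset \<phi> M)" for M
    by (induction M) (simp_all add: phi_mult)
  ultimately show "sum_mset M \<in> K" "prod_mset M \<in> K"
    using assms by (simp_all add: stable_def K_def)
qed

lemma sum_pow_roots_in_K:
  assumes "stable M"
  shows "(\<Sum>x\<in>#M. x ^ n) \<in> K"
proof -
  have pow: "\<phi> (x ^ n) = \<phi> x ^ n" for x n by (induction n) (simp_all add: phi_mult)
  have "\<phi> (\<Sum>x\<in>#M. x ^ n) = (\<Sum>x\<in>#image_mset \<phi> M. x ^ n)" for M
    by (induction M) (simp_all add: phi_add pow)
  thus ?thesis using assms by (simp add: stable_def K_def)
qed

text \<open>Multiplicativity includes the argument 0, so that \<chi> vanishes at 0 unless it is
  constantly 1 on \<open>K\<close>. Both kinds occur: the constant one enters the product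
  formula.\<close>

definition chi_mult :: "('a \<Rightarrow> complex) \<Rightarrow> bool" where
  "chi_mult \<chi> \<longleftrightarrow> \<chi> 1 = 1 \<and> (\<forall>x\<in>K. \<forall>y\<in>K. \<chi> (x * y) = \<chi> x * \<chi> y)"

definition psi_add :: "('a \<Rightarrow> complex) \<Rightarrow> bool" where
  "psi_add \<psi> \<longleftrightarrow> \<psi> 0 = 1 \<and> (\<forall>x\<in>K. \<forall>y\<in>K. \<psi> (x + y) = \<psi> x * \<psi> y) \<and> (\<exists>d\<in>K. \<psi> d \<noteq> 1)"

text \<open>Translating the subleading coefficient multiplies the summand by a constant, which may be
  chosen different from \<open>1\<close>; this does not disturb the norm if the degree is at least \<open>2\<close>.\<close>

lemma sum_PK_translate:
  assumes psi: "psi_add \<psi>" and k: "k \<ge> 1"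
    and h: "\<And>g d. g \<in> PK k \<Longrightarrow> h (g + monom d (k - 1)) = h g"
  shows "(\<Sum>g\<in>PK k. \<psi> (- coeff g (k - 1)) * h g) = 0"
proof -
  obtain d where d: "d \<in> K" "\<psi> d \<noteq> 1" using psi by (auto simp: psi_add_def)
  define d' where "d' = - d"
  have dK: "d' \<in> K" using d K_closed by (simp add: d'_def)
  have mem: "g + monom c (k - 1) \<in> PK k" if "g \<in> PK k" "c \<in> K" for g c
  proof -
    have "degree (monom c (k - 1)) < degree g"
      using that(1) k by (auto simp: PK_def intro: le_less_trans[OF degree_monom_le])
    thus ?thesis using that
      by (auto simp: PK_def lead_coeff_add_le degree_add_eq_left K_closed coeff_eq_0)
  qed
  let ?S = "\<Sum>g\<in>PK k. \<psi> (- coeff g (k - 1)) * h g"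
  have "?S = (\<Sum>g\<in>PK k. \<psi> (- coeff (g + monom d' (k - 1)) (k - 1)) * h (g + monom d' (k - 1)))"
    by (rule sum.reindex_bij_witness[where j = "\<lambda>g. g + monom d (k - 1)" and i = "\<lambda>g. g + monom d' (k - 1)"])
      (use mem d dK in \<open>auto simp: d'_def add.assoc add_monom\<close>)
  also have "\<dots> = (\<Sum>g\<in>PK k. \<psi> d * (\<psi> (- coeff g (k - 1)) * h g))"
  proof (rule sum.cong[OF refl])
    fix g assume g: "g \<in> PK k"
    have "\<psi> (d + - coeff g (k - 1)) = \<psi> d * \<psi> (- coeff g (k - 1))"
      using psi d(1) K_closed(4)[of "coeff g (k - 1)"] g unfolding psi_add_def PK_def by blast
    moreover have "- coeff (g + monom d' (k - 1)) (k - 1) = d + - coeff g (k - 1)" by (simp add: d'_def)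
    ultimately show "\<psi> (- coeff (g + monom d' (k - 1)) (k - 1)) * h (g + monom d' (k - 1)) =
        \<psi> d * (\<psi> (- coeff g (k - 1)) * h g)"
      using h[OF g] by simp
  qed
  also have "\<dots> = \<psi> d * ?S" by (simp add: sum_distrib_left)
  finally have "(1 - \<psi> d) * ?S = 0" by (simp add: algebra_simps)
  thus ?thesis using d(2) by simp
qed

text \<open>In terms of the monic polynomial with root multiset M, this is \<psi> at minus the
  subleading coefficient times \<chi> at the constant coefficient up to sign: the classical
  multiplicative function with L-series 1 + G X, where G is the Gauss sum.\<close>

definition lamc :: "('a \<Rightarrow> complex) \<Rightarrow> ('a \<Rightarrow> complex) \<Rightarrow> 'a multiset \<Rightarrow> complex" where
  "lamc \<psi> \<chi> M = \<psi> (sum_mset M) * \<chi> (prod_mset M)"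

lemma lamc_mult:
  assumes "psi_add \<psi>" "chi_mult \<chi>" "stable M" "stable M'"
  shows "lamc \<psi> \<chi> (M + M') = lamc \<psi> \<chi> M * lamc \<psi> \<chi> M'"
  using assms sum_prod_roots_in_K[of M] sum_prod_roots_in_K[of M']
  by (simp add: lamc_def psi_add_def chi_mult_def)

lemma Lam_lamc:
  assumes "k \<ge> 1"
  shows "Lam (lamc \<psi> \<chi>) k = (\<Sum>g\<in>PK k. \<psi> (- coeff g (k - 1)) * \<chi> ((- 1) ^ k * coeff g 0))"
proof -
  have "lamc \<psi> \<chi> M = \<psi> (- coeff (mpoly M) (k - 1)) * \<chi> ((- 1) ^ k * coeff (mpoly M) 0)" if "M \<in> SM k" for M
  proof -
    have k: "size M = k" using that by (simp add: SM_def)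
    hence "M \<noteq> {#}" using assms by auto
    hence "- coeff (mpoly M) (k - 1) = sum_mset M" using coeff_subleading_mpoly[of M] k by simp
    moreover have "(- 1) ^ k * coeff (mpoly M) 0 = prod_mset M"
      using k by (simp add: coeff_0_mpoly power_mult_distrib[symmetric] mult.assoc[symmetric])
    ultimately show ?thesis by (simp add: lamc_def)
  qed
  thus ?thesis unfolding Lam_def
    by (simp add: sum.reindex_bij_betw[OF bij_betw_mpoly, symmetric])
qed

text \<open>From degree 2 on the subleading coefficient varies independently of the constant one. In
  degree 1 they are the same coefficient, which is harmless only when \<chi> is constant.\<close>

lemma Lam_lamc_vanish:
  assumes "psi_add \<psi>" "k \<ge> 2 \<or> (k \<ge> 1 \<and> (\<forall>x. \<chi> x = 1))"
  shows "Lam (lamc \<psi> \<chi>) k = 0"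
proof -
  have "(\<Sum>g\<in>PK k. \<psi> (- coeff g (k - 1)) * \<chi> ((- 1) ^ k * coeff g 0)) = 0"
    by (rule sum_PK_translate[OF assms(1)]) (use assms(2) in auto)
  thus ?thesis using assms(2) Lam_lamc[of k \<psi> \<chi>] by auto
qed

lemma Lam_1: "Lam lam 1 = (\<Sum>x\<in>K. lam {#x#})"
proof -
  have "SM 1 = (\<lambda>x. {#x#}) ` K"
    by (auto simp: SM_def stable_def K_def dest!: size_1_singleton_mset[unfolded One_nat_def])
  thus ?thesis by (simp add: Lam_def sum.reindex inj_on_def)
qed

definition gauss :: "('a \<Rightarrow> complex) \<Rightarrow> ('a \<Rightarrow> complex) \<Rightarrow> complex" where
  "gauss \<psi> \<chi> = (\<Sum>x\<in>K. \<psi> x * \<chi> x)"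

lemma Lam_fps_lamc:
  assumes "psi_add \<psi>" "chi_mult \<chi>"
  shows "Abs_fps (Lam (lamc \<psi> \<chi>)) = 1 + fps_const (gauss \<psi> \<chi>) * fps_X"
proof (rule fps_ext)
  fix n
  have 0: "Lam (lamc \<psi> \<chi>) 0 = 1" using assms by (simp add: Lam_0 lamc_def psi_add_def chi_mult_def)
  have 1: "Lam (lamc \<psi> \<chi>) (Suc 0) = gauss \<psi> \<chi>"
    using Lam_1[of "lamc \<psi> \<chi>"] by (simp add: lamc_def gauss_def)
  show "Abs_fps (Lam (lamc \<psi> \<chi>)) $ n = (1 + fps_const (gauss \<psi> \<chi>) * fps_X) $ n"
  proof (cases "n \<ge> 2")
    case True
    thus ?thesis using Lam_lamc_vanish[OF assms(1), of n \<chi>] by (simp add: fps_X_def)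
  next
    case False
    then consider "n = 0" | "n = Suc 0" by linarith
    thus ?thesis by cases (simp_all add: 0 1)
  qed
qed

text \<open>The logarithmic derivative of 1 + G X has the coefficients (-1)^(n-1) G^n. They are read
  off the recursion, in which only two terms survive because the L-series has no terms from degree 2
  on.\<close>

theorem davenport_hasse_lift:
  assumes "psi_add \<psi>" "chi_mult \<chi>" "n \<ge> 1"
  shows "Sp (lamc \<psi> \<chi>) n = (- 1) ^ (n - 1) * gauss \<psi> \<chi> ^ n"
proof -
  define L where "L = Lam (lamc \<psi> \<chi>)"
  have rec: "of_nat n * L n = (\<Sum>k=1..n. Sp (lamc \<psi> \<chi>) k * L (n - k))" for n
    unfolding L_def by (rule Lam_recursion) (rule lamc_mult[OF assms(1,2)])
  have L0: "L 0 = 1" and L1: "L 1 = gauss \<psi> \<chi>" and L2: "\<And>n. n \<ge> 2 \<Longrightarrow> L n = 0"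
    using arg_cong[OF Lam_fps_lamc[OF assms(1,2)], of "\<lambda>f. f $ 0"]
      arg_cong[OF Lam_fps_lamc[OF assms(1,2)], of "\<lambda>f. f $ 1"] Lam_lamc_vanish[OF assms(1)]
    by (simp_all add: L_def)
  show ?thesis using assms(3)
  proof (induction n rule: nat_induct_at_least)
    case base
    show ?case using rec[of 1] L0 L1 by simp
  next
    case (Suc n)
    have "0 = (\<Sum>k=1..Suc n. Sp (lamc \<psi> \<chi>) k * L (Suc n - k))" using rec[of "Suc n"] L2[of "Suc n"] Suc by simp
    also have "\<dots> = (\<Sum>k\<in>{n, Suc n}. Sp (lamc \<psi> \<chi>) k * L (Suc n - k))"
      using Suc.hyps by (intro sum.mono_neutral_right) (auto intro!: L2)
    also have "\<dots> = Sp (lamc \<psi> \<chi>) n * gauss \<psi> \<chi> + Sp (lamc \<psi> \<chi>) (Suc n)"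
      using L0 L1 by simp
    finally have "Sp (lamc \<psi> \<chi>) (Suc n) = - (Sp (lamc \<psi> \<chi>) n * gauss \<psi> \<chi>)"
      by (simp add: eq_neg_iff_add_eq_0 add.commute)
    also have "\<dots> = (- 1) ^ (Suc n - 1) * gauss \<psi> \<chi> ^ Suc n"
      using Suc by (cases n) (simp_all add: mult_ac)
    finally show ?case .
  qed
qed

end

section \<open>The Davenport--Hasse product formula\<close>

text \<open>The reciprocal polynomial of \<open>mpoly M\<close>; minus its logarithmic derivative
  generates the power sums of the roots.\<close>

definition rev_fps :: "'a::field multiset \<Rightarrow> 'a fps" where
  "rev_fps M = (\<Prod>x\<in>#M. 1 - fps_const x * fps_X)"

definition power_sums :: "'a::field multiset \<Rightarrow> 'a fps" where
  "power_sums M = Abs_fps (\<lambda>k. \<Sum>x\<in>#M. x ^ Suc k)"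

lemma newton_power_sums: "fps_deriv (rev_fps M) = - (power_sums M * rev_fps M)"
proof (induction M)
  case (add x M)
  let ?L = "1 - fps_const x * fps_X :: 'a fps"
  have R: "rev_fps (add_mset x M) = ?L * rev_fps M" by (simp add: rev_fps_def)
  have P: "power_sums (add_mset x M) = Abs_fps (\<lambda>k. x ^ Suc k) + power_sums M"
    by (rule fps_ext) (simp add: power_sums_def)
  have geo: "Abs_fps (\<lambda>k. x ^ Suc k) * ?L = fps_const x"
  proof (rule fps_ext)
    fix n
    have "Abs_fps (\<lambda>k. x ^ Suc k) * ?L = Abs_fps (\<lambda>k. x ^ Suc k) - fps_const x * (fps_X * Abs_fps (\<lambda>k. x ^ Suc k))"
      by (simp add: algebra_simps)
    thus "(Abs_fps (\<lambda>k. x ^ Suc k) * ?L) $ n = fps_const x $ n"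
      by (cases n) simp_all
  qed
  have "power_sums (add_mset x M) * rev_fps (add_mset x M) =
      (Abs_fps (\<lambda>k. x ^ Suc k) * ?L) * rev_fps M + ?L * (power_sums M * rev_fps M)"
    unfolding R P by (simp add: algebra_simps)
  moreover have "fps_deriv (rev_fps (add_mset x M)) =
      - (fps_const x * rev_fps M) + ?L * fps_deriv (rev_fps M)"
    unfolding R by (simp add: add.commute) (simp only: fps_const_neg [symmetric] mult_minus_left)
  ultimately show ?case unfolding geo add
    by (simp only: mult_minus_right minus_add_distrib)
qed (simp_all add: rev_fps_def power_sums_def fps_eq_iff)

lemma rev_fps_eq_reflect: "rev_fps M = fps_of_poly (reflect_poly (mpoly M))"
proof (induction M)
  case (add x M)
  have "reflect_poly [:- x, 1:] = [:1, - x:]"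
    by (simp add: reflect_poly_def cCons_def)
  moreover have "fps_of_poly [:1, - x:] = 1 - fps_const x * fps_X"
    by (simp add: fps_of_poly_linear)
  ultimately show ?case using add
    by (simp add: rev_fps_def reflect_poly_mult fps_of_poly_mult del: mult_pCons_left)
qed (simp add: rev_fps_def)

lemma rev_fps_nth: "i \<le> size M \<Longrightarrow> rev_fps M $ i = coeff (mpoly M) (size M - i)"
  by (simp add: rev_fps_eq_reflect coeff_reflect_poly)

text \<open>Newton's identities, valid in every characteristic: the power sums of exponent below l
  depend only on the nonconstant coefficients, and the constant coefficient enters the l-th one
  solely through the term -l a.\<close>

lemma power_sum_constant_coeff:
  fixes M M' :: "'a::field multiset"
  assumes "mpoly M = pCons a g" "mpoly M' = pCons b g" "size M = l" "size M' = l" "l > 0"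
  shows "(\<Sum>x\<in>#M. x ^ l) + of_nat l * a = (\<Sum>x\<in>#M'. x ^ l) + of_nat l * b"
proof -
  have same: "rev_fps M $ i = rev_fps M' $ i" if "i < l" for i
    using that assms by (simp add: rev_fps_nth coeff_pCons split: nat.splits)
  have last: "rev_fps M $ l = a" "rev_fps M' $ l = b"
    using assms by (simp_all add: rev_fps_nth)
  have R0: "rev_fps M $ 0 = 1" "rev_fps M' $ 0 = 1"
    using lead_coeff_mpoly[of M] lead_coeff_mpoly[of M'] by (simp_all add: rev_fps_nth)
  have newton: "of_nat (Suc k) * rev_fps M $ Suc k =
      - (power_sums M $ k * rev_fps M $ 0 + (\<Sum>i<k. power_sums M $ i * rev_fps M $ (k - i)))" for k and M :: "'a multiset"
  proof -
    have "of_nat (Suc k) * rev_fps M $ Suc k = - ((power_sums M * rev_fps M) $ k)"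
      using arg_cong[OF newton_power_sums[of M], of "\<lambda>h. h $ k"] by simp
    also have "(power_sums M * rev_fps M) $ k = (\<Sum>i\<in>insert k {..<k}. power_sums M $ i * rev_fps M $ (k - i))"
      unfolding fps_mult_nth by (intro sum.cong) auto
    finally show ?thesis by simp
  qed
  have eq: "power_sums M $ k = power_sums M' $ k" if "Suc k < l" for k
    using that
  proof (induction k rule: less_induct)
    case (less k)
    have "of_nat (Suc k) * rev_fps M $ Suc k = of_nat (Suc k) * rev_fps M' $ Suc k"
      using same less.prems by simp
    hence "power_sums M $ k + (\<Sum>i<k. power_sums M $ i * rev_fps M $ (k - i)) =
        power_sums M' $ k + (\<Sum>i<k. power_sums M' $ i * rev_fps M' $ (k - i))"
      by (simp only: newton R0 mult_1_right neg_equal_iff_equal)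
    moreover have "(\<Sum>i<k. power_sums M $ i * rev_fps M $ (k - i)) = (\<Sum>i<k. power_sums M' $ i * rev_fps M' $ (k - i))"
      using less same by (intro sum.cong) auto
    ultimately show ?case by simp
  qed
  obtain k where k: "l = Suc k" using assms(5) gr0_implies_Suc by blast
  have "(\<Sum>i<k. power_sums M $ i * rev_fps M $ (k - i)) = (\<Sum>i<k. power_sums M' $ i * rev_fps M' $ (k - i))"
    using eq same k by (intro sum.cong) auto
  moreover have "of_nat l * a = - (power_sums M $ k + (\<Sum>i<k. power_sums M $ i * rev_fps M $ (k - i)))"
    using newton[of k M] last R0 by (simp only: k mult_1_right)
  moreover have "of_nat l * b = - (power_sums M' $ k + (\<Sum>i<k. power_sums M' $ i * rev_fps M' $ (k - i)))"
    using newton[of k M'] last R0 by (simp only: k mult_1_right)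
  ultimately have "power_sums M $ k + of_nat l * a = power_sums M' $ k + of_nat l * b" by simp
  thus ?thesis by (simp add: power_sums_def k)
qed

lemma prod_linear_fps_nth:
  fixes c :: "'i \<Rightarrow> complex"
  assumes "finite A"
  shows "(\<Prod>j\<in>A. 1 + fps_const (c j) * fps_X) $ card A = (\<Prod>j\<in>A. c j)"
    and "n > card A \<Longrightarrow> (\<Prod>j\<in>A. 1 + fps_const (c j) * fps_X) $ n = 0"
proof -
  have "(\<Prod>j\<in>A. 1 + fps_const (c j) * fps_X) $ card A = (\<Prod>j\<in>A. c j) \<and>
     (\<forall>n > card A. (\<Prod>j\<in>A. 1 + fps_const (c j) * fps_X) $ n = 0)"
    using assms
  proof (induction A)
    case (insert x A)
    let ?P = "\<Prod>j\<in>A. 1 + fps_const (c j) * fps_X"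
    have "(\<Prod>j\<in>insert x A. 1 + fps_const (c j) * fps_X) = ?P + fps_const (c x) * (fps_X * ?P)"
      using insert.hyps by (simp add: algebra_simps)
    hence nth: "(\<Prod>j\<in>insert x A. 1 + fps_const (c j) * fps_X) $ Suc n = ?P $ Suc n + c x * ?P $ n" for n
      by (simp only: fps_add_nth fps_mult_left_const_nth fps_X_mult_nth) simp
    show ?case
    proof (intro conjI allI impI)
      show "(\<Prod>j\<in>insert x A. 1 + fps_const (c j) * fps_X) $ card (insert x A) = (\<Prod>j\<in>insert x A. c j)"
        unfolding card_insert_disjoint[OF insert.hyps] nth using insert by simp
      fix n assume "n > card (insert x A)"
      then obtain m where "n = Suc m" "m > card A" using insert.hyps by (cases n) auto
      thus "(\<Prod>j\<in>insert x A. 1 + fps_const (c j) * fps_X) $ n = 0" using insert.IH by (simp only: nth) simp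
    qed
  qed auto
  thus "(\<Prod>j\<in>A. 1 + fps_const (c j) * fps_X) $ card A = (\<Prod>j\<in>A. c j)"
    "n > card A \<Longrightarrow> (\<Prod>j\<in>A. 1 + fps_const (c j) * fps_X) $ n = 0" by auto
qed

context field_endo begin

lemma orb_power:
  "sum_mset (orb n (x ^ l)) = (\<Sum>y\<in>#orb n x. y ^ l)"
  "prod_mset (orb n (x ^ l)) = prod_mset (orb n x) ^ l"
proof -
  have pow: "\<phi> (x ^ l) = \<phi> x ^ l" for x by (induction l) (simp_all add: phi_mult)
  have "(\<phi> ^^ i) (x ^ l) = (\<phi> ^^ i) x ^ l" for i by (induction i) (simp_all add: pow)
  thus "sum_mset (orb n (x ^ l)) = (\<Sum>y\<in>#orb n x. y ^ l)"
    "prod_mset (orb n (x ^ l)) = prod_mset (orb n x) ^ l"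
    by (induction n) (simp_all add: orb_Suc power_mult_distrib)
qed

lemma Fix_power: "x \<in> Fix n \<Longrightarrow> x ^ l \<in> Fix n"
proof -
  have pow: "\<phi> (x ^ l) = \<phi> x ^ l" for x by (induction l) (simp_all add: phi_mult)
  have "(\<phi> ^^ i) (x ^ l) = (\<phi> ^^ i) x ^ l" for i x by (induction i) (simp_all add: pow)
  thus "x \<in> Fix n \<Longrightarrow> x ^ l \<in> Fix n" by (simp add: Fix_def)
qed

text \<open>The pullback of \<open>lamc\<close> along the l-th power map on the roots.\<close>

definition lamp :: "nat \<Rightarrow> ('a \<Rightarrow> complex) \<Rightarrow> ('a \<Rightarrow> complex) \<Rightarrow> 'a multiset \<Rightarrow> complex" where
  "lamp l \<psi> \<kappa> M = \<psi> (\<Sum>x\<in>#M. x ^ l) * \<kappa> (prod_mset M) ^ l"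

lemma lamp_mult:
  assumes "psi_add \<psi>" "chi_mult \<kappa>" "stable M" "stable M'"
  shows "lamp l \<psi> \<kappa> (M + M') = lamp l \<psi> \<kappa> M * lamp l \<psi> \<kappa> M'"
  using assms sum_pow_roots_in_K[of M l] sum_pow_roots_in_K[of M' l]
    sum_prod_roots_in_K[of M] sum_prod_roots_in_K[of M']
  by (simp add: lamp_def psi_add_def chi_mult_def power_mult_distrib)

lemma chi_mult_twist:
  assumes "chi_mult \<kappa>" "chi_mult \<rho>"
  shows "chi_mult (\<lambda>x. \<kappa> x * \<rho> x ^ j)"
  using assms by (simp add: chi_mult_def power_mult_distrib)

lemma chi_mult_power: "chi_mult \<kappa> \<Longrightarrow> x \<in> K \<Longrightarrow> \<kappa> (x ^ l) = \<kappa> x ^ l"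
  by (induction l) (auto simp: chi_mult_def K_power)

text \<open>The pullback along \<open>x \<mapsto> x ^ l\<close> decomposes into the twists by the powers of a
  character \<open>\<rho>\<close> of order \<open>l\<close>.\<close>

lemma Sp_lamp:
  assumes kappa: "chi_mult \<kappa>" and n: "n \<ge> 1"
    and root: "\<And>y. y \<in> Fix n \<Longrightarrow> (\<Sum>j<l. \<rho> (prod_mset (orb n y)) ^ j) = of_nat (card {x\<in>Fix n. x ^ l = y})"
  shows "Sp (lamp l \<psi> \<kappa>) n = (\<Sum>j<l. Sp (lamc \<psi> (\<lambda>x. \<kappa> x * \<rho> x ^ j)) n)"
proof -
  have fin: "finite (Fix n)" using n by (intro finite_Fix) auto
  have lam: "lamp l \<psi> \<kappa> (orb n x) = lamc \<psi> \<kappa> (orb n (x ^ l))" if "x \<in> Fix n" for x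
  proof -
    have "stable (orb n x)" using that by (intro stable_orb) (simp add: Fix_def)
    hence "\<kappa> (prod_mset (orb n x) ^ l) = \<kappa> (prod_mset (orb n x)) ^ l"
      using sum_prod_roots_in_K(2) chi_mult_power[OF kappa] by blast
    thus ?thesis by (simp add: lamp_def lamc_def orb_power)
  qed
  have "(\<Sum>j<l. Sp (lamc \<psi> (\<lambda>x. \<kappa> x * \<rho> x ^ j)) n) =
      (\<Sum>y\<in>Fix n. \<Sum>j<l. lamc \<psi> (\<lambda>x. \<kappa> x * \<rho> x ^ j) (orb n y))"
    unfolding Sp_def by (rule sum.swap)
  also have "\<dots> = (\<Sum>y\<in>Fix n. lamc \<psi> \<kappa> (orb n y) * (\<Sum>j<l. \<rho> (prod_mset (orb n y)) ^ j))"
    by (simp add: lamc_def sum_distrib_left mult.assoc)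
  also have "\<dots> = (\<Sum>y\<in>Fix n. \<Sum>x\<in>{x\<in>Fix n. x ^ l = y}. lamc \<psi> \<kappa> (orb n (x ^ l)))"
    using root by (intro sum.cong refl) (simp add: mult.commute)
  also have "\<dots> = (\<Sum>x\<in>Fix n. lamc \<psi> \<kappa> (orb n (x ^ l)))"
    using fin Fix_power by (intro sum.group) auto
  also have "\<dots> = Sp (lamp l \<psi> \<kappa>) n" using lam by (simp add: Sp_def)
  finally show ?thesis by simp
qed

text \<open>The sums \<open>Sp\<close> of the pullback are the sums over all twists, so its
  logarithmic derivative is that of the product of the linear L-series of the twists, and the two
  series agree.\<close>

lemma Lam_fps_lamp:
  assumes psi: "psi_add \<psi>" and kappa: "chi_mult \<kappa>" and rho: "chi_mult \<rho>"
    and root: "\<And>n y. n \<ge> 1 \<Longrightarrow> y \<in> Fix n \<Longrightarrow> (\<Sum>j<l. \<rho> (prod_mset (orb n y)) ^ j) = of_nat (card {x\<in>Fix n. x ^ l = y})"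
  shows "Abs_fps (Lam (lamp l \<psi> \<kappa>)) = (\<Prod>j<l. 1 + fps_const (gauss \<psi> (\<lambda>x. \<kappa> x * \<rho> x ^ j)) * fps_X)"
proof (rule fps_log_deriv_unique)
  let ?kap = "\<lambda>j x. \<kappa> x * \<rho> x ^ j"
  show "fps_deriv (Abs_fps (Lam (lamp l \<psi> \<kappa>))) = Abs_fps (\<lambda>k. Sp (lamp l \<psi> \<kappa>) (Suc k)) * Abs_fps (Lam (lamp l \<psi> \<kappa>))"
    by (rule Lam_fps_deriv) (rule lamp_mult[OF psi kappa])
  have twist: "fps_deriv (1 + fps_const (gauss \<psi> (?kap j)) * fps_X) =
      Abs_fps (\<lambda>k. Sp (lamc \<psi> (?kap j)) (Suc k)) * (1 + fps_const (gauss \<psi> (?kap j)) * fps_X)" for j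
    using Lam_fps_deriv[of "lamc \<psi> (?kap j)"] lamc_mult[OF psi chi_mult_twist[OF kappa rho, of j]]
      Lam_fps_lamc[OF psi chi_mult_twist[OF kappa rho, of j]] by simp
  have "Abs_fps (\<lambda>k. Sp (lamp l \<psi> \<kappa>) (Suc k)) = (\<Sum>j<l. Abs_fps (\<lambda>k. Sp (lamc \<psi> (?kap j)) (Suc k)))"
    by (rule fps_ext) (simp add: fps_sum_nth Sp_lamp[OF kappa _ root])
  thus "fps_deriv (\<Prod>j<l. 1 + fps_const (gauss \<psi> (?kap j)) * fps_X) =
      Abs_fps (\<lambda>k. Sp (lamp l \<psi> \<kappa>) (Suc k)) * (\<Prod>j<l. 1 + fps_const (gauss \<psi> (?kap j)) * fps_X)"
    using fps_log_deriv_prod[of "{..<l}", OF _ twist] by simp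
  have "(\<Prod>j<l. 1 + fps_const (gauss \<psi> (?kap j)) * fps_X) $ 0 = (\<Prod>j<l. 1)"
    by (induction l) simp_all
  thus "Abs_fps (Lam (lamp l \<psi> \<kappa>)) $ 0 = (\<Prod>j<l. 1 + fps_const (gauss \<psi> (?kap j)) * fps_X) $ 0"
    using psi kappa by (simp add: Lam_0 lamp_def psi_add_def chi_mult_def)
qed

lemma bij_betw_pCons_PK: "bij_betw (\<lambda>(a, g). pCons a g) (K \<times> PK k) (PK (Suc k))"
proof (rule bij_betw_imageI)
  show "inj_on (\<lambda>(a, g). pCons a g) (K \<times> PK k)" by (auto intro!: inj_onI)
  show "(\<lambda>(a, g). pCons a g) ` (K \<times> PK k) = PK (Suc k)"
  proof (intro equalityI subsetI)
    fix h assume "h \<in> (\<lambda>(a, g). pCons a g) ` (K \<times> PK k)"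
    then obtain a g where "h = pCons a g" "a \<in> K" "g \<in> PK k" by auto
    thus "h \<in> PK (Suc k)" by (auto simp: PK_def coeff_pCons split: nat.splits)
  next
    fix h assume h: "h \<in> PK (Suc k)"
    obtain a g where ag: "h = pCons a g" by (cases h)
    have "g \<noteq> 0" using h by (auto simp: PK_def ag)
    have "coeff h 0 \<in> K" "\<And>i. coeff h (Suc i) \<in> K" using h unfolding PK_def by blast+
    hence "a \<in> K" "\<And>i. coeff g i \<in> K" by (simp_all add: ag)
    hence "a \<in> K" "g \<in> PK k" using h \<open>g \<noteq> 0\<close> by (auto simp: PK_def ag)
    thus "h \<in> (\<lambda>(a, g). pCons a g) ` (K \<times> PK k)" using ag by auto
  qed
qed

text \<open>The coefficient of X^l of the L-series of \<open>lamp\<close> is computed twice. As a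
  product of linear factors it gives the left side. As a sum over monic polynomials of degree l it
  splits along the constant coefficient a: by Newton's identities a contributes -l a to the l-th
  power sum, and the product of the roots is -a because l is odd. What remains is a coefficient of
  the same series for the trivial character.\<close>

theorem hasse_davenport_product:
  assumes psi: "psi_add \<psi>" and chi: "chi_mult \<chi>" and rho: "chi_mult \<rho>" and l: "odd l"
    and root: "\<And>n y. n \<ge> 1 \<Longrightarrow> y \<in> Fix n \<Longrightarrow> (\<Sum>j<l. \<rho> (prod_mset (orb n y)) ^ j) = of_nat (card {x\<in>Fix n. x ^ l = y})"
  shows "(\<Prod>j<l. gauss \<psi> (\<lambda>x. \<chi> x * \<rho> x ^ j)) =
    (\<Sum>a\<in>K. \<psi> (- of_nat l * a) * \<chi> (- a) ^ l) * (\<Prod>j\<in>{1..<l}. gauss \<psi> (\<lambda>x. \<rho> x ^ j))"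
proof -
  obtain k where k: "l = Suc k" using l by (cases l) auto
  have trivial: "chi_mult (\<lambda>x. 1)" by (simp add: chi_mult_def)
  have "(\<Prod>j<l. gauss \<psi> (\<lambda>x. \<chi> x * \<rho> x ^ j)) = Lam (lamp l \<psi> \<chi>) l"
    using arg_cong[OF Lam_fps_lamp[OF psi chi rho root], of "\<lambda>f. f $ l"]
      prod_linear_fps_nth(1)[of "{..<l}" "\<lambda>j. gauss \<psi> (\<lambda>x. \<chi> x * \<rho> x ^ j)"] by simp
  also have "\<dots> = (\<Sum>g\<in>PK l. lamp l \<psi> \<chi> (proots g))" by (rule Lam_eq_sum_PK)
  also have "\<dots> = (\<Sum>(a, g)\<in>K \<times> PK k. lamp l \<psi> \<chi> (proots (pCons a g)))"
    unfolding k by (rule sum.reindex_bij_betw[OF bij_betw_pCons_PK, symmetric, THEN trans])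
      (simp add: case_prod_unfold)
  also have "\<dots> = (\<Sum>(a, g)\<in>K \<times> PK k. (\<psi> (- of_nat l * a) * \<chi> (- a) ^ l) * lamp l \<psi> (\<lambda>x. 1) (proots g))"
  proof (intro sum.cong refl, clarify)
    fix a g assume a: "a \<in> K" and g: "g \<in> PK k"
    have "pCons a g \<in> PK l" using a g bij_betw_pCons_PK[of k] by (auto simp: k bij_betw_def)
    then obtain M where M: "M \<in> SM l" "mpoly M = pCons a g"
      using bij_betw_imp_surj_on[OF bij_betw_mpoly[of l]] by (metis imageE)
    obtain M1 where M1: "M1 \<in> SM k" "mpoly M1 = g"
      using bij_betw_imp_surj_on[OF bij_betw_mpoly[of k]] g by (metis imageE)
    have size: "size M = l" "size M1 = k" using M(1) M1(1) by (auto simp: SM_def)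
    \<comment> \<open>The reference polynomial with the same higher coefficients and constant
      coefficient 0; its roots are 0 and those of \<open>g\<close>.\<close>
    have "mpoly (add_mset 0 M1) = pCons 0 g" using M1 by simp
    hence "(\<Sum>x\<in>#M. x ^ l) + of_nat l * a = (\<Sum>x\<in>#add_mset 0 M1. x ^ l) + of_nat l * 0"
      using M(2) size k by (intro power_sum_constant_coeff) auto
    hence sum: "(\<Sum>x\<in>#M. x ^ l) = - of_nat l * a + (\<Sum>x\<in>#M1. x ^ l)"
      by (simp add: k algebra_simps)
    have "prod_mset M = - a"
      using coeff_0_mpoly[of M] l size by (simp add: M(2) eq_neg_iff_add_eq_0 add.commute)
    moreover have "- of_nat l * a \<in> K"
    proof -
      have "of_nat n \<in> K" for n by (induction n) (auto intro: K_closed)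
      thus ?thesis using a by (auto intro: K_closed)
    qed
    hence "\<psi> (- of_nat l * a + (\<Sum>x\<in>#M1. x ^ l)) = \<psi> (- of_nat l * a) * \<psi> (\<Sum>x\<in>#M1. x ^ l)"
      using psi sum_pow_roots_in_K[of M1 l] M1(1) unfolding psi_add_def SM_def by blast
    moreover have "proots (pCons a g) = M" "proots g = M1"
      using M(2) M1(2) by (metis proots_mpoly)+
    ultimately show "lamp l \<psi> \<chi> (proots (pCons a g)) =
        (\<psi> (- of_nat l * a) * \<chi> (- a) ^ l) * lamp l \<psi> (\<lambda>x. 1) (proots g)"
      by (simp only: lamp_def sum) simp
  qed
  also have "\<dots> = (\<Sum>a\<in>K. \<psi> (- of_nat l * a) * \<chi> (- a) ^ l) * (\<Sum>g\<in>PK k. lamp l \<psi> (\<lambda>x. 1) (proots g))"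
    by (simp add: sum_product sum.cartesian_product)
  also have "(\<Sum>g\<in>PK k. lamp l \<psi> (\<lambda>x. 1) (proots g)) = Lam (lamp l \<psi> (\<lambda>x. 1)) k"
    by (rule Lam_eq_sum_PK[symmetric])
  also have "\<dots> = (\<Prod>j\<in>{1..<l}. gauss \<psi> (\<lambda>x. \<rho> x ^ j))"
  proof -
    \<comment> \<open>The constant function is summed over 0 as well, so the factor for j = 0 is 1
      and the product has degree k = l - 1. Its top coefficient is the one wanted.\<close>
    have "gauss \<psi> (\<lambda>x. 1) = 0"
      using Lam_lamc_vanish[OF psi, of 1 "\<lambda>x. 1"] Lam_1[of "lamc \<psi> (\<lambda>x. 1)"]
      by (simp add: lamc_def gauss_def)
    moreover have "{..<l} = insert 0 {1..<l}" using k by auto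
    ultimately have "(\<Prod>j<l. 1 + fps_const (gauss \<psi> (\<lambda>x. 1 * \<rho> x ^ j)) * fps_X) =
        (\<Prod>j\<in>{1..<l}. 1 + fps_const (gauss \<psi> (\<lambda>x. \<rho> x ^ j)) * fps_X)" by simp
    thus ?thesis
      using arg_cong[OF Lam_fps_lamp[OF psi trivial rho root], of "\<lambda>f. f $ k"]
        prod_linear_fps_nth(1)[of "{1..<l}" "\<lambda>j. gauss \<psi> (\<lambda>x. \<rho> x ^ j)"] k by simp
  qed
  finally show ?thesis .
qed

end

section \<open>Trace and characters of a finite subfield\<close>

lemma frobenius_power_add:
  fixes x y :: "'a::comm_ring_1"
  assumes "prime p" "CHAR('a) = p"
  shows "(x + y) ^ (p ^ n) = x ^ (p ^ n) + y ^ (p ^ n)"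
proof (induction n)
  case (Suc n)
  have one: "(u + v) ^ p = u ^ p + v ^ p" for u v :: 'a
  proof -
    have "(of_nat p :: 'a) = 0" using assms(2) by (simp add: of_nat_eq_0_iff_char_dvd)
    thus ?thesis using freshman_dream_dvd[OF assms(1), of u v] by (simp add: algebra_simps)
  qed
  show ?case by (simp only: power_Suc2 power_mult Suc one)
qed simp

lemma finite_power_fixed:
  fixes q :: nat
  assumes "q > 1"
  shows "finite {x::'a::field. x ^ q = x}"
    "card {x::'a::field. x ^ q = x} \<le> q"
proof -
  define P where "P = (monom 1 q - monom 1 1 :: 'a poly)"
  have "coeff P q = 1" using assms by (simp add: P_def)
  hence P0: "P \<noteq> 0" by auto
  have dP: "degree P \<le> q" unfolding P_def using assms
    by (intro degree_diff_le) (auto intro: order_trans[OF degree_monom_le])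
  have eq: "{x. x ^ q = x} = {x. poly P x = 0}" by (simp add: P_def poly_monom)
  show "finite {x::'a. x ^ q = x}" unfolding eq by (rule poly_roots_finite[OF P0])
  show "card {x::'a. x ^ q = x} \<le> q" unfolding eq using card_poly_roots_bound[OF P0] dP by simp
qed

lemma funpow_power: "((\<lambda>x::'a::monoid_mult. x ^ q) ^^ k) x = x ^ (q ^ k)"
  by (induction k) (simp_all add: power_mult [symmetric] mult.commute)

lemma power_char_endo:
  assumes "prime p" "CHAR('a::alg_closed_field) = p" "n > 0"
  shows "field_endo (\<lambda>x::'a. x ^ (p ^ n))"
proof
  have "p ^ n > 1" using assms by (intro one_less_power prime_gt_1_nat)
  fix k :: nat assume "k > 0"
  hence "(p ^ n) ^ k > 1" using \<open>p ^ n > 1\<close> by (rule one_less_power[rotated])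
  thus "finite {x::'a. ((\<lambda>x. x ^ (p ^ n)) ^^ k) x = x}"
    unfolding funpow_power by (rule finite_power_fixed)
qed (simp_all add: frobenius_power_add[OF assms(1,2)] power_mult_distrib)

definition tr :: "nat \<Rightarrow> nat \<Rightarrow> 'a::comm_ring_1 \<Rightarrow> 'a" where
  "tr p n x = (\<Sum>i<n. x ^ (p ^ i))"

definition rep :: "nat \<Rightarrow> 'a::comm_ring_1 \<Rightarrow> nat" where
  "rep p y = (THE k. k < p \<and> of_nat k = y)"

text \<open>The canonical character of the subfield with p^n elements, with n as a parameter:
  subfields of different degrees share one ambient type.\<close>

definition psi :: "nat \<Rightarrow> nat \<Rightarrow> 'a::comm_ring_1 \<Rightarrow> complex" where
  "psi p n x = zeta p ^ rep p (tr p n x)"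

lemma of_nat_inj_CHAR:
  assumes "CHAR('a::comm_ring_1) = p"
  shows "(of_nat a :: 'a) = of_nat b \<longleftrightarrow> [a = b] (mod p)"
  using of_nat_eq_iff_cong_CHAR[where ?'a = 'a, of a b] assms by simp

lemma of_nat_power_CHAR:
  assumes "prime p" "CHAR('a::comm_ring_1) = p"
  shows "of_nat k ^ p = (of_nat k :: 'a)"
proof -
  have "int p dvd int k ^ p - int k" by (rule fermat_int_dvd[OF assms(1)])
  hence "[int k ^ p = int k] (mod int p)" by (simp add: cong_iff_dvd_diff)
  hence "[k ^ p = k] (mod p)" by (metis cong_int_iff of_nat_power)
  hence "(of_nat (k ^ p) :: 'a) = of_nat k" using of_nat_inj_CHAR[OF assms(2)] by blast
  thus ?thesis by simp
qed

lemma prime_field_eq: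
  assumes "prime p" "CHAR('a::field) = p"
  shows "{x::'a. x ^ p = x} = of_nat ` {..<p}"
proof -
  have p1: "p > 1" using assms(1) prime_gt_1_nat by blast
  have sub: "of_nat ` {..<p} \<subseteq> {x::'a. x ^ p = x}"
    using of_nat_power_CHAR[OF assms] by auto
  have "inj_on (of_nat :: nat \<Rightarrow> 'a) {..<p}"
    by (rule inj_onI) (simp add: of_nat_inj_CHAR[OF assms(2)] cong_def)
  hence "card ((of_nat :: nat \<Rightarrow> 'a) ` {..<p}) = p" by (simp add: card_image)
  thus ?thesis using card_seteq[OF finite_power_fixed(1)[OF p1] sub] finite_power_fixed(2)[OF p1, where ?'a = 'a]
    by simp
qed

lemma rep_of_nat:
  assumes "prime p" "CHAR('a::comm_ring_1) = p"
  shows "rep p (of_nat k :: 'a) = k mod p"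
proof -
  have "(THE j. j < p \<and> (of_nat j :: 'a) = of_nat k) = k mod p"
    using prime_gt_0_nat[OF assms(1)]
    by (intro the_equality) (auto simp: of_nat_inj_CHAR[OF assms(2)] cong_def)
  thus ?thesis by (simp add: rep_def)
qed

lemma prime_field_obtain:
  assumes "prime p" "CHAR('a::field) = p" "(y::'a) ^ p = y"
  obtains k where "y = of_nat k"
  using prime_field_eq[OF assms(1,2)] assms(3) by blast

lemma tr_in_prime_field:
  assumes "prime p" "CHAR('a::field) = p" "(x::'a) ^ (p ^ n) = x"
  shows "tr p n x ^ p = tr p n x"
proof -
  have "tr p n x ^ p = (\<Sum>i<n. x ^ (p ^ Suc i))"
  proof -
    have "(\<Sum>i<m. x ^ (p ^ i)) ^ p = (\<Sum>i<m. x ^ (p ^ Suc i))" for m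
    proof (induction m)
      case 0
      then show ?case using prime_gt_0_nat[OF assms(1)] by (simp add: zero_power)
    next
      case (Suc m)
      thus ?case using frobenius_power_add[OF assms(1,2), of "\<Sum>i<m. x ^ (p ^ i)" "x ^ p ^ m" 1]
        by (simp add: power_mult [symmetric] mult.commute)
    qed
    thus ?thesis by (simp add: tr_def)
  qed
  also have "\<dots> = tr p n x"
  proof (cases n)
    case (Suc k)
    have "(\<Sum>i<n. x ^ (p ^ Suc i)) = (\<Sum>i<k. x ^ (p ^ Suc i)) + x"
      using assms(3) by (simp add: Suc)
    also have "\<dots> = tr p n x" unfolding tr_def Suc by (simp only: sum.lessThan_Suc_shift) simp
    finally show ?thesis .
  qed (simp add: tr_def)
  finally show ?thesis .
qed

lemma tr_add:
  assumes "prime p" "CHAR('a::comm_ring_1) = p"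
  shows "tr p n (x + y :: 'a) = tr p n x + tr p n y"
  by (simp add: tr_def frobenius_power_add[OF assms] sum.distrib)

lemma rep_add_cong:
  assumes "prime p" "CHAR('a::field) = p" "(x::'a) ^ p = x" "(y::'a) ^ p = y"
  shows "[rep p (x + y) = rep p x + rep p y] (mod p)"
proof -
  obtain j where j: "x = of_nat j" using prime_field_obtain[OF assms(1,2,3)] .
  obtain k where k: "y = of_nat k" using prime_field_obtain[OF assms(1,2,4)] .
  have "rep p (x + y) = (j + k) mod p" using rep_of_nat[OF assms(1,2), of "j + k"] by (simp add: j k)
  thus ?thesis by (simp add: j k rep_of_nat[OF assms(1,2)] cong_def mod_add_eq)
qed

lemma rep_mult_cong:
  assumes "prime p" "CHAR('a::field) = p" "(y::'a) ^ p = y"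
  shows "[rep p (of_nat c * y) = c * rep p y] (mod p)"
proof -
  obtain k where k: "y = of_nat k" using prime_field_obtain[OF assms] .
  have "rep p (of_nat c * y) = (c * k) mod p" using rep_of_nat[OF assms(1,2), of "c * k"] by (simp add: k)
  thus ?thesis by (simp add: k rep_of_nat[OF assms(1,2)] cong_def mod_mult_right_eq)
qed

lemma psi_add_eq:
  assumes "prime p" "CHAR('a::field) = p" "(x::'a) ^ (p ^ n) = x" "(y::'a) ^ (p ^ n) = y"
  shows "psi p n (x + y) = psi p n x * psi p n y"
proof -
  have "[rep p (tr p n (x + y)) = rep p (tr p n x) + rep p (tr p n y)] (mod p)"
    unfolding tr_add[OF assms(1,2)]
    by (intro rep_add_cong tr_in_prime_field assms)
  hence "zeta p ^ rep p (tr p n (x + y)) = zeta p ^ (rep p (tr p n x) + rep p (tr p n y))"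
    using prime_gt_0_nat[OF assms(1)] by (intro power_eq_power_if_cong[of _ p]) auto
  thus ?thesis by (simp add: psi_def power_add)
qed

lemma psi_0: "prime p \<Longrightarrow> CHAR('a::comm_ring_1) = p \<Longrightarrow> psi p n (0::'a) = 1"
  using rep_of_nat[where ?'a = 'a, of p 0] prime_gt_0_nat[of p]
  by (simp add: psi_def tr_def zero_power)

text \<open>The trace is a polynomial of degree p^(n-1) and cannot vanish on a larger set.\<close>

lemma exists_trace_nonzero:
  assumes "prime p" "n > 0" "finite A" "card A > p ^ (n - 1)"
  shows "\<exists>x\<in>A. tr p n (x::'a::field) \<noteq> 0"
proof (rule ccontr)
  assume "\<not> (\<exists>x\<in>A. tr p n x \<noteq> 0)"
  hence sub: "A \<subseteq> {x. tr p n x = 0}" by blast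
  define P where "P = (\<Sum>i<n. monom 1 (p ^ i) :: 'a poly)"
  have p1: "p > 1" using assms(1) prime_gt_1_nat by blast
  have poly: "poly P x = tr p n x" for x by (simp add: P_def tr_def poly_sum poly_monom)
  have "coeff P (p ^ (n - 1)) = (\<Sum>i<n. if i = n - 1 then 1 else 0)"
    using p1 by (auto simp: P_def coeff_sum intro!: sum.cong)
  also have "\<dots> = 1" using assms(2) by simp
  finally have P0: "P \<noteq> 0" by auto
  have "degree P \<le> p ^ (n - 1)" unfolding P_def
    using p1 by (intro degree_sum_le) (auto intro!: order_trans[OF degree_monom_le] power_increasing)
  hence "card {x. poly P x = 0} \<le> p ^ (n - 1)" using card_poly_roots_bound[OF P0] by linarith
  moreover have "card A \<le> card {x. poly P x = 0}"
    using sub poly_roots_finite[OF P0] by (intro card_mono) (auto simp: poly)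
  ultimately show False using assms(4) by simp
qed

text \<open>The field with q elements is the fixed set of the q-power map in an algebraically closed
  field, so that ground field and extension are subsets of one type and norms and traces need no
  transport.\<close>

locale gen_field =
  fixes p n :: nat and g :: "'a::alg_closed_field"
  assumes prime_p: "prime p" and odd_p: "odd p" and char_p: "CHAR('a) = p" and n_pos: "n > 0"
    and gen: "bij_betw (\<lambda>i. g ^ i) {..<p ^ n - 1} ({x. x ^ (p ^ n) = x} - {0})"
begin

abbreviation q where "q \<equiv> p ^ n"
abbreviation F where "F \<equiv> {x::'a. x ^ q = x}"

lemma q_gt_1: "q > 1"
  using prime_p n_pos by (intro one_less_power prime_gt_1_nat)

lemma p_gt_1: "p > 1"
  using prime_p prime_gt_1_nat by blast

sublocale E: field_endo "\<lambda>x::'a. x ^ q"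
  by (rule power_char_endo[OF prime_p char_p n_pos])

lemma K_eq: "E.K = F"
  by (simp add: E.K_def)

lemma finite_F: "finite F"
  by (rule finite_power_fixed[OF q_gt_1])

lemma card_F: "card F = q"
proof -
  have "card (F - {0}) = q - 1" using bij_betw_same_card[OF gen] by simp
  moreover have "0 \<in> F" using q_gt_1 by (simp add: zero_power)
  ultimately show ?thesis using finite_F q_gt_1 by (simp add: card_Diff_singleton)
qed

lemma g_in_F: "g \<in> F" and g_nonzero: "g \<noteq> 0"
proof -
  have "q > 2"
  proof -
    have "p \<ge> 3" using prime_p odd_p prime_ge_2_nat[OF prime_p] by (cases "p = 2") auto
    also have "p \<le> q" using n_pos p_gt_1 by (simp add: self_le_power)
    finally show ?thesis by simp
  qed
  hence "1 \<in> {..<q - 1}" by simp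
  from bij_betw_apply[OF gen this] show "g \<in> F" "g \<noteq> 0" by auto
qed

lemma F_pow_eq_1: "x \<in> F \<Longrightarrow> x \<noteq> 0 \<Longrightarrow> x ^ (q - 1) = 1"
proof -
  assume x: "x \<in> F" "x \<noteq> 0"
  have "x ^ (q - 1) * x = x ^ q" using q_gt_1 by (intro power_minus_mult) linarith
  hence "x ^ (q - 1) * x = x" using x(1) by simp
  thus ?thesis using x by simp
qed

lemma g_pow: "g ^ (q - 1) = 1"
  using F_pow_eq_1 g_in_F g_nonzero by blast

lemma g_pow_in: "g ^ i \<in> F - {0}"
proof -
  have "(g ^ i) ^ q = (g ^ q) ^ i" by (metis mult.commute power_mult)
  thus ?thesis using g_in_F g_nonzero by simp
qed

lemma F_obtain: "x \<in> F \<Longrightarrow> x \<noteq> 0 \<Longrightarrow> \<exists>i<q - 1. x = g ^ i"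
proof -
  assume "x \<in> F" "x \<noteq> 0"
  hence "x \<in> F - {0}" by simp
  hence "x \<in> (\<lambda>i. g ^ i) ` {..<q - 1}" by (simp only: bij_betw_imp_surj_on[OF gen])
  thus ?thesis by blast
qed

lemma g_pow_eq_iff: "g ^ i = g ^ j \<longleftrightarrow> [i = j] (mod (q - 1))"
proof
  assume "g ^ i = g ^ j"
  moreover have red: "g ^ (a mod (q - 1)) = g ^ a" for a
    by (rule power_eq_power_if_cong[OF g_pow]) (simp only: cong_mod_left cong_refl)
  ultimately have eq: "g ^ (i mod (q - 1)) = g ^ (j mod (q - 1))" by (simp only: red)
  have "q - 1 > 0" using q_gt_1 by linarith
  hence mem: "a mod (q - 1) \<in> {..<q - 1}" for a by simp
  have "i mod (q - 1) = j mod (q - 1)"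
    by (rule inj_onD[OF bij_betw_imp_inj_on[OF gen] eq mem mem])
  thus "[i = j] (mod (q - 1))" by (simp add: cong_def)
qed (rule power_eq_power_if_cong[OF g_pow])

definition \<tau> :: "nat \<Rightarrow> nat" where "\<tau> i = rep p (tr p n (g ^ i))"

lemma psi_g: "psi p n (g ^ i) = zeta p ^ \<tau> i"
  by (simp add: psi_def \<tau>_def)

lemma of_nat_in_F: "of_nat c \<in> F"
proof -
  have "(of_nat c :: 'a) ^ (p ^ i) = of_nat c" for i
    by (induction i) (simp_all add: power_mult of_nat_power_CHAR[OF prime_p char_p] mult.commute)
  thus ?thesis by simp
qed

lemma tau_scale:
  assumes e: "g ^ e = of_nat c"
  shows "[\<tau> (i + e) = c * \<tau> i] (mod p)"
proof -
  have "(of_nat c :: 'a) ^ (p ^ i) = of_nat c" for i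
    by (induction i) (simp_all add: power_mult of_nat_power_CHAR[OF prime_p char_p] mult.commute)
  hence "tr p n (g ^ (i + e)) = of_nat c * tr p n (g ^ i)"
    by (simp add: tr_def power_add power_mult_distrib e sum_distrib_left mult.commute)
  thus ?thesis unfolding \<tau>_def
    using rep_mult_cong[OF prime_p char_p] tr_in_prime_field[OF prime_p char_p] g_pow_in[of i] by simp
qed

sublocale log_trace p "q - 1" \<tau>
proof
  show "prime p" "odd p" by (rule prime_p odd_p)+
  show "q - 1 > 0" using q_gt_1 by simp
  show "even (q - 1)" using odd_p by simp
  show "\<not> p dvd q - 1"
  proof
    assume "p dvd q - 1"
    moreover have "p dvd q" using n_pos by simp
    ultimately have "p dvd q - (q - 1)" by (rule dvd_diff_nat[rotated])
    thus False using q_gt_1 p_gt_1 by simp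
  qed
  show "\<tau> (i + (q - 1)) = \<tau> i" for i by (simp only: \<tau>_def power_add g_pow mult_1_right)
  show "\<tau> (p * i) = \<tau> i" for i
  proof -
    have "tr p n (x ^ p) = tr p n x" if "x \<in> F" for x
    proof -
      have "tr p n (x ^ p) = (\<Sum>i<n. x ^ (p ^ Suc i))"
        by (simp add: tr_def power_mult [symmetric])
      also obtain k where k: "n = Suc k" using n_pos gr0_implies_Suc by blast
      have "(\<Sum>i<n. x ^ (p ^ Suc i)) = (\<Sum>i<k. x ^ (p ^ Suc i)) + x"
        using that by (simp add: k)
      also have "\<dots> = tr p n x" unfolding tr_def k by (simp only: sum.lessThan_Suc_shift) simp
      finally show ?thesis .
    qed
    from this[of "g ^ i"] show ?thesis using g_pow_in[of i] by (simp add: \<tau>_def power_mult [symmetric] mult.commute)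
  qed
  fix c assume c: "\<not> p dvd c"
  hence "(of_nat c :: 'a) \<noteq> 0" by (simp add: of_nat_eq_0_iff_char_dvd char_p)
  then obtain e where "g ^ e = of_nat c" using F_obtain[of "of_nat c"] of_nat_in_F by fastforce
  hence "\<forall>i. [\<tau> (i + e) = c * \<tau> i] (mod p)" using tau_scale by blast
  thus "\<exists>e. \<forall>i. [\<tau> (i + e) = c * \<tau> i] (mod p)" by blast
qed

end

lemma geometric_nat: "q \<ge> 1 \<Longrightarrow> (q - 1) * (\<Sum>i<s. q ^ i) = q ^ s - (1::nat)"
proof (induction s)
  case (Suc s)
  have "q ^ s \<ge> 1" using Suc.prems by simp
  moreover have "(q - 1) * q ^ s = q * q ^ s - q ^ s" by (simp add: diff_mult_distrib)
  moreover have "q * q ^ s \<ge> q ^ s" using Suc.prems by simp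
  ultimately show ?case using Suc by (simp add: distrib_left)
qed simp

declare One_nat_def [simp del]

section \<open>Characters and Gauss sums relative to a generator\<close>

context gen_field begin

definition dlog :: "'a \<Rightarrow> nat" where
  "dlog x = (THE i. i < q - 1 \<and> g ^ i = x)"

definition chi :: "complex \<Rightarrow> 'a \<Rightarrow> complex" where
  "chi z x = (if x = 0 then 0 else z ^ dlog x)"

lemma q1_pos: "q - 1 > 0"
  using q_gt_1 by linarith

lemma dlog_g: "dlog (g ^ i) = i mod (q - 1)"
  unfolding dlog_def
proof (rule the_equality)
  show "i mod (q - 1) < q - 1 \<and> g ^ (i mod (q - 1)) = g ^ i"
    unfolding g_pow_eq_iff by (simp only: cong_mod_left cong_refl mod_less_divisor[OF q1_pos])
  fix j assume j: "j < q - 1 \<and> g ^ j = g ^ i"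
  hence "[j = i] (mod (q - 1))" unfolding g_pow_eq_iff by blast
  thus "j = i mod (q - 1)" using j by (simp add: cong_def)
qed

lemma chi_g:
  assumes "z ^ (q - 1) = 1"
  shows "chi z (g ^ i) = z ^ i"
proof -
  have "z ^ (i mod (q - 1)) = z ^ i"
    by (rule power_eq_power_if_cong[OF assms]) (simp only: cong_mod_left cong_refl)
  moreover have "g ^ i \<noteq> 0" using g_nonzero by simp
  ultimately show ?thesis by (simp only: chi_def dlog_g if_False)
qed

lemma chi_0 [simp]: "chi z 0 = 0"
  by (simp add: chi_def)

lemma chi_mult_chi:
  assumes "z ^ (q - 1) = 1"
  shows "E.chi_mult (chi z)"
  unfolding E.chi_mult_def
proof (intro conjI ballI)
  show "chi z 1 = 1" using chi_g[OF assms, of 0] by simp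
  fix x y assume xy: "x \<in> E.K" "y \<in> E.K"
  show "chi z (x * y) = chi z x * chi z y"
  proof (cases "x = 0 \<or> y = 0")
    case False
    then obtain i j where "x = g ^ i" "y = g ^ j" using F_obtain xy K_eq by metis
    thus ?thesis by (simp only: chi_g[OF assms] power_add [symmetric])
  qed auto
qed

lemma psi_add_psi: "E.psi_add (psi p n)"
  unfolding E.psi_add_def
proof (intro conjI ballI)
  show "psi p n (0::'a) = 1" by (rule psi_0[OF prime_p char_p])
  show "psi p n (x + y) = psi p n x * psi p n y" if "x \<in> E.K" "y \<in> E.K" for x y
    using that unfolding K_eq by (intro psi_add_eq prime_p char_p) auto
  have "p ^ (n - 1) < q" using n_pos p_gt_1 by (intro power_strict_increasing) auto
  hence "card F > p ^ (n - 1)" by (simp only: card_F)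
  then obtain x where x: "x \<in> F" "tr p n x \<noteq> 0"
    using exists_trace_nonzero[OF prime_p n_pos finite_F] by blast
  hence "tr p n x ^ p = tr p n x" by (intro tr_in_prime_field prime_p char_p) auto
  then obtain k where k: "tr p n x = of_nat k" using prime_field_obtain[OF prime_p char_p] by blast
  have "\<not> p dvd k" using x(2) unfolding k by (simp add: of_nat_eq_0_iff_char_dvd char_p)
  hence "\<not> p dvd k mod p" by (simp add: dvd_mod_iff)
  hence "zeta p ^ (k mod p) \<noteq> 1" using p_gt_1 by (subst zeta_power_eq_1_iff) auto
  hence "psi p n x \<noteq> 1" by (simp add: psi_def k rep_of_nat[OF prime_p char_p])
  thus "\<exists>d\<in>E.K. psi p n d \<noteq> 1" using x(1) K_eq by blast
qed

lemma sum_F: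
  fixes f :: "'a \<Rightarrow> complex"
  shows "(\<Sum>x\<in>F. f x) = f 0 + (\<Sum>i<q - 1. f (g ^ i))"
proof -
  have "0 \<in> F" using q_gt_1 by (simp add: zero_power)
  hence "(\<Sum>x\<in>F. f x) = f 0 + (\<Sum>x\<in>F - {0}. f x)" using finite_F by (simp add: sum.remove)
  also have "(\<Sum>x\<in>F - {0}. f x) = (\<Sum>i<q - 1. f (g ^ i))"
    by (rule sum.reindex_bij_betw[OF gen, symmetric])
  finally show ?thesis .
qed

lemma gauss_chi: "z ^ (q - 1) = 1 \<Longrightarrow> E.gauss (psi p n) (chi z) = GS z"
  unfolding GS_def E.gauss_def K_eq sum_F by (simp only: chi_g psi_g chi_0 mult_zero_right add_0)

lemma sum_psi: "(\<Sum>i<q - 1. zeta p ^ \<tau> i) = - 1"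
proof -
  have "E.Lam (E.lamc (psi p n) (\<lambda>x. 1)) 1 = 0" by (rule E.Lam_lamc_vanish[OF psi_add_psi]) auto
  hence "(\<Sum>x\<in>F. psi p n x) = 0" using E.Lam_1[of "E.lamc (psi p n) (\<lambda>x. 1)"] by (simp add: E.lamc_def K_eq)
  hence "psi p n (0::'a) + (\<Sum>i<q - 1. zeta p ^ \<tau> i) = 0" by (simp only: sum_F psi_g)
  thus ?thesis using psi_0[OF prime_p char_p, of n] by (simp add: add_eq_0_iff)
qed

lemma GS_1: "GS 1 = - 1"
  by (simp only: GS_def sum_psi power_one mult_1_right)

lemma minus_one_eq: "g ^ ((q - 1) div 2) = - 1"
proof -
  have ev: "2 * ((q - 1) div 2) = q - 1" using q1_even by simp
  have sq: "(g ^ ((q - 1) div 2)) ^ 2 = 1"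
    unfolding power_mult [symmetric] using ev g_pow by (simp only: mult.commute[of _ 2])
  have "g ^ ((q - 1) div 2) \<noteq> g ^ 0"
  proof
    assume "g ^ ((q - 1) div 2) = g ^ 0"
    hence "[(q - 1) div 2 = 0] (mod (q - 1))" unfolding g_pow_eq_iff .
    hence "q - 1 dvd (q - 1) div 2" by (simp only: cong_0_iff)
    moreover have "(q - 1) div 2 > 0 \<and> (q - 1) div 2 < q - 1"
      using ev q1_pos by (cases "(q - 1) div 2 = 0") auto
    ultimately show False using dvd_imp_le by (meson leD)
  qed
  thus ?thesis using sq by (simp add: power2_eq_1_iff)
qed

text \<open>Collecting the double sum by the quotient \<open>g ^ t\<close> of the two arguments
  leaves the sum over j of \<psi>(g^j (1 + g^t)). It is q - 1 when g^t = -1 and -1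
  otherwise.\<close>

theorem GS_mult_inverse:
  assumes z: "z ^ (q - 1) = 1" "z \<noteq> 1"
  shows "GS z * GS (inverse z) = z ^ ((q - 1) div 2) * of_nat q"
proof -
  define h where "h = (q - 1) div 2"
  have z0: "z \<noteq> 0" using z(1) zero_power[OF q1_pos, where ?'a = complex] by (metis zero_neq_one)
  have inner: "(\<Sum>j<q - 1. zeta p ^ \<tau> j * zeta p ^ \<tau> (j + t)) = (if t = h then of_nat (q - 1) else - 1)"
    if t: "t < q - 1" for t
  proof -
    have eq: "zeta p ^ \<tau> j * zeta p ^ \<tau> (j + t) = psi p n (g ^ j * (1 + g ^ t))" for j
    proof -
      have "psi p n (g ^ j + g ^ (j + t)) = psi p n (g ^ j) * psi p n (g ^ (j + t))"
        using g_pow_in[of j] g_pow_in[of "j + t"] by (intro psi_add_eq prime_p char_p) auto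
      moreover have "g ^ j * (1 + g ^ t) = g ^ j + g ^ (j + t)" by (simp add: power_add distrib_left)
      ultimately show ?thesis by (simp only: psi_g)
    qed
    show ?thesis
    proof (cases "t = h")
      case True
      hence "1 + g ^ t = 0" using minus_one_eq by (simp add: h_def)
      hence "zeta p ^ \<tau> j * zeta p ^ \<tau> (j + t) = 1" for j
        by (simp only: eq mult_zero_right psi_0[OF prime_p char_p])
      thus ?thesis using True by simp
    next
      case False
      have "1 + g ^ t \<noteq> 0"
      proof
        assume "1 + g ^ t = 0"
        hence "g ^ t = g ^ h" using minus_one_eq by (simp add: h_def add_eq_0_iff)
        hence "t mod (q - 1) = h mod (q - 1)" unfolding g_pow_eq_iff by (simp only: cong_def)
        moreover have "h < q - 1" unfolding h_def using q1_pos by linarith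
        ultimately show False using t False by simp
      qed
      moreover have "1 + g ^ t \<in> F" using E.K_closed(2,3) E.K_power[of g t] g_in_F K_eq by auto
      ultimately obtain e where e: "1 + g ^ t = g ^ e" using F_obtain by blast
      have "psi p n (g ^ j * g ^ e) = zeta p ^ \<tau> (j + e)" for j
        by (simp only: power_add [of g, symmetric] psi_g)
      hence "(\<Sum>j<q - 1. zeta p ^ \<tau> j * zeta p ^ \<tau> (j + t)) = (\<Sum>j<q - 1. zeta p ^ \<tau> (j + e))"
        by (simp only: eq e)
      also have "\<dots> = (\<Sum>j<q - 1. zeta p ^ \<tau> j)"
        by (rule sum_periodic_shift[of "\<lambda>j. zeta p ^ \<tau> j"]) (simp only: periodic)
      finally show ?thesis using sum_psi False by simp
    qed
  qed
  have "GS z * GS (inverse z) = (\<Sum>j<q - 1. zeta p ^ \<tau> j * inverse z ^ j * GS z)"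
    unfolding GS_def[of "inverse z"] by (simp add: sum_distrib_left mult_ac)
  also have "\<dots> = (\<Sum>j<q - 1. \<Sum>t<q - 1. zeta p ^ \<tau> j * zeta p ^ \<tau> (j + t) * z ^ t)"
  proof (rule sum.cong[OF refl])
    fix j
    have GSz: "GS z = (\<Sum>t<q - 1. zeta p ^ \<tau> (t + j) * z ^ (t + j))"
      unfolding GS_def by (rule sum_periodic_shift [symmetric]) (simp only: periodic power_add z mult_1_right)
    have "inverse z ^ j * z ^ (t + j) = z ^ t" for t
      using z0 by (simp add: power_add power_inverse)
    note inv = this
    have "zeta p ^ \<tau> j * inverse z ^ j * GS z =
        (\<Sum>t<q - 1. zeta p ^ \<tau> j * inverse z ^ j * (zeta p ^ \<tau> (t + j) * z ^ (t + j)))"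
      unfolding GSz by (rule sum_distrib_left)
    also have "\<dots> = (\<Sum>t<q - 1. zeta p ^ \<tau> j * zeta p ^ \<tau> (j + t) * z ^ t)"
    proof (rule sum.cong[OF refl])
      fix t
      have "zeta p ^ \<tau> j * inverse z ^ j * (zeta p ^ \<tau> (t + j) * z ^ (t + j)) =
          zeta p ^ \<tau> j * zeta p ^ \<tau> (j + t) * (inverse z ^ j * z ^ (t + j))"
        by (simp only: mult_ac add.commute[of t])
      thus "zeta p ^ \<tau> j * inverse z ^ j * (zeta p ^ \<tau> (t + j) * z ^ (t + j)) =
          zeta p ^ \<tau> j * zeta p ^ \<tau> (j + t) * z ^ t" by (simp only: inv)
    qed
    finally show "zeta p ^ \<tau> j * inverse z ^ j * GS z = (\<Sum>t<q - 1. zeta p ^ \<tau> j * zeta p ^ \<tau> (j + t) * z ^ t)" .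
  qed
  also have "\<dots> = (\<Sum>t<q - 1. \<Sum>j<q - 1. zeta p ^ \<tau> j * zeta p ^ \<tau> (j + t) * z ^ t)"
    by (rule sum.swap)
  also have "\<dots> = (\<Sum>t<q - 1. (if t = h then of_nat (q - 1) else - 1) * z ^ t)"
    by (intro sum.cong refl) (simp only: sum_distrib_right [symmetric] inner lessThan_iff)
  also have "\<dots> = (\<Sum>t<q - 1. (if t = h then of_nat q * z ^ t else 0) - z ^ t)"
    using q_gt_1 by (intro sum.cong refl) (auto simp: of_nat_diff algebra_simps)
  also have "\<dots> = of_nat q * z ^ h - (\<Sum>t<q - 1. z ^ t)"
  proof -
    have "h < q - 1" unfolding h_def using q1_pos by linarith
    thus ?thesis by (simp add: sum_subtractf)
  qed
  also have "(\<Sum>t<q - 1. z ^ t) = 0" using z geometric_sum[of z "q - 1"] by simp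
  finally show ?thesis by (simp add: h_def mult.commute)
qed

lemma prod_orb: "prod_mset (E.orb s x) = x ^ (\<Sum>i<s. q ^ i)"
  by (induction s) (simp_all add: E.orb_Suc funpow_power power_add mult.commute)

lemma sum_orb: "sum_mset (E.orb s x) = (\<Sum>i<s. x ^ (q ^ i))"
  by (induction s) (simp_all add: E.orb_Suc funpow_power add.commute)

text \<open>Transitivity of the trace: the sum over an orbit is the relative trace, and the
  exponents i n + a exhaust the range below s n.\<close>

lemma tr_sum_orb: "tr p n (sum_mset (E.orb s x)) = tr p (s * n) x"
proof -
  have frob_sum: "(\<Sum>i<s. f i) ^ (p ^ a) = (\<Sum>i<s. f i ^ (p ^ a))" for f :: "nat \<Rightarrow> 'a" and a
    using p_gt_1 by (induction s) (simp_all add: frobenius_power_add[OF prime_p char_p] zero_power)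
  have "tr p n (sum_mset (E.orb s x)) = (\<Sum>a<n. \<Sum>i<s. x ^ (p ^ (i * n + a)))"
    unfolding tr_def sum_orb frob_sum
    by (simp add: power_mult [symmetric] power_add mult.commute)
  also have "\<dots> = (\<Sum>i<s. \<Sum>a<n. x ^ (p ^ (i * n + a)))" by (rule sum.swap)
  also have "\<dots> = (\<Sum>i<s. \<Sum>j = i * n..<i * n + n. x ^ (p ^ j))"
  proof (rule sum.cong[OF refl])
    fix i
    show "(\<Sum>a<n. x ^ (p ^ (i * n + a))) = (\<Sum>j = i * n..<i * n + n. x ^ (p ^ j))"
      using sum.shift_bounds_nat_ivl[of "\<lambda>j. x ^ (p ^ j)" 0 "i * n" n]
      by (simp add: atLeast0LessThan add.commute)
  qed
  also have "\<dots> = tr p (s * n) x" unfolding tr_def by (rule sum.nat_group)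
  finally show ?thesis .
qed

text \<open>Orbit sum and orbit product are the relative trace and norm, so the \<open>Sp\<close>
  sum is the Gauss sum upstairs. Since the norm of \<open>h\<close> is \<open>g\<close>, the lifted
  character has the same value z at its generator.\<close>

theorem GS_lift:
  assumes H: "gen_field p (n * s) h" and s: "s > 0" and h: "h ^ ((p ^ (n * s) - 1) div (q - 1)) = g"
    and z: "z ^ (q - 1) = 1"
  shows "log_trace.GS p (p ^ (n * s) - 1) (gen_field.\<tau> p (n * s) h) z = (- 1) ^ (s - 1) * GS z ^ s"
proof -
  interpret H: gen_field p "n * s" h by (rule H)
  have R: "(\<Sum>i<s. q ^ i) = (p ^ (n * s) - 1) div (q - 1)"
    using geometric_nat[of q s] q_gt_1 by (simp add: power_mult) (metis nonzero_mult_div_cancel_left q1_pos One_nat_def less_numeral_extra(3))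
  have Q: "E.Fix s = H.F" by (simp add: E.Fix_def funpow_power power_mult)
  have val: "E.lamc (psi p n) (chi z) (E.orb s x) = psi p (n * s) x * chi z (x ^ ((p ^ (n * s) - 1) div (q - 1)))" for x
    by (simp add: E.lamc_def psi_def tr_sum_orb prod_orb R mult.commute)
  have R0: "(p ^ (n * s) - 1) div (q - 1) > 0"
    unfolding R [symmetric] using s by (intro sum_pos2[of _ 0]) auto
  have "E.Sp (E.lamc (psi p n) (chi z)) s = (\<Sum>x\<in>H.F. psi p (n * s) x * chi z (x ^ ((p ^ (n * s) - 1) div (q - 1))))"
    unfolding E.Sp_def Q by (simp only: val)
  also have "\<dots> = (\<Sum>i<p ^ (n * s) - 1. zeta p ^ H.\<tau> i * z ^ i)"
  proof -
    have "(h ^ i) ^ ((p ^ (n * s) - 1) div (q - 1)) = g ^ i" for i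
      unfolding h [symmetric] by (metis mult.commute power_mult)
    thus ?thesis using R0 by (simp only: H.sum_F H.psi_g chi_g[OF z] zero_power chi_0 mult_zero_right add_0)
  qed
  finally have "E.Sp (E.lamc (psi p n) (chi z)) s = H.GS z" unfolding H.GS_def .
  thus ?thesis using E.davenport_hasse_lift[OF psi_add_psi chi_mult_chi[OF z], of s] s
    by (simp add: gauss_chi[OF z])
qed

text \<open>The \<open>l\<close>-th powers in each extension field are singled out by a character of order \<open>l\<close>
  of the ground field, composed with the norm.\<close>

lemma root_count:
  assumes l: "l > 0" "l dvd q - 1" and k: "k \<ge> 1" and y: "y \<in> E.Fix k"
  shows "(\<Sum>j<l. chi (zeta l) (prod_mset (E.orb k y)) ^ j) = of_nat (card {x\<in>E.Fix k. x ^ l = y})"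
proof -
  define R where "R = (\<Sum>i<k. q ^ i)"
  have R: "(q - 1) * R = q ^ k - 1" unfolding R_def using geometric_nat q_gt_1 by simp
  have Fix_eq: "E.Fix k = {x. x ^ (q ^ k) = x}" by (simp add: E.Fix_def funpow_power)
  have qk: "q ^ k > 1" using k by (intro one_less_power[OF q_gt_1]) auto
  have zl: "zeta l ^ (q - 1) = 1" using l by (auto simp: power_mult elim!: dvdE)
  \<comment> \<open>A primitive l-th root of unity of the ground field, available as l divides q -
    1; one solution of x^l = y yields all others through its powers.\<close>
  define w where "w = g ^ ((q - 1) div l)"
  have wl: "w ^ l = 1" unfolding w_def power_mult [symmetric] using l g_pow by simp
  have inj_w: "inj_on (\<lambda>j. w ^ j) {..<l}"
  proof (rule inj_onI)
    fix a b assume ab: "a \<in> {..<l}" "b \<in> {..<l}" "w ^ a = w ^ b"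
    define c where "c = (q - 1) div l"
    have qc: "q - 1 = c * l" using l by (simp add: c_def)
    have c0: "c > 0" using qc q1_pos by (cases c) auto
    have "[c * a = c * b] (mod (c * l))"
      using ab(3) unfolding w_def power_mult [symmetric] g_pow_eq_iff c_def [symmetric] by (simp only: qc)
    hence "[a = b] (mod l)" using c0 by (simp add: cong_def mult_mod_right [symmetric])
    thus "a = b" using ab by (simp add: cong_def)
  qed
  show ?thesis
  proof (cases "y = 0")
    case True
    have "(0::'a) ^ (q ^ k) = 0" by (rule zero_power) (use qk in linarith)
    hence "{x \<in> E.Fix k. x ^ l = y} = {0}" using l(1) True unfolding Fix_eq by auto
    moreover have "prod_mset (E.orb k y) = 0" unfolding prod_orb True
      using k by (intro zero_power sum_pos2[of _ 0]) auto
    hence "chi (zeta l) (prod_mset (E.orb k y)) = 0" by (simp only: chi_0)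
    \<comment> \<open>The term j = 0 is 0^0 = 1 and matches the single solution x = 0.\<close>
    moreover have "(\<Sum>j<l. (0::complex) ^ j) = 1"
      using l(1) by (cases l) (simp_all only: sum.lessThan_Suc_shift, auto simp: zero_power)
    ultimately show ?thesis by simp
  next
    case False
    have nz: "x ^ (q ^ k - 1) = 1 \<longleftrightarrow> x \<in> E.Fix k" if "x \<noteq> 0" for x
    proof -
      have "x ^ (q ^ k - 1) * x = x ^ (q ^ k)" using qk by (intro power_minus_mult) linarith
      thus ?thesis using that by (auto simp: Fix_eq)
    qed
    have "y ^ R \<in> F"
    proof -
      have "(y ^ R) ^ (q - 1) = 1" using nz[OF False] y R by (metis mult.commute power_mult)
      hence "(y ^ R) ^ (q - 1) * y ^ R = y ^ R" by simp
      moreover have "(y ^ R) ^ (q - 1) * y ^ R = (y ^ R) ^ q" using q_gt_1 by (intro power_minus_mult) linarith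
      ultimately show ?thesis by simp
    qed
    then obtain e where e: "y ^ R = g ^ e" using F_obtain False by (metis power_not_zero)
    have ch: "chi (zeta l) (prod_mset (E.orb k y)) = zeta l ^ e"
      unfolding prod_orb R_def [symmetric] e by (rule chi_g[OF zl])
    \<comment> \<open>\<open>e\<close> is a discrete logarithm of the norm of \<open>y\<close>, so
      this is Euler's criterion for l-th powers expressed through the norm.\<close>
    have iff: "zeta l ^ e = 1 \<longleftrightarrow> y ^ ((q ^ k - 1) div l) = 1"
    proof -
      define c where "c = (q - 1) div l"
      have qc: "q - 1 = c * l" using l by (simp add: c_def)
      have c0: "c > 0" using qc q1_pos by (cases c) auto
      have "(q ^ k - 1) div l = c * R" unfolding R [symmetric] qc using l(1) by simp
      hence "y ^ ((q ^ k - 1) div l) = g ^ (e * c)" using e by (metis mult.commute power_mult)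
      moreover have "g ^ (e * c) = 1 \<longleftrightarrow> [e * c = 0] (mod (q - 1))" using g_pow_eq_iff[of "e * c" 0] by simp
      moreover have "[e * c = 0] (mod (q - 1)) \<longleftrightarrow> l dvd e"
        unfolding cong_0_iff qc using c0 by (simp add: mult.commute[of e])
      ultimately show ?thesis using zeta_power_eq_1_iff[OF l(1), of e] by simp
    qed
    have lk: "l dvd q ^ k - 1" unfolding R [symmetric] using l(2) by simp
    define T where "T = (q ^ k - 1) div l"
    have lT: "q ^ k - 1 = l * T" unfolding T_def using lk by simp
    have iff: "zeta l ^ e = 1 \<longleftrightarrow> y ^ T = 1" unfolding T_def by (rule iff)
    show ?thesis
    proof (cases "zeta l ^ e = 1")
      case True
      obtain x0 where x0: "x0 ^ l = y" using nth_root_exists[of l y] l(1) by blast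
      have x00: "x0 \<noteq> 0" using x0 False l(1) by (auto simp: zero_power)
      have "x0 ^ (q ^ k - 1) = y ^ T"
        by (simp only: lT power_mult x0)
      hence x0F: "x0 \<in> E.Fix k" using iff True nz[OF x00] by simp
      have "{x\<in>E.Fix k. x ^ l = y} = (\<lambda>j. x0 * w ^ j) ` {..<l}"
      proof (intro equalityI subsetI)
        fix x assume x: "x \<in> {x\<in>E.Fix k. x ^ l = y}"
        define P where "P = (monom 1 l - 1 :: 'a poly)"
        have "coeff P l = 1" using l(1) by (simp add: P_def)
        hence P0: "P \<noteq> 0" by auto
        have dP: "degree P \<le> l" unfolding P_def by (intro degree_diff_le) (auto intro: degree_monom_le)
        have roots: "{u. poly P u = 0} = {u. u ^ l = 1}" by (simp add: P_def poly_monom)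
        have "card {u::'a. u ^ l = 1} \<le> l"
          using card_poly_roots_bound[OF P0] dP unfolding roots by simp
        moreover have "(\<lambda>j. w ^ j) ` {..<l} \<subseteq> {u. u ^ l = 1}"
          using wl by (auto simp: power_mult [symmetric] mult.commute[of _ l]) (simp add: power_mult)
        moreover have "finite {u::'a. u ^ l = 1}" using poly_roots_finite[OF P0] unfolding roots .
        ultimately have "(\<lambda>j. w ^ j) ` {..<l} = {u. u ^ l = 1}"
          using card_image[OF inj_w] by (intro card_seteq) auto
        moreover have "x / x0 \<in> {u. u ^ l = 1}" using x x0 False by (simp add: power_divide)
        ultimately obtain j where "j < l" "x / x0 = w ^ j" by auto
        thus "x \<in> (\<lambda>j. x0 * w ^ j) ` {..<l}" using x00 by (intro image_eqI[of _ _ j]) (auto simp: field_simps)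
      next
        fix x assume "x \<in> (\<lambda>j. x0 * w ^ j) ` {..<l}"
        then obtain j where j: "x = x0 * w ^ j" by auto
        have wj: "(w ^ j) ^ l = 1" using wl by (metis mult.commute power_mult power_one)
        have x_l: "x ^ l = y" by (simp add: j power_mult_distrib wj x0)
        have "x ^ (q ^ k - 1) = (x ^ l) ^ T" by (simp only: lT power_mult)
        also have "\<dots> = 1" using x_l iff True by simp
        finally have "x ^ (q ^ k - 1) = 1" .
        moreover have "x \<noteq> 0" using x_l False l(1) by (auto simp: zero_power)
        ultimately show "x \<in> {x\<in>E.Fix k. x ^ l = y}" using nz x_l by blast
      qed
      moreover have "inj_on (\<lambda>j. x0 * w ^ j) {..<l}" using inj_w x00 by (auto simp: inj_on_def)
      ultimately have "card {x\<in>E.Fix k. x ^ l = y} = l" by (simp add: card_image)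
      thus ?thesis unfolding ch True by simp
    next
      case False': False
      have "{x\<in>E.Fix k. x ^ l = y} = {}"
      proof (rule ccontr)
        assume "{x\<in>E.Fix k. x ^ l = y} \<noteq> {}"
        then obtain x where x: "x \<in> E.Fix k" "x ^ l = y" by blast
        have "x \<noteq> 0" using x False l(1) by (auto simp: zero_power)
        hence "x ^ (q ^ k - 1) = 1" using nz x by blast
        moreover have "x ^ (q ^ k - 1) = y ^ T"
          by (simp only: lT power_mult x(2))
        ultimately show False using iff False' by simp
      qed
      moreover have "(\<Sum>j<l. (zeta l ^ e) ^ j) = 0"
      proof -
        have "(zeta l ^ e) ^ l = 1" using zeta_power_self[OF l(1)] by (metis mult.commute power_mult power_one)
        thus ?thesis using False' geometric_sum[of "zeta l ^ e" l] by simp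
      qed
      ultimately show ?thesis unfolding ch by (simp only: card.empty of_nat_0)
    qed
  qed
qed

text \<open>In \<open>hasse_davenport_product\<close> the additive character appears at l a. As l
  equals \<open>g ^ e\<close> in the prime field, substituting l a for a restores it and produces
  the factor z^(l e).\<close>

theorem GS_product:
  assumes l: "odd l" "l dvd q - 1" "coprime l p" and z: "z ^ (q - 1) = 1" and e: "g ^ e = of_nat l"
  shows "z ^ (l * e) * (\<Prod>j<l. GS (z * zeta l ^ j)) = GS (z ^ l) * (\<Prod>j\<in>{1..<l}. GS (zeta l ^ j))"
proof -
  have l0: "l > 0" using l(1) by (cases l) auto
  have zl: "zeta l ^ (q - 1) = 1" using l l0 by (auto simp: power_mult elim!: dvdE)
  have zlj: "(zeta l ^ j) ^ (q - 1) = 1" for j using zl by (metis mult.commute power_mult power_one)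
  have twist: "E.gauss (psi p n) (\<lambda>x. chi z x * chi (zeta l) x ^ j) = GS (z * zeta l ^ j)" for j
  proof -
    have zz: "(z * zeta l ^ j) ^ (q - 1) = 1" by (simp only: power_mult_distrib z zlj mult_1_right)
    have "chi z x * chi (zeta l) x ^ j = chi (z * zeta l ^ j) x" for x
      by (simp add: chi_def power_mult_distrib power_mult [symmetric] mult.commute)
    thus ?thesis using gauss_chi[OF zz] by simp
  qed
  have rho: "E.gauss (psi p n) (\<lambda>x. chi (zeta l) x ^ j) = GS (zeta l ^ j)" if "j \<in> {1..<l}" for j
  proof -
    have "chi (zeta l) x ^ j = chi (zeta l ^ j) x" for x
      using that by (auto simp: chi_def power_mult [symmetric] mult.commute zero_power)
    thus ?thesis using gauss_chi[OF zlj] by simp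
  qed
  have main: "(\<Prod>j<l. GS (z * zeta l ^ j)) =
      (\<Sum>a\<in>F. psi p n (- of_nat l * a) * chi z (- a) ^ l) * (\<Prod>j\<in>{1..<l}. GS (zeta l ^ j))"
    using E.hasse_davenport_product[OF psi_add_psi chi_mult_chi[OF z] chi_mult_chi[OF zl] l(1) root_count[OF l0 l(2)]]
    by (simp add: twist rho K_eq)
  have zl': "(z ^ l) ^ (q - 1) = 1" using z by (metis mult.commute power_mult power_one)
  have neg: "bij_betw uminus F F"
    using E.K_closed(4) unfolding K_eq by (intro bij_betwI[of _ _ _ uminus]) auto
  have "(\<Sum>a\<in>F. psi p n (- of_nat l * a) * chi z (- a) ^ l) = (\<Sum>a\<in>F. psi p n (of_nat l * a) * chi z a ^ l)"
    using sum.reindex_bij_betw[OF neg, of "\<lambda>a. psi p n (of_nat l * a) * chi z a ^ l"] by simp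
  also have "\<dots> = (\<Sum>i<q - 1. zeta p ^ \<tau> (i + e) * (z ^ l) ^ i)"
  proof -
    have "psi p n (of_nat l * g ^ i) = zeta p ^ \<tau> (i + e)" for i
      unfolding e [symmetric] power_add [symmetric] psi_g by (simp only: add.commute)
    moreover have "chi z (g ^ i) ^ l = (z ^ l) ^ i" for i
      unfolding chi_g[OF z] by (metis mult.commute power_mult)
    ultimately show ?thesis using l0 by (simp only: sum_F chi_0 zero_power mult_zero_right add_0)
  qed
  finally have "(z ^ l) ^ e * (\<Sum>a\<in>F. psi p n (- of_nat l * a) * chi z (- a) ^ l) = GS (z ^ l)"
    using GS_shift[OF zl', of e] by simp
  thus ?thesis unfolding main by (simp add: power_mult mult.assoc [symmetric])
qed

end

section \<open>The sign of the quadratic Gauss sum\<close>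

text \<open>Gauss's evaluation of the alternating sum of \<open>q\<close>-binomial coefficients; at \<open>m = p - 1\<close>
  and a primitive \<open>p\<close>-th root of unity \<open>x\<close> its terms become powers of \<open>x\<close> with quadratic exponents.\<close>

definition qbinom :: "complex \<Rightarrow> nat \<Rightarrow> nat \<Rightarrow> complex" where
  "qbinom x m j = (\<Prod>i<j. (1 - x ^ m / x ^ i) / (1 - x ^ Suc i))"

lemma qbinom_0 [simp]: "qbinom x m 0 = 1"
  by (simp add: qbinom_def)

lemma qbinom_Suc: "qbinom x m (Suc j) = qbinom x m j * ((1 - x ^ m / x ^ j) / (1 - x ^ Suc j))"
  by (simp add: qbinom_def)

lemma qbinom_eq_0:
  assumes "x \<noteq> 0" "m < j"
  shows "qbinom x m j = 0"
  using assms unfolding qbinom_def by (intro prod_zero) (auto intro!: bexI[of _ m])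

lemma qbinom_absorb:
  assumes "x \<noteq> 0"
  shows "qbinom x (Suc m) j * (1 - x ^ Suc m / x ^ j) = (1 - x ^ Suc m) * qbinom x m j"
proof (induction j)
  case (Suc j)
  have "qbinom x (Suc m) (Suc j) * (1 - x ^ Suc m / x ^ Suc j) =
      (qbinom x (Suc m) j * (1 - x ^ Suc m / x ^ j)) * ((1 - x ^ m / x ^ j) / (1 - x ^ Suc j))"
    using assms by (simp add: qbinom_Suc)
  also have "\<dots> = (1 - x ^ Suc m) * qbinom x m (Suc j)"
    by (simp only: Suc qbinom_Suc mult.assoc)
  finally show ?case .
qed simp

lemma qbinom_pascal:
  assumes "x \<noteq> 0" "x ^ Suc j \<noteq> 1"
  shows "qbinom x (Suc m) (Suc j) = qbinom x m (Suc j) + x ^ m / x ^ j * qbinom x m j"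
proof -
  have "qbinom x (Suc m) (Suc j) = (1 - x ^ Suc m) * qbinom x m j / (1 - x ^ Suc j)"
    unfolding qbinom_Suc qbinom_absorb[OF assms(1), symmetric] by simp
  also have "\<dots> = qbinom x m j * ((1 - x ^ m / x ^ j) / (1 - x ^ Suc j)) + x ^ m / x ^ j * qbinom x m j"
    using assms by (simp add: field_simps)
  finally show ?thesis by (simp only: qbinom_Suc)
qed

text \<open>One use of Pascal's rule brings in the factor 1 - x^(m+1) / x^j, and absorption turns it
  into the constant 1 - x^(m+1) while lowering the upper index once more.\<close>

lemma gauss_alternating_sum_rec:
  assumes x: "x \<noteq> 0" "\<And>i. 0 < i \<Longrightarrow> i \<le> Suc (Suc m) \<Longrightarrow> x ^ i \<noteq> 1"
  shows "(\<Sum>j\<le>Suc (Suc m). (- 1) ^ j * qbinom x (Suc (Suc m)) j) =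
    (1 - x ^ Suc m) * (\<Sum>j\<le>m. (- 1) ^ j * qbinom x m j)"
proof -
  let ?b = "qbinom x"
  have "(\<Sum>j\<le>Suc (Suc m). (- 1) ^ j * ?b (Suc (Suc m)) j) =
      1 + (\<Sum>j\<le>Suc m. (- 1) ^ Suc j * ?b (Suc (Suc m)) (Suc j))"
    by (subst sum.atMost_Suc_shift) simp
  also have "(\<Sum>j\<le>Suc m. (- 1) ^ Suc j * ?b (Suc (Suc m)) (Suc j)) =
      (\<Sum>j\<le>Suc m. (- 1) ^ Suc j * ?b (Suc m) (Suc j)) - (\<Sum>j\<le>Suc m. (- 1) ^ j * (x ^ Suc m / x ^ j * ?b (Suc m) j))"
    unfolding sum_subtractf [symmetric]
  proof (rule sum.cong[OF refl])
    fix j assume "j \<in> {..Suc m}"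
    hence "x ^ Suc j \<noteq> 1" using x(2)[of "Suc j"] by simp
    from qbinom_pascal[OF x(1) this, of "Suc m"]
    show "(- 1) ^ Suc j * ?b (Suc (Suc m)) (Suc j) =
        (- 1) ^ Suc j * ?b (Suc m) (Suc j) - (- 1) ^ j * (x ^ Suc m / x ^ j * ?b (Suc m) j)"
      by (simp add: algebra_simps)
  qed
  also have "1 + ((\<Sum>j\<le>Suc m. (- 1) ^ Suc j * ?b (Suc m) (Suc j)) - (\<Sum>j\<le>Suc m. (- 1) ^ j * (x ^ Suc m / x ^ j * ?b (Suc m) j))) =
      (\<Sum>j\<le>Suc (Suc m). (- 1) ^ j * ?b (Suc m) j) - (\<Sum>j\<le>Suc m. (- 1) ^ j * (x ^ Suc m / x ^ j * ?b (Suc m) j))"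
    by (subst (3) sum.atMost_Suc_shift) simp
  also have "(\<Sum>j\<le>Suc (Suc m). (- 1) ^ j * ?b (Suc m) j) = (\<Sum>j\<le>Suc m. (- 1) ^ j * ?b (Suc m) j)"
    using qbinom_eq_0[OF x(1), of "Suc m" "Suc (Suc m)"] by simp
  also have "(\<Sum>j\<le>Suc m. (- 1) ^ j * ?b (Suc m) j) - (\<Sum>j\<le>Suc m. (- 1) ^ j * (x ^ Suc m / x ^ j * ?b (Suc m) j)) =
      (\<Sum>j\<le>Suc m. (- 1) ^ j * (?b (Suc m) j * (1 - x ^ Suc m / x ^ j)))"
    unfolding sum_subtractf [symmetric] by (intro sum.cong refl) (simp add: algebra_simps)
  also have "\<dots> = (\<Sum>j\<le>Suc m. (- 1) ^ j * ((1 - x ^ Suc m) * ?b m j))"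
    by (simp only: qbinom_absorb[OF x(1)])
  also have "\<dots> = (1 - x ^ Suc m) * (\<Sum>j\<le>Suc m. (- 1) ^ j * ?b m j)"
    by (simp only: sum_distrib_left mult.left_commute)
  also have "(\<Sum>j\<le>Suc m. (- 1) ^ j * ?b m j) = (\<Sum>j\<le>m. (- 1) ^ j * ?b m j)"
    using qbinom_eq_0[OF x(1), of m "Suc m"] by simp
  finally show ?thesis .
qed

lemma gauss_alternating_sum:
  assumes "x \<noteq> 0" "\<And>i. 0 < i \<Longrightarrow> i \<le> 2 * e \<Longrightarrow> x ^ i \<noteq> 1"
  shows "(\<Sum>j\<le>2 * e. (- 1) ^ j * qbinom x (2 * e) j) = (\<Prod>k<e. 1 - x ^ (2 * k + 1))"
  using assms(2)
proof (induction e)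
  case (Suc e)
  have eq: "2 * Suc e = Suc (Suc (2 * e))" by simp
  have IH: "(\<Sum>j\<le>2 * e. (- 1) ^ j * qbinom x (2 * e) j) = (\<Prod>k<e. 1 - x ^ (2 * k + 1))"
    using Suc by auto
  have "(\<Sum>j\<le>Suc (Suc (2 * e)). (- 1) ^ j * qbinom x (Suc (Suc (2 * e))) j) =
      (1 - x ^ Suc (2 * e)) * (\<Sum>j\<le>2 * e. (- 1) ^ j * qbinom x (2 * e) j)"
    by (rule gauss_alternating_sum_rec[OF assms(1)]) (use Suc.prems in auto)
  thus ?case unfolding eq IH by (simp only: prod.lessThan_Suc) (simp add: mult.commute power_add)
qed simp

text \<open>Since x^(p-1) = 1/x, the j-th factor of the q-binomial coefficient collapses to
  -x^(-(j+1)); the product of these has a triangular number as exponent.\<close>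

lemma sum_quadratic_exponents:
  assumes p: "p = 2 * e + 1" and x: "x ^ p = 1" "\<And>i. 0 < i \<Longrightarrow> i < p \<Longrightarrow> x ^ i \<noteq> (1::complex)"
  shows "(\<Sum>j<p. inverse x ^ (\<Sum>i<j. Suc i)) = (\<Prod>k<e. 1 - x ^ (2 * k + 1))"
proof -
  have "p > 0" using p by simp
  hence x0: "x \<noteq> 0" using x(1) by (metis zero_power zero_neq_one)
  have "(- 1) ^ j * qbinom x (2 * e) j = inverse x ^ (\<Sum>i<j. Suc i)" if "j \<le> 2 * e" for j
    using that
  proof (induction j)
    case (Suc j)
    have "x ^ (2 * e) * x = 1" using x(1) by (simp add: p mult.commute power_add)
    hence "x ^ (2 * e) = inverse x" using x0 by (simp add: field_simps)
    hence "1 - x ^ (2 * e) / x ^ j = - (inverse x ^ Suc j) * (1 - x ^ Suc j)"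
      using x0 by (simp add: field_simps)
    moreover have "1 - x ^ Suc j \<noteq> 0" using x(2)[of "Suc j"] Suc.prems p by simp
    ultimately have "qbinom x (2 * e) (Suc j) = qbinom x (2 * e) j * - (inverse x ^ Suc j)"
      by (simp add: qbinom_Suc)
    hence "(- 1) ^ Suc j * qbinom x (2 * e) (Suc j) = ((- 1) ^ j * qbinom x (2 * e) j) * inverse x ^ Suc j"
      by simp
    also have "\<dots> = inverse x ^ (\<Sum>i<Suc j. Suc i)" using Suc by (simp add: power_add)
    finally show ?case .
  qed simp
  hence "(\<Sum>j\<le>2 * e. inverse x ^ (\<Sum>i<j. Suc i)) = (\<Sum>j\<le>2 * e. (- 1) ^ j * qbinom x (2 * e) j)"
    by (intro sum.cong) auto
  also have "\<dots> = (\<Prod>k<e. 1 - x ^ (2 * k + 1))"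
    by (rule gauss_alternating_sum[OF x0]) (use x(2) p in auto)
  also have "{..2 * e} = {..<p}" using p by auto
  finally show ?thesis .
qed

lemma sum_odd_numbers: "(\<Sum>k<e. 2 * k + 1) = e * (e::nat)"
  by (induction e) simp_all

lemma sum_zeta_squares_eq_prod:
  assumes p: "p = 2 * e + 1" and e: "e > 0"
  shows "(\<Sum>j<p. zeta p ^ (j ^ 2)) = (\<Prod>k<e. zeta p ^ (2 * k + 1) - inverse (zeta p ^ (2 * k + 1)))"
proof -
  define z where "z = zeta p"
  have p0: "p > 0" using p by simp
  have zp: "z ^ p = 1" and z0: "z \<noteq> 0" using p0 by (simp_all add: z_def)
  \<comment> \<open>The square makes triangular exponents into j^2 + j, and the inverse makes them
    positive.\<close>
  define x where "x = inverse (z ^ 2)"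
  have xp: "x ^ p = 1" by (simp add: x_def power_inverse flip: power_mult) (simp add: mult.commute[of 2] power_mult zp)
  have xi: "x ^ i \<noteq> 1" if "0 < i" "i < p" for i
  proof
    assume "x ^ i = 1"
    hence "z ^ (2 * i) = 1" by (simp add: x_def power_inverse power_mult)
    hence "p dvd 2 * i" unfolding z_def using zeta_power_eq_1_iff[OF p0] by blast
    moreover have "coprime p 2" using p by simp
    ultimately have "p dvd i" using coprime_dvd_mult_right_iff by blast
    thus False using that dvd_imp_le by fastforce
  qed
  have inv_x: "inverse x = z ^ 2" by (simp add: x_def)
  have tri: "2 * (\<Sum>i<j. Suc i) = j ^ 2 + j" for j :: nat
    by (induction j) (simp_all add: power2_eq_square)
  have "(\<Sum>j<p. z ^ (j ^ 2 + j)) = (\<Sum>j<p. inverse x ^ (\<Sum>i<j. Suc i))"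
    unfolding inv_x power_mult [symmetric] tri ..
  also have "\<dots> = (\<Prod>k<e. 1 - x ^ (2 * k + 1))" by (rule sum_quadratic_exponents[OF p xp xi])
  also have "\<dots> = (\<Prod>k<e. inverse (z ^ (2 * k + 1)) * (z ^ (2 * k + 1) - inverse (z ^ (2 * k + 1))))"
    using z0 by (intro prod.cong refl) (simp add: x_def power_inverse right_diff_distrib power2_eq_square power_mult_distrib)
  also have "\<dots> = inverse (z ^ (e * e)) * (\<Prod>k<e. z ^ (2 * k + 1) - inverse (z ^ (2 * k + 1)))"
  proof -
    have "(\<Prod>k<e. inverse (z ^ (2 * k + 1))) = inverse (z ^ (e * e))"
      unfolding prod_inversef [symmetric] sum_odd_numbers [symmetric] power_sum by simp
    thus ?thesis by (simp only: prod.distrib)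
  qed
  finally have A: "z ^ (e * e) * (\<Sum>j<p. z ^ (j ^ 2 + j)) = (\<Prod>k<e. z ^ (2 * k + 1) - inverse (z ^ (2 * k + 1)))"
    using z0 by simp
  \<comment> \<open>Completing the square: e + 1 is one half modulo p = 2 e + 1. The leftover factor
    with exponent e^2 is the product of the odd powers that was split off above.\<close>
  have "(\<Sum>j<p. z ^ (j ^ 2)) = (\<Sum>j<p. z ^ ((j + (e + 1)) ^ 2))"
  proof (rule sum_periodic_shift[symmetric, of "\<lambda>j. z ^ (j ^ 2)"])
    fix i show "z ^ ((i + p) ^ 2) = z ^ (i ^ 2)"
      by (rule power_eq_power_if_cong[OF zp]) (simp add: cong_def power_mod[symmetric, of "i + p"] power_mod)
  qed
  also have "\<dots> = (\<Sum>j<p. z ^ (e * e) * z ^ (j ^ 2 + j))"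
  proof (rule sum.cong[OF refl])
    fix j
    have "(j + (e + 1)) ^ 2 = (e * e + (j ^ 2 + j)) + p * (j + 1)"
      by (simp add: p power2_eq_square algebra_simps)
    thus "z ^ ((j + (e + 1)) ^ 2) = z ^ (e * e) * z ^ (j ^ 2 + j)"
      by (simp only: power_add power_mult zp power_one mult_1_right)
  qed
  finally show ?thesis using A unfolding z_def by (simp add: sum_distrib_left)
qed

text \<open>For \<open>p = 4n + 3\<close> exactly \<open>n\<close> of the \<open>2n + 1\<close> sines are negative.\<close>

lemma prod_sines_direction:
  assumes p: "p = 4 * n + 3"
  shows "\<exists>r>0. (\<Prod>k<2 * n + 1. zeta p ^ (2 * k + 1) - inverse (zeta p ^ (2 * k + 1))) = \<i> * of_real r"
proof -
  define s where "s = (\<lambda>k. 2 * sin (2 * pi * real (2 * k + 1) / real p))"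
  have term_eq: "zeta p ^ (2 * k + 1) - inverse (zeta p ^ (2 * k + 1)) = \<i> * of_real (s k)" for k
    unfolding zeta_power_eq_cis cis_inverse by (simp add: complex_eq_iff s_def)
  have pos: "s k > 0" if "k < n + 1" for k
  proof -
    have "real (2 * (2 * k + 1)) < real p" using that p by (intro of_nat_less_iff[THEN iffD2]) simp
    hence "pi * real (2 * (2 * k + 1)) < pi * real p" by (rule mult_strict_left_mono) simp
    moreover have "pi * real (2 * (2 * k + 1)) = 2 * pi * real (2 * k + 1)" by simp
    ultimately have "2 * pi * real (2 * k + 1) / real p < pi" using p by (subst pos_divide_less_eq) simp_all
    thus ?thesis unfolding s_def using p by (intro mult_pos_pos sin_gt_zero) auto
  qed
  have neg: "s k < 0" if "n + 1 \<le> k" "k < 2 * n + 1" for k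
  proof -
    have "real (2 * (2 * k + 1)) > real p" using that p by (intro of_nat_less_iff[THEN iffD2]) simp
    hence "pi * real p < pi * real (2 * (2 * k + 1))" by (rule mult_strict_left_mono) simp
    moreover have "pi * real (2 * (2 * k + 1)) = 2 * pi * real (2 * k + 1)" by simp
    ultimately have a: "2 * pi * real (2 * k + 1) / real p > pi" using p by (subst pos_less_divide_eq) simp_all
    have "real (2 * k + 1) < real p" using that p by (intro of_nat_less_iff[THEN iffD2]) simp
    hence "2 * pi * real (2 * k + 1) < 2 * pi * real p" by (rule mult_strict_left_mono) simp
    hence b: "2 * pi * real (2 * k + 1) / real p < 2 * pi" using p by (subst pos_divide_less_eq) simp_all
    show ?thesis using sin_lt_zero[OF a b] by (simp add: s_def)
  qed
  define r where "r = (\<Prod>k<n + 1. s k) * (\<Prod>k\<in>{n + 1..<2 * n + 1}. - s k)"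
  have "r > 0" unfolding r_def using pos neg by (intro mult_pos_pos prod_pos) auto
  have split: "{..<2 * n + 1} = {..<n + 1} \<union> {n + 1..<2 * n + 1}" by auto
  have "(\<Prod>k<2 * n + 1. s k) = (\<Prod>k<n + 1. s k) * (\<Prod>k\<in>{n + 1..<2 * n + 1}. s k)"
    unfolding split by (rule prod.union_disjoint) auto
  also have "(\<Prod>k\<in>{n + 1..<2 * n + 1}. s k) = (- 1) ^ n * (\<Prod>k\<in>{n + 1..<2 * n + 1}. - s k)"
    unfolding prod_uminus by (simp flip: power_add power_mult_distrib add: mult.assoc[symmetric])
  finally have "(\<Prod>k<2 * n + 1. s k) = (- 1) ^ n * r" by (simp add: r_def)
  moreover have "(\<Prod>k<2 * n + 1. zeta p ^ (2 * k + 1) - inverse (zeta p ^ (2 * k + 1))) =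
      \<i> ^ (2 * n + 1) * of_real (\<Prod>k<2 * n + 1. s k)"
    unfolding term_eq by (simp add: prod.distrib)
  ultimately have "(\<Prod>k<2 * n + 1. zeta p ^ (2 * k + 1) - inverse (zeta p ^ (2 * k + 1))) =
      \<i> ^ (2 * n + 1) * (- 1) ^ n * of_real r" by simp
  also have "\<i> ^ (2 * n + 1) * (- 1) ^ n = \<i>"
  proof -
    have "\<i> ^ (2 * n) = (- 1) ^ n" by (simp only: power_mult power2_i)
    thus ?thesis by (simp only: power_add power_one_right) (simp add: mult.commute)
  qed
  finally have "(\<Prod>k<2 * n + 1. zeta p ^ (2 * k + 1) - inverse (zeta p ^ (2 * k + 1))) = \<i> * of_real r" .
  thus ?thesis using \<open>r > 0\<close> by blast
qed

section \<open>The quadratic Gauss sum over the prime field and its extensions of odd degree\<close>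

lemma sum_lessThan_add:
  fixes f :: "nat \<Rightarrow> 'a::comm_monoid_add"
  shows "(\<Sum>i<a + b. f i) = (\<Sum>i<a. f i) + (\<Sum>i<b. f (i + a))"
  by (induction b) (simp_all add: add_ac)

lemma sum_double:
  fixes f :: "nat \<Rightarrow> complex"
  shows "(\<Sum>i<2 * e. f i) = (\<Sum>i<e. f (2 * i) + f (2 * i + 1))"
  by (induction e) (simp_all add: add_ac One_nat_def)

context gen_field begin

lemma GS_minus_one_square: "GS (- 1) ^ 2 = (- 1) ^ ((q - 1) div 2) * of_nat q"
proof -
  have "(- 1 :: complex) ^ (q - 1) = 1" using q1_even by simp
  from GS_mult_inverse[OF this] show ?thesis by (simp add: power2_eq_square)
qed

lemma sub_gen_field:
  assumes n: "n = a * s" and a: "a > 0"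
  shows "gen_field p a (g ^ ((q - 1) div (p ^ a - 1)))"
proof -
  define R where "R = (\<Sum>i<s. (p ^ a) ^ i)"
  have pa: "p ^ a > 1" using a by (intro one_less_power[OF p_gt_1])
  have R: "q - 1 = R * (p ^ a - 1)" using geometric_nat[of "p ^ a" s] pa
    by (simp add: R_def n power_mult mult.commute)
  have R': "(q - 1) div (p ^ a - 1) = R" unfolding R using pa by (intro nonzero_mult_div_cancel_right) simp
  have R0: "R > 0" using R q1_pos by (cases R) auto
  have iff: "x ^ (p ^ a) = x \<longleftrightarrow> x ^ (p ^ a - 1) = 1" if "x \<noteq> 0" for x :: 'a
  proof -
    have "x ^ (p ^ a - 1) * x = x ^ (p ^ a)" using pa by (intro power_minus_mult) linarith
    thus ?thesis using that by auto
  qed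
  have eq: "(g ^ R) ^ i = (g ^ R) ^ j \<longleftrightarrow> [i = j] (mod (p ^ a - 1))" for i j
  proof -
    have "(g ^ R) ^ i = (g ^ R) ^ j \<longleftrightarrow> [R * i = R * j] (mod (R * (p ^ a - 1)))"
      unfolding power_mult [symmetric] g_pow_eq_iff R ..
    thus ?thesis using R0 by (simp add: cong_def mult_mod_right [symmetric])
  qed
  have "bij_betw (\<lambda>i. (g ^ R) ^ i) {..<p ^ a - 1} ({x. x ^ (p ^ a) = x} - {0})"
  proof (rule bij_betw_imageI)
    show "inj_on (\<lambda>i. (g ^ R) ^ i) {..<p ^ a - 1}"
      by (rule inj_onI) (simp add: eq cong_def)
    show "(\<lambda>i. (g ^ R) ^ i) ` {..<p ^ a - 1} = {x. x ^ (p ^ a) = x} - {0}"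
    proof (intro equalityI subsetI)
      fix x assume "x \<in> (\<lambda>i. (g ^ R) ^ i) ` {..<p ^ a - 1}"
      then obtain i where i: "x = (g ^ R) ^ i" by blast
      have x0: "x \<noteq> 0" using i g_nonzero by simp
      have "x ^ (p ^ a - 1) = (g ^ (q - 1)) ^ i" unfolding i R by (simp add: power_mult [symmetric] mult_ac)
      hence "x ^ (p ^ a - 1) = 1" by (simp only: g_pow power_one)
      thus "x \<in> {x. x ^ (p ^ a) = x} - {0}" unfolding iff[OF x0, symmetric] using x0 by simp
    next
      fix x :: 'a assume x: "x \<in> {x. x ^ (p ^ a) = x} - {0}"
      hence x0: "x \<noteq> 0" by simp
      have x1: "x ^ (p ^ a - 1) = 1" unfolding iff[OF x0, symmetric] using x by simp
      have "x ^ (q - 1) = (x ^ (p ^ a - 1)) ^ R" unfolding R power_mult [symmetric] by (simp only: mult.commute)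
      hence "x ^ (q - 1) = 1" by (simp only: x1 power_one)
      moreover have "x ^ (q - 1) * x = x ^ q" using q_gt_1 by (intro power_minus_mult) linarith
      ultimately have "x \<in> F" by simp
      then obtain i where i: "x = g ^ i" using F_obtain x0 by blast
      have "g ^ (i * (p ^ a - 1)) = g ^ 0" using x1 unfolding i power_mult [symmetric] by simp
      hence "q - 1 dvd i * (p ^ a - 1)" unfolding g_pow_eq_iff cong_0_iff .
      hence "R dvd i" unfolding R using pa by simp
      then obtain j where j: "i = R * j" by blast
      have "x = (g ^ R) ^ (j mod (p ^ a - 1))"
        unfolding i j power_mult by (simp only: eq cong_mod_right cong_refl)
      thus "x \<in> (\<lambda>i. (g ^ R) ^ i) ` {..<p ^ a - 1}" using pa by (intro image_eqI) auto
    qed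
  qed
  thus ?thesis unfolding R' using prime_p odd_p char_p a by unfold_locales
qed

end

text \<open>Counting square roots identifies the quadratic Gauss sum with the sum of
  \<zeta>_p^(j^2). The sine product shows that it is a positive multiple of \<i>, and its square -p
  fixes the absolute value.\<close>

theorem GS_quadratic_prime_field:
  assumes "gen_field p 1 (g :: 'a::alg_closed_field)" "p mod 4 = 3"
  shows "log_trace.GS p (p - 1) (gen_field.\<tau> p 1 g) (- 1) = csqrt (- of_nat p)"
proof -
  interpret gen_field p 1 g by (rule assms)
  obtain n where p: "p = 4 * n + 3" using assms(2) by (metis mod_mult_div_eq add.commute mult.commute)
  define e where "e = 2 * n + 1"
  have pe: "p = 2 * e + 1" by (simp add: e_def p)
  have p1: "p ^ 1 - 1 = 2 * e" using pe by simp
  have psi_nat: "psi p 1 (of_nat k :: 'a) = zeta p ^ k" for k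
  proof -
    have "psi p 1 (of_nat k :: 'a) = zeta p ^ (k mod p)"
      by (simp add: psi_def tr_def rep_of_nat[OF prime_p char_p])
    also have "\<dots> = zeta p ^ k"
      using p_gt_1 by (intro power_eq_power_if_cong[of _ p]) auto
    finally show ?thesis .
  qed
  have F_nat: "bij_betw of_nat {..<p} F"
    using prime_field_eq[OF prime_p char_p] of_nat_inj_CHAR[OF char_p]
    by (intro bij_betw_imageI inj_onI) (auto simp: cong_def)
  have "(\<Sum>j<p. zeta p ^ (j ^ 2)) = (\<Sum>j<p. psi p 1 ((of_nat j :: 'a) ^ 2))"
    unfolding of_nat_power [symmetric] psi_nat ..
  also have "\<dots> = (\<Sum>x\<in>F. psi p 1 (x ^ 2))"
    by (rule sum.reindex_bij_betw[OF F_nat])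
  also have "\<dots> = 1 + (\<Sum>i<2 * e. zeta p ^ \<tau> (i * 2))"
  proof -
    have "(\<Sum>x\<in>F. psi p 1 (x ^ 2)) = psi p 1 ((0::'a) ^ 2) + (\<Sum>i<p ^ 1 - 1. psi p 1 ((g ^ i) ^ 2))"
      by (rule sum_F)
    moreover have "psi p 1 ((0::'a) ^ 2) = 1" using psi_0[OF prime_p char_p, of 1] by simp
    moreover have "psi p 1 ((g ^ i) ^ 2) = zeta p ^ \<tau> (i * 2)" for i
      by (simp only: power_mult [symmetric] psi_g)
    ultimately show ?thesis by (simp only: p1)
  qed
  \<comment> \<open>Doubling hits each even exponent twice, and 1 + (-1)^i is 2 at even and 0 at odd
    exponents.\<close>
  also have "(\<Sum>i<2 * e. zeta p ^ \<tau> (i * 2)) = (\<Sum>i<2 * e. zeta p ^ \<tau> i * (1 + (- 1) ^ i))"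
  proof -
    have "(\<Sum>i<e + e. zeta p ^ \<tau> (i * 2)) = (\<Sum>i<e. zeta p ^ \<tau> (i * 2)) + (\<Sum>i<e. zeta p ^ \<tau> ((i + e) * 2))"
      by (rule sum_lessThan_add)
    moreover have "\<tau> ((i + e) * 2) = \<tau> (i * 2)" for i
      using periodic[of "i * 2"] unfolding p1 by (simp add: distrib_right mult.commute)
    ultimately have "(\<Sum>i<2 * e. zeta p ^ \<tau> (i * 2)) = 2 * (\<Sum>i<e. zeta p ^ \<tau> (i * 2))"
      by (simp only: mult_2)
    moreover have "(\<Sum>i<2 * e. zeta p ^ \<tau> i * (1 + (- 1) ^ i)) = (\<Sum>i<e. 2 * zeta p ^ \<tau> (i * 2))"
    proof -
      have "zeta p ^ \<tau> (2 * i) * (1 + (- 1) ^ (2 * i)) + zeta p ^ \<tau> (2 * i + 1) * (1 + (- 1) ^ (2 * i + 1)) =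
          2 * zeta p ^ \<tau> (i * 2)" for i
        by (simp add: mult.commute[of i])
      thus ?thesis unfolding sum_double by (simp only:)
    qed
    ultimately show ?thesis by (simp only: sum_distrib_left)
  qed
  also have "1 + \<dots> = GS (- 1)"
  proof -
    have s0: "(\<Sum>i<2 * e. zeta p ^ \<tau> i) = - 1" using sum_psi by (simp only: p1)
    have gs: "GS (- 1) = (\<Sum>i<2 * e. zeta p ^ \<tau> i * (- 1) ^ i)" unfolding GS_def unfolding p1 ..
    show ?thesis unfolding gs distrib_left sum.distrib mult_1_right s0 by simp
  qed
  finally have "GS (- 1) = (\<Prod>k<e. zeta p ^ (2 * k + 1) - inverse (zeta p ^ (2 * k + 1)))"
    using sum_zeta_squares_eq_prod[OF pe] by (simp add: e_def)
  then obtain r where r: "r > 0" "GS (- 1) = \<i> * of_real r"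
    using prod_sines_direction[OF p] unfolding e_def by metis
  have "GS (- 1) ^ 2 = - of_nat p"
    using GS_minus_one_square unfolding p1 by (simp add: e_def)
  hence "of_real (r ^ 2) = (of_real (real p) :: complex)"
    unfolding r(2) by (simp add: power_mult_distrib)
  hence "r ^ 2 = real p" by (simp only: of_real_eq_iff)
  hence "r = sqrt (real p)" using r(1) by (simp add: real_sqrt_unique)
  moreover have "csqrt (- of_nat p) = \<i> * of_real (sqrt (real p))"
    using csqrt_of_real_nonpos[of "- real p"] by simp
  ultimately show ?thesis using r(2) by simp
qed

lemma (in gen_field) GS_quadratic:
  assumes "p mod 4 = 3" "odd n"
  shows "GS (- 1) = csqrt (- of_nat p) ^ n"
proof -
  define g1 where "g1 = g ^ ((q - 1) div (p ^ 1 - 1))"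
  have g1: "gen_field p 1 g1" unfolding g1_def by (rule sub_gen_field[of 1 n]) simp_all
  have "GS (- 1) = (- 1) ^ (n - 1) * log_trace.GS p (p ^ 1 - 1) (gen_field.\<tau> p 1 g1) (- 1) ^ n"
    using gen_field.GS_lift[OF g1, of n g "- 1"] gen_field_axioms n_pos g1_def odd_p by simp
  thus ?thesis using GS_quadratic_prime_field[OF g1 assms(1)] assms(2) by simp
qed

section \<open>Pure Gauss sums\<close>

lemma power_int_cong:
  fixes z :: complex
  assumes "z ^ n = 1" "n > 0" "[a = b] (mod int n)"
  shows "z powi a = z powi b"
proof -
  have z0: "z \<noteq> 0" using assms(1,2) by (auto simp: zero_power)
  obtain k where k: "a = b + int n * k" using assms(3) by (metis cong_iff_lin cong_sym)
  have "z powi (int n * k) = 1" by (simp add: power_int_mult assms(1))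
  thus ?thesis using z0 by (simp add: k power_int_add)
qed

lemma root_of_unity_mult: "root_of_unity x \<Longrightarrow> root_of_unity y \<Longrightarrow> root_of_unity (x * y)"
proof -
  assume "root_of_unity x" "root_of_unity y"
  then obtain a b where "a > 0" "x ^ a = 1" "b > 0" "y ^ b = 1" by (auto simp: root_of_unity_def)
  hence "(x * y) ^ (a * b) = 1" "a * b > 0"
    by (simp_all add: power_mult_distrib power_mult) (metis mult.commute power_mult power_one)
  thus ?thesis unfolding root_of_unity_def by blast
qed

lemma root_of_unity_power_iff: "k > 0 \<Longrightarrow> root_of_unity (x ^ k) \<longleftrightarrow> root_of_unity x"
  unfolding root_of_unity_def
  by (metis mult.commute power_mult power_one nat_0_less_mult_iff)

lemma root_of_unity_prod: "finite S \<Longrightarrow> (\<And>i. i \<in> S \<Longrightarrow> root_of_unity (f i)) \<Longrightarrow> root_of_unity (\<Prod>i\<in>S. f i)"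
proof (induction S rule: finite_induct)
  case empty
  then show ?case by (auto simp: root_of_unity_def intro: exI[of _ 1])
next
  case (insert x S)
  then show ?case by (simp add: root_of_unity_mult)
qed

lemma eq_1_if_coprime_powers:
  fixes x :: "'a::field"
  assumes "x ^ a = 1" "x ^ b = 1" "coprime a b"
  shows "x = 1"
proof -
  have sym: "x = 1" if h: "x ^ a = 1" "x ^ b = 1" "coprime a b" "a > 0" for a b :: nat
  proof -
    obtain s t where "a * s = b * t + gcd a b" using bezout_nat[of a b] h(4) by auto
    hence "x ^ (a * s) = x ^ (b * t) * x" using h(3) by (simp add: power_add)
    thus ?thesis using h(1,2) by (simp add: power_mult)
  qed
  show ?thesis
  proof (cases "a = 0")
    case True
    hence "b = 1" using assms(3) by simp
    thus ?thesis using assms(2) by simp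
  qed (use sym[OF assms] in auto)
qed

lemma (in gen_field) GS_minus_one_square_neg:
  assumes "p mod 4 = 3" "odd n"
  shows "GS (- 1) ^ 2 = - of_nat q"
proof -
  obtain k where k: "n = 2 * k + 1" using assms(2) oddE by blast
  have p2: "(p ^ 2) mod 4 = 1" using assms(1) by (simp add: power2_eq_square mod_mult_eq[symmetric, of p p])
  have "q = p * (p ^ 2) ^ k" unfolding k power_add power_mult power_one_right by (rule mult.commute)
  moreover have "(p ^ 2) ^ k mod 4 = 1" using p2 by (metis power_mod power_one one_mod_2_pow_eq mod_less one_less_numeral_iff semiring_norm(76))
  ultimately have "q mod 4 = 3" using assms(1) by (metis mod_mult_eq mult.right_neutral mod_mod_trivial)
  hence "odd ((q - 1) div 2)" by presburger
  thus ?thesis using GS_minus_one_square by simp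
qed

text \<open>\<open>pure_order\<close> is property (\<star>) rephrased for the value z of a character
  at the generator and measured against the quadratic Gauss sum. In \<open>t_rel\<close> the
  exponents \<open>e\<close> and \<open>e1\<close> stand for \<eta>_(2 m_1 m_i) and \<eta>_(2 m_1)
  as powers of \<eta>_N, described by congruences.\<close>

locale pure_setup = gen_field p n g for p n and g :: "'a::alg_closed_field" +
  fixes r m N :: nat and pr u ms :: "nat \<Rightarrow> nat" and t :: "nat \<Rightarrow> int" and A :: int
  assumes p_mod: "p mod 4 = 3" and n_odd: "odd n" and r_pos: "r \<ge> 1"
    and pr_prime: "\<And>i. i \<in> {1..r} \<Longrightarrow> prime (pr i)"
    and pr_odd: "\<And>i. i \<in> {1..r} \<Longrightarrow> odd (pr i)"
    and u_pos: "\<And>i. i \<in> {1..r} \<Longrightarrow> u i \<ge> 1"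
    and ms_eq: "\<And>i. i \<in> {1..r} \<Longrightarrow> ms i = pr i ^ u i"
    and inj_pr: "inj_on pr {1..r}"
    and m_eq: "m = (\<Prod>i\<in>{1..r}. ms i)" and N_eq: "N = 2 * m" and N_dvd: "N dvd q - 1"
    and pure_order: "\<And>J z. J \<subseteq> {1..r} \<Longrightarrow> 1 \<in> J \<Longrightarrow> (\<And>k. z ^ k = 1 \<longleftrightarrow> 2 * (\<Prod>i\<in>J. ms i) dvd k) \<Longrightarrow>
        root_of_unity (GS z / GS (- 1))"
    and A_eq: "A = (\<Sum>i\<in>{1..r}. t i * (\<Prod>j\<in>{1..r} - {i}. int (ms j)))" and t_1: "t 1 = 0"
    and t_rel: "\<And>i. i \<in> {2..r} \<Longrightarrow> \<exists>e e1. [e = 1] (mod 2 * ms 1 * ms i) \<and> (\<forall>k\<in>{1..r} - {1, i}. ms k dvd e) \<and>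
        [e1 = 1] (mod 2 * ms 1) \<and> (\<forall>k\<in>{1..r} - {1}. ms k dvd e1) \<and>
        GS (zeta N ^ e) = zeta (ms i) powi t i * GS (zeta N ^ e1)"
begin

lemma one_in: "1 \<in> {1..r}"
  using r_pos by simp

lemma ms_pos: "i \<in> {1..r} \<Longrightarrow> ms i > 0"
  using ms_eq pr_prime prime_gt_0_nat by simp

lemma ms_odd: "i \<in> {1..r} \<Longrightarrow> odd (ms i)"
  using ms_eq pr_odd by simp

lemma pr_dvd_ms: "i \<in> {1..r} \<Longrightarrow> pr i dvd ms i"
  unfolding ms_eq using u_pos[of i] by (intro dvd_power) simp

lemma ms_dvd_m: "i \<in> {1..r} \<Longrightarrow> ms i dvd m"
  unfolding m_eq by (rule dvd_prodI) simp_all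

lemma pr_dvd_m: "i \<in> {1..r} \<Longrightarrow> pr i dvd m"
  by (rule dvd_trans[OF pr_dvd_ms ms_dvd_m])

lemma ms_gt_1: "i \<in> {1..r} \<Longrightarrow> ms i > 1"
  by (rule less_le_trans[OF prime_gt_1_nat[OF pr_prime] dvd_imp_le[OF pr_dvd_ms ms_pos]])

lemma coprime_ms: "i \<in> {1..r} \<Longrightarrow> k \<in> {1..r} \<Longrightarrow> i \<noteq> k \<Longrightarrow> coprime (ms i) (ms k)"
  using inj_onD[OF inj_pr, of i k] primes_coprime[OF pr_prime pr_prime, of i k] by (auto simp: ms_eq)

lemma m_odd: "odd m" and m_pos: "m > 0"
  using ms_odd ms_pos by (auto simp: m_eq even_prod_iff intro!: prod_pos)

lemma N_pos: "N > 0" and N_even: "even N"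
  using m_pos by (simp_all add: N_eq)

lemma prod_dvd_int_iff:
  assumes "S \<subseteq> {1..r}"
  shows "int (\<Prod>i\<in>S. ms i) dvd x \<longleftrightarrow> (\<forall>i\<in>S. int (ms i) dvd x)"
proof -
  have "finite S" using assms finite_subset by blast
  thus ?thesis using assms
  proof (induction S)
    case (insert k S)
    have "coprime (int (ms k)) (int (\<Prod>i\<in>S. ms i))"
      unfolding coprime_int_iff
      by (intro prod_coprime_right coprime_ms) (use insert in auto)
    hence "int (ms k) * int (\<Prod>i\<in>S. ms i) dvd x \<longleftrightarrow> int (ms k) dvd x \<and> int (\<Prod>i\<in>S. ms i) dvd x"
      by (auto intro: divides_mult dvd_mult_left dvd_mult_right)
    thus ?case using insert by simp
  qed simp
qed

lemma N_dvd_int_iff: "int N dvd x \<longleftrightarrow> even x \<and> (\<forall>i\<in>{1..r}. int (ms i) dvd x)"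
proof -
  have "coprime 2 (int m)" using m_odd by simp
  hence "2 * int m dvd x \<longleftrightarrow> even x \<and> int m dvd x"
    by (auto intro: divides_mult dvd_mult_left dvd_mult_right)
  thus ?thesis using prod_dvd_int_iff[of "{1..r}" x] by (simp add: N_eq m_eq)
qed

lemma N_dvd_iff: "N dvd x \<longleftrightarrow> even x \<and> (\<forall>i\<in>{1..r}. ms i dvd x)"
  using N_dvd_int_iff[of "int x"] by (simp only: int_dvd_int_iff even_of_nat)

lemma cong_N_iff: "[x = y] (mod N) \<longleftrightarrow> (even x \<longleftrightarrow> even y) \<and> (\<forall>i\<in>{1..r}. [x = y] (mod ms i))"
proof -
  have "[x = y] (mod k) \<longleftrightarrow> int k dvd int x - int y" for k
    by (metis cong_iff_dvd_diff cong_int_iff)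
  moreover have "even (int x - int y) \<longleftrightarrow> (even x \<longleftrightarrow> even y)" by simp
  ultimately show ?thesis using N_dvd_int_iff[of "int x - int y"] by simp
qed

text \<open>The cofactor of \<open>ms i\<close> in N; it is coprime to \<open>ms i\<close>, which
  allows j to be changed modulo one prime power at a time.\<close>

definition co :: "nat \<Rightarrow> nat" where
  "co i = 2 * (\<Prod>k\<in>{1..r} - {i}. ms k)"

lemma N_co: "i \<in> {1..r} \<Longrightarrow> N = ms i * co i"
  by (simp add: N_eq m_eq co_def prod.remove[of "{1..r}" i ms])

lemma coprime_ms_co:
  assumes i: "i \<in> {1..r}"
  shows "coprime (ms i) (co i)"
proof -
  have "coprime (ms i) (\<Prod>k\<in>{1..r} - {i}. ms k)"
    by (intro prod_coprime_right coprime_ms i) auto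
  thus ?thesis using ms_odd[OF i] by (simp add: co_def)
qed

lemma ms_dvd_co: "k \<in> {1..r} \<Longrightarrow> k \<noteq> i \<Longrightarrow> ms k dvd co i"
  unfolding co_def by (intro dvd_mult dvd_prodI) auto

lemma even_co: "even (co i)"
  by (simp add: co_def)

lemma exists_cong:
  assumes "i \<in> {1..r}"
  obtains j' where "[j' = j] (mod co i)" "[j' = b] (mod ms i)" "even j' \<longleftrightarrow> even j"
    "\<And>k. k \<in> {1..r} \<Longrightarrow> k \<noteq> i \<Longrightarrow> [j' = j] (mod ms k)"
proof -
  obtain j' where j': "[j' = b] (mod ms i)" "[j' = j] (mod co i)"
    using binary_chinese_remainder_nat[OF coprime_ms_co[OF assms]] by blast
  moreover have "even j' \<longleftrightarrow> even j" using even_co j'(2) by (metis cong_dvd_modulus_nat cong_dvd_iff dvd_refl)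
  moreover have "[j' = j] (mod ms k)" if "k \<in> {1..r}" "k \<noteq> i" for k
    using cong_dvd_modulus_nat[OF j'(2) ms_dvd_co[OF that]] .
  ultimately show ?thesis using that by blast
qed

lemma zN_pow [simp]: "zeta N ^ N = 1"
  using N_pos by simp

lemma zN_power_pow: "(zeta N ^ j) ^ N = 1"
  by (metis mult.commute power_mult power_one zN_pow)

lemma zN_cong: "[i = j] (mod N) \<Longrightarrow> zeta N ^ i = zeta N ^ j"
  by (rule power_eq_power_if_cong[OF zN_pow])

lemma zN_m: "zeta N ^ m = - 1"
proof -
  have "(zeta N ^ m) ^ 2 = 1" using zN_pow by (simp only: power_mult [symmetric] N_eq mult.commute)
  moreover have "zeta N ^ m \<noteq> 1"
    using zeta_power_eq_1_iff[OF N_pos, of m] m_pos by (auto simp: N_eq dest: dvd_imp_le)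
  ultimately show ?thesis by (simp add: power2_eq_1_iff)
qed

lemma GS_m1_square: "GS (- 1) ^ 2 = of_int (- int q)"
  using GS_minus_one_square_neg[OF p_mod n_odd] by simp

lemma GS_m1_nonzero: "GS (- 1) \<noteq> 0"
proof
  assume "GS (- 1) = 0"
  hence "(of_int (- int q) :: complex) = 0" using GS_m1_square by simp
  hence "- int q = 0" by (simp only: of_int_eq_0_iff)
  thus False using q_gt_1 by linarith
qed

section \<open>Ratios to the quadratic Gauss sum and their purity\<close>

definition rr :: "nat \<Rightarrow> complex" where
  "rr j = GS (zeta N ^ j) / GS (- 1)"

definition pure :: "nat \<Rightarrow> bool" where
  "pure j \<longleftrightarrow> root_of_unity (rr j)"

lemma GS_rr: "GS (zeta N ^ j) = rr j * GS (- 1)"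
  using GS_m1_nonzero by (simp add: rr_def)

lemma rr_cong: "[i = j] (mod N) \<Longrightarrow> rr i = rr j"
  using zN_cong by (simp add: rr_def)

lemma rr_m: "rr m = 1"
  using GS_m1_nonzero by (simp add: rr_def zN_m)

lemma pure_m: "pure m"
  by (auto simp: pure_def rr_m root_of_unity_def intro: exI[of _ 1])

lemma rr_pow: "pure j \<Longrightarrow> rr j ^ N = 1"
  unfolding pure_def by (rule pure_ratio_pow[OF N_pos N_even N_dvd zN_power_pow _ GS_rr GS_m1_nonzero])

lemma rr_galois:
  assumes "pure j" "coprime c N"
  shows "rr (j * c) = rr j ^ c"
  using pure_ratio_galois[OF N_pos N_even N_dvd zN_power_pow[of j] rr_pow[OF assms(1)] GS_rr assms(2)] GS_m1_nonzero
  by (simp add: rr_def power_mult)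

lemma rr_frobenius: "pure j \<Longrightarrow> rr j ^ p = rr j"
  by (rule pure_ratio_frobenius[OF N_pos N_even N_dvd zN_power_pow[of j] rr_pow GS_rr GS_m1_nonzero])

lemma rr_on_prime_field:
  assumes "pure j" "g ^ e = of_nat c" "\<not> p dvd c"
  shows "zeta N ^ (j * e) = (- 1) ^ e"
  using pure_char_on_prime_field[OF N_pos N_even N_dvd zN_power_pow[of j] rr_pow[OF assms(1)] GS_rr GS_m1_nonzero
      assms(3), of e] tau_scale[OF assms(2)] by (simp add: power_mult)

lemma pr_not_dvd_co:
  assumes i: "i \<in> {1..r}"
  shows "\<not> pr i dvd co i"
  using coprime_ms_co[OF i] pr_dvd_ms[OF i] pr_prime[OF i] by (meson coprime_common_divisor not_prime_unit)

lemma pr_ne_p: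
  assumes i: "i \<in> {1..r}"
  shows "coprime (pr i) p"
proof -
  have "pr i dvd N" using pr_dvd_ms[OF i] N_co[OF i] by simp
  thus ?thesis using coprime_p_N[OF N_dvd] by (meson coprime_divisors dvd_refl)
qed

lemma rr_cong_power:
  assumes i: "i \<in> {1..r}" and "pure j" "pure j'" "[j * ms i = j' * ms i] (mod N)"
  shows "rr j ^ ms i = rr j' ^ ms i"
  unfolding ms_eq[OF i]
proof (rule pure_ratio_cong[OF N_pos N_even N_dvd zN_power_pow[of j] rr_pow[OF assms(2)] GS_rr
      zN_power_pow[of j'] rr_pow[OF assms(3)] GS_rr pr_prime[OF i] _ _ pr_not_dvd_co[OF i] GS_m1_square])
  show "(zeta N ^ j) ^ (pr i ^ u i) = (zeta N ^ j') ^ (pr i ^ u i)"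
    using zN_cong[OF assms(4)] by (simp add: power_mult ms_eq[OF i])
  show "N dvd pr i ^ u i * co i" using N_co[OF i] ms_eq[OF i] by simp
  show "\<not> int (pr i) dvd - int q"
  proof
    assume "int (pr i) dvd - int q"
    hence "pr i dvd p ^ n" by (simp only: dvd_minus_iff int_dvd_int_iff)
    moreover have "coprime (pr i) (p ^ n)" using pr_ne_p[OF i] by simp
    ultimately show False using pr_prime[OF i] by (meson coprime_common_divisor dvd_refl not_prime_unit)
  qed
qed

text \<open>Two factors of the product formula must be seen to be harmless. The Gauss sums of order
  \<open>pr i\<close> pair off with their inverses, so the square of their product is that of
  \<open>GS (-1) ^ (l - 1)\<close>. The character value at l is a sign because a pure character is
  quadratic on the prime field.\<close>

lemma hd_step:
  assumes i: "i \<in> {1..r}" and pure: "\<And>k. k < pr i \<Longrightarrow> pure (j + k * (N div pr i))"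
  obtains \<sigma> where "\<sigma> = 1 \<or> \<sigma> = - 1" "rr (pr i * j) = \<sigma> * (\<Prod>k<pr i. rr (j + k * (N div pr i)))"
proof -
  define l where "l = pr i"
  define z where "z = zeta N ^ j"
  have l: "prime l" "odd l" "l dvd N" "coprime l p"
    using pr_prime pr_odd pr_dvd_ms N_co pr_ne_p i by (auto simp: l_def)
  have l0: "l > 0" using l(1) prime_gt_0_nat by blast
  obtain h where h: "l = 2 * h + 1" using l(2) oddE by blast
  have zl: "zeta l = zeta N ^ (N div l)"
    using zeta_mult_power[of "N div l" l] l(3) N_pos by (auto elim!: dvdE)
  \<comment> \<open>Hence characters of order l take the value 1 at -1, and each pair of inverse
    ones contributes exactly q.\<close>
  have lm: "l dvd (q - 1) div 2"
  proof -
    obtain c where "q - 1 = N * c" using N_dvd by blast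
    hence "(q - 1) div 2 = m * c" by (simp add: N_eq)
    moreover have "l dvd m" using l(2,3) by (metis N_eq coprime_commute coprime_dvd_mult_right_iff coprime_right_2_iff_odd)
    ultimately show ?thesis by simp
  qed
  have zq: "z ^ (q - 1) = 1" unfolding z_def using N_dvd zN_power_pow by (metis dvdE power_mult power_one)
  define Pi where "Pi = (\<Prod>k\<in>{1..<l}. GS (zeta l ^ k))"
  have "Pi * Pi = (\<Prod>k\<in>{1..<l}. GS (zeta l ^ k)) * (\<Prod>k\<in>{1..<l}. GS (zeta l ^ (l - k)))"
  proof -
    have "(\<Prod>k\<in>{1..<l}. GS (zeta l ^ (l - k))) = Pi" unfolding Pi_def
      by (rule prod.reindex_bij_witness[of _ "\<lambda>k. l - k" "\<lambda>k. l - k"]) auto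
    thus ?thesis by (simp add: Pi_def)
  qed
  also have "\<dots> = (\<Prod>k\<in>{1..<l}. of_nat q)"
    unfolding prod.distrib [symmetric]
  proof (rule prod.cong[OF refl])
    fix k assume k: "k \<in> {1..<l}"
    have inv: "inverse (zeta l ^ k) = zeta l ^ (l - k)"
    proof -
      have "zeta l ^ (l - k) * zeta l ^ k = 1" using k l0 by (simp flip: power_add)
      thus ?thesis by (metis inverse_unique mult.commute)
    qed
    have ne: "zeta l ^ k \<noteq> 1" using zeta_power_eq_1_iff[OF l0, of k] k by (auto dest: dvd_imp_le)
    have one: "(zeta l ^ k) ^ a = 1" if "l dvd a" for a
      using that zeta_power_self[OF l0] by (metis dvdE mult.commute power_mult power_one)
    have "l dvd q - 1" using l(3) N_dvd by (rule dvd_trans)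
    thus "GS (zeta l ^ k) * GS (zeta l ^ (l - k)) = of_nat q"
      using GS_mult_inverse[OF one ne] one[OF lm] unfolding inv by (simp only: mult_1)
  qed
  also have "\<dots> = (GS (- 1) ^ (l - 1)) ^ 2"
  proof -
    have "(GS (- 1) ^ (l - 1)) ^ 2 = (GS (- 1) ^ 2) ^ (2 * h)"
      by (simp only: h power_mult [symmetric] mult.commute diff_add_inverse2)
    also have "\<dots> = ((- of_nat q) ^ 2) ^ h" unfolding GS_m1_square power_mult by simp
    also have "\<dots> = of_nat q ^ (l - 1)" by (simp add: h power_mult)
    finally show ?thesis by simp
  qed
  finally have "Pi ^ 2 = (GS (- 1) ^ (l - 1)) ^ 2" by (simp only: power2_eq_square)
  hence "Pi = 1 * GS (- 1) ^ (l - 1) \<or> Pi = - 1 * GS (- 1) ^ (l - 1)" by (simp add: power2_eq_iff)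
  then obtain \<sigma>1 where s1: "\<sigma>1 = 1 \<or> \<sigma>1 = (- 1 :: complex)" "Pi = \<sigma>1 * GS (- 1) ^ (l - 1)"
    by blast
  have l_F: "of_nat l \<noteq> (0::'a)"
    using l(4) p_gt_1 by (simp add: of_nat_eq_0_iff_char_dvd char_p) (metis coprime_absorb_right less_irrefl nat_dvd_1_iff_1)
  hence pl: "\<not> p dvd l" by (simp add: of_nat_eq_0_iff_char_dvd char_p)
  obtain e where e: "g ^ e = of_nat l" using F_obtain[OF of_nat_in_F l_F] by metis
  have pj: "pure j" using pure[of 0] l0 by (simp add: l_def)
  have ze: "z ^ (l * e) = (- 1) ^ (e * l)"
    using rr_on_prime_field[OF pj e pl] unfolding z_def
    by (metis (no_types, lifting) mult.assoc mult.commute power_mult)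
  define \<sigma>2 where "\<sigma>2 = (- 1 :: complex) ^ (e * l)"
  have s2: "\<sigma>2 = 1 \<or> \<sigma>2 = - 1" unfolding \<sigma>2_def by (cases "even (e * l)") auto
  have prods: "(\<Prod>k<l. GS (z * zeta l ^ k)) = (\<Prod>k<l. rr (j + k * (N div l))) * GS (- 1) ^ l"
  proof -
    have "z * zeta l ^ k = zeta N ^ (j + k * (N div l))" for k
      by (simp add: z_def zl power_add power_mult [symmetric] mult.commute)
    thus ?thesis by (simp add: GS_rr prod.distrib)
  qed
  have "\<sigma>2 * ((\<Prod>k<l. rr (j + k * (N div l))) * GS (- 1) ^ l) = rr (l * j) * GS (- 1) * (\<sigma>1 * GS (- 1) ^ (l - 1))"
    using GS_product[OF l(2) dvd_trans[OF l(3) N_dvd] l(4) zq e] GS_rr[of "l * j"]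
    unfolding prods ze \<sigma>2_def Pi_def [symmetric] s1(2) [symmetric]
    by (simp add: z_def power_mult [symmetric] mult.commute)
  also have "\<dots> = (\<sigma>1 * rr (l * j)) * GS (- 1) ^ l" using l0 by (cases l) simp_all
  finally have "\<sigma>2 * (\<Prod>k<l. rr (j + k * (N div l))) = \<sigma>1 * rr (l * j)" using GS_m1_nonzero by simp
  hence "\<sigma>1 * \<sigma>2 * (\<Prod>k<l. rr (j + k * (N div l))) = \<sigma>1 * \<sigma>1 * rr (l * j)" by (simp add: mult.assoc)
  hence "rr (l * j) = (\<sigma>1 * \<sigma>2) * (\<Prod>k<l. rr (j + k * (N div l)))" using s1(1) by auto
  moreover have "\<sigma>1 * \<sigma>2 = 1 \<or> \<sigma>1 * \<sigma>2 = - 1" using s1(1) s2 by auto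
  ultimately show ?thesis using that unfolding l_def by blast
qed

text \<open>For odd j this says that the order of \<eta>^j is 2 times the product of
  \<open>ms i\<close> over \<open>supp j\<close>, so that the purity hypothesis is applicable once 1
  lies in \<open>supp j\<close>.\<close>

definition full :: "nat \<Rightarrow> bool" where
  "full j \<longleftrightarrow> (\<forall>i\<in>{1..r}. ms i dvd j \<or> coprime (pr i) j)"

definition supp :: "nat \<Rightarrow> nat set" where
  "supp j = {i\<in>{1..r}. \<not> ms i dvd j}"

lemma pure_full:
  assumes "odd j" "full j" "1 \<in> supp j"
  shows "pure j"
  unfolding pure_def rr_def
proof (rule pure_order[of "supp j"])
  show "supp j \<subseteq> {1..r}" "1 \<in> supp j" using assms(3) by (auto simp: supp_def)
  fix k
  have "(zeta N ^ j) ^ k = 1 \<longleftrightarrow> N dvd j * k"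
    unfolding power_mult [symmetric] by (rule zeta_power_eq_1_iff[OF N_pos])
  also have "\<dots> \<longleftrightarrow> even k \<and> (\<forall>i\<in>supp j. ms i dvd k)"
  proof -
    have "ms i dvd j * k \<longleftrightarrow> ms i dvd k" if "i \<in> supp j" for i
    proof -
      have "coprime (pr i) j" using that assms(2) by (auto simp: supp_def full_def)
      hence "coprime (ms i) j" using that by (simp add: supp_def ms_eq)
      thus ?thesis by (simp add: coprime_dvd_mult_right_iff)
    qed
    thus ?thesis unfolding N_dvd_iff using assms(1) by (auto simp: supp_def)
  qed
  also have "\<dots> \<longleftrightarrow> 2 * (\<Prod>i\<in>supp j. ms i) dvd k"
  proof -
    have "(\<Prod>i\<in>supp j. ms i) dvd k \<longleftrightarrow> (\<forall>i\<in>supp j. ms i dvd k)"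
    proof -
      have "supp j \<subseteq> {1..r}" by (auto simp: supp_def)
      from prod_dvd_int_iff[OF this, of "int k"] show ?thesis by (simp only: int_dvd_int_iff)
    qed
    moreover have "odd (\<Prod>i\<in>supp j. ms i)" using ms_odd by (auto simp: even_prod_iff supp_def)
    hence "coprime 2 (\<Prod>i\<in>supp j. ms i)" by simp
    hence "2 * (\<Prod>i\<in>supp j. ms i) dvd k \<longleftrightarrow> even k \<and> (\<Prod>i\<in>supp j. ms i) dvd k"
      by (auto intro: divides_mult dvd_mult_left dvd_mult_right)
    ultimately show ?thesis by blast
  qed
  finally show "(zeta N ^ j) ^ k = 1 \<longleftrightarrow> 2 * (\<Prod>i\<in>supp j. ms i) dvd k" .
qed

text \<open>Dividing \<open>j\<close> by a prime \<open>p\<^sub>i\<close> that divides it to too small a power multiplies the order of the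
  character by \<open>p\<^sub>i\<close>, without changing the set of primes that divide the order.\<close>

lemma descend:
  assumes "odd j" "1 \<in> supp j" "\<not> full j"
  obtains i j' where "i \<in> {1..r}" "j = pr i * j'"
    "\<And>k. odd (j' + k * (N div pr i))" "\<And>k. 1 \<in> supp (j' + k * (N div pr i))"
    "\<And>k. gcd (j' + k * (N div pr i)) m < gcd j m" "pr i dvd j" "\<not> ms i dvd j"
proof -
  obtain i where i: "i \<in> {1..r}" "\<not> ms i dvd j" "\<not> coprime (pr i) j"
    using assms(3) by (auto simp: full_def)
  define l where "l = pr i"
  have l: "prime l" using pr_prime i(1) by (simp add: l_def)
  have "l dvd j" using i(3) l by (metis l_def prime_imp_coprime)
  then obtain j' where j': "j = l * j'" by blast
  obtain w where w: "u i = Suc w" using u_pos[OF i(1)] by (cases "u i") auto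
  \<comment> \<open>Here w = u_i - 1. All shifts k (N / l) are divisible by l^w whereas j' is not,
    so every j' + k (N / l) keeps the defect of j' at l and has a smaller gcd with m than j.\<close>
  have Nl: "N div l = l ^ w * co i"
    using N_co[OF i(1)] prime_gt_0_nat[OF l] by (simp add: ms_eq[OF i(1)] w l_def)
  have lw: "\<not> l ^ w dvd j'" using i(2) by (auto simp: ms_eq[OF i(1)] w j' l_def)
  have odd': "odd (j' + k * (N div l))" for k using assms(1) even_co by (simp add: j' Nl)
  have other: "ms k dvd N div l" if "k \<in> {1..r}" "k \<noteq> i" for k
    unfolding Nl using ms_dvd_co[OF that] by simp
  have supp': "1 \<in> supp (j' + k * (N div l))" for k
  proof (cases "i = 1")
    case True
    have "\<not> l ^ w dvd j' + k * (N div l)" using lw by (simp add: Nl dvd_add_left_iff)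
    moreover have "l ^ w dvd ms i" by (simp add: ms_eq[OF i(1)] w l_def)
    ultimately have "\<not> ms i dvd j' + k * (N div l)" by (meson dvd_trans)
    thus ?thesis using True one_in by (simp add: supp_def)
  next
    case False
    hence "ms 1 dvd k * (N div l)" using other[OF one_in] by simp
    moreover have "\<not> ms 1 dvd j'" using assms(2) by (auto simp: supp_def j')
    ultimately have "\<not> ms 1 dvd j' + k * (N div l)" by (simp add: dvd_add_left_iff)
    thus ?thesis using one_in by (simp add: supp_def)
  qed
  have "l * gcd (j' + k * (N div l)) m dvd gcd j m" for k
  proof -
    define d where "d = gcd (j' + k * (N div l)) m"
    have d: "d dvd j' + k * (N div l)" "d dvd m" by (simp_all add: d_def)
    have ld: "l * d dvd m"
    proof (rule ccontr)
      assume nd: "\<not> l * d dvd m"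
      have "l ^ w dvd d"
      proof -
        obtain c where c: "m = d * c" using d(2) by blast
        have "\<not> l dvd c" using nd c by auto
        hence "coprime (ms i) c" using l by (simp add: ms_eq[OF i(1)] l_def prime_imp_coprime)
        moreover have "ms i dvd d * c" using i(1) by (simp add: c[symmetric] m_eq dvd_prodI)
        ultimately have "ms i dvd d" by (simp add: coprime_dvd_mult_left_iff)
        moreover have "l ^ w dvd ms i" by (simp add: ms_eq[OF i(1)] w l_def)
        ultimately show ?thesis by (rule dvd_trans[rotated])
      qed
      hence "l ^ w dvd j' + k * (N div l)" using d(1) by (rule dvd_trans)
      hence "l ^ w dvd j'" by (simp add: Nl dvd_add_left_iff)
      thus False using lw by simp
    qed
    have "l * d dvd l * (j' + k * (N div l))" using d(1) by simp
    also have "l * (j' + k * (N div l)) = j + k * N"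
    proof -
      have "l * (N div l) = N" using N_co[OF i(1)] by (simp add: Nl ms_eq[OF i(1)] w l_def mult.assoc)
      thus ?thesis by (simp add: j' distrib_left mult.left_commute)
    qed
    finally have "l * d dvd j + k * N" .
    moreover have "l * d dvd k * N" using ld by (simp add: N_eq)
    ultimately have "l * d dvd j" by (simp add: dvd_add_left_iff)
    thus ?thesis using ld by (simp add: d_def)
  qed
  hence "l * gcd (j' + k * (N div l)) m \<le> gcd j m" for k using m_pos by (intro dvd_imp_le) simp_all
  moreover have "gcd (j' + k * (N div l)) m < l * gcd (j' + k * (N div l)) m" for k
    using prime_gt_1_nat[OF l] m_pos by simp
  ultimately have "gcd (j' + k * (N div l)) m < gcd j m" for k using less_le_trans by blast
  thus ?thesis using that[of i j'] i(1,2) j' odd' supp' unfolding l_def by simp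
qed

text \<open>Descent along the product formula: up to sign the ratio is a product of ratios of
  characters of larger order with the same prime divisors, until prime powers occur in full.\<close>

lemma pure_all: "odd j \<Longrightarrow> 1 \<in> supp j \<Longrightarrow> pure j"
proof (induction "gcd j m" arbitrary: j rule: less_induct)
  case less
  show ?case
  proof (cases "full j")
    case False
    obtain i j' where i: "i \<in> {1..r}" "j = pr i * j'"
      "\<And>k. odd (j' + k * (N div pr i))" "\<And>k. 1 \<in> supp (j' + k * (N div pr i))"
      "\<And>k. gcd (j' + k * (N div pr i)) m < gcd j m"
      using descend[OF less.prems False] by metis
    have pure: "pure (j' + k * (N div pr i))" for k using less.hyps i(3-5) by blast
    obtain \<sigma> where s: "\<sigma> = 1 \<or> \<sigma> = - 1" "rr (pr i * j') = \<sigma> * (\<Prod>k<pr i. rr (j' + k * (N div pr i)))"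
      by (rule hd_step[OF i(1) pure])
    have "root_of_unity \<sigma>" unfolding root_of_unity_def using s(1) by (intro exI[of _ 2]) auto
    moreover have "root_of_unity (\<Prod>k<pr i. rr (j' + k * (N div pr i)))"
      using pure unfolding pure_def by (intro root_of_unity_prod) simp_all
    ultimately show ?thesis unfolding pure_def i(2) s(2) by (rule root_of_unity_mult)
  qed (use pure_full less.prems in blast)
qed

text \<open>If p_1 divided p - 1, a character of order 2 p_1 would come from the prime field, its
  Gauss sum being an n-th power up to a positive sign. The Gauss sum below would then be pure as
  well, and \<open>pure_char_on_prime_field\<close>, applied to a generator of the whole prime
  field, would make the character quadratic.\<close>

lemma coprime_ms_1_pred_p: "coprime (ms 1) (p - 1)"
proof (rule ccontr)
  define l where "l = pr 1"
  assume "\<not> coprime (ms 1) (p - 1)"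
  hence "\<not> coprime l (p - 1)" by (simp add: ms_eq[OF one_in] l_def)
  hence lp: "l dvd p - 1" using pr_prime[OF one_in] by (metis l_def prime_imp_coprime)
  have l: "prime l" "odd l" using pr_prime[OF one_in] pr_odd[OF one_in] by (simp_all add: l_def)
  have lm: "l dvd m" unfolding l_def by (rule pr_dvd_m[OF one_in])
  \<comment> \<open>The exponent giving a character of order 2 l; it is not divisible by
    \<open>ms 1\<close>, so purity is available.\<close>
  define j where "j = m div l"
  have mj: "m = j * l" using lm by (simp add: j_def)
  have "odd j" using m_odd by (simp add: mj)
  have "\<not> ms 1 dvd j"
  proof
    assume "ms 1 dvd j"
    then obtain c where "j = ms 1 * c" by blast
    hence "ms 1 * (c * l * 2) = ms 1 * co 1" using N_co[OF one_in] by (simp add: N_eq mj mult_ac)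
    hence "co 1 = c * l * 2" using ms_pos[OF one_in] by simp
    thus False using pr_not_dvd_co[OF one_in] by (simp add: l_def)
  qed
  hence pj: "pure j" using pure_all[OF \<open>odd j\<close>] one_in by (simp add: supp_def)
  define z where "z = zeta N ^ j"
  have "j > 0" using m_pos by (simp add: mj)
  hence z_eq: "z = zeta (2 * l)" using zeta_mult_power[of j "2 * l"] by (simp add: z_def N_eq mj mult_ac)
  have "even (p - 1)" using odd_p by simp
  hence l2: "2 * l dvd p - 1" using lp l(2) by (intro divides_mult) simp_all
  have l20: "2 * l > 0" using prime_gt_0_nat[OF l(1)] by simp
  have z2l: "z ^ (2 * l) = 1" using l20 by (simp add: z_eq)
  define g1 where "g1 = g ^ ((q - 1) div (p ^ 1 - 1))"
  have G: "gen_field p 1 g1" unfolding g1_def by (rule sub_gen_field[of 1 n]) simp_all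
  interpret G: gen_field p 1 g1 by (rule G)
  have gen_n: "gen_field p (1 * n) g" using gen_field_axioms by simp
  have lift: "GS y = G.GS y ^ n" if "y ^ (p ^ 1 - 1) = 1" for y
  proof -
    have "g ^ ((p ^ (1 * n) - 1) div (p ^ 1 - 1)) = g1" by (simp add: g1_def)
    from G.GS_lift[OF gen_n n_pos this that] show ?thesis using n_odd by simp
  qed
  have zp: "z ^ (p ^ 1 - 1) = 1" using l2 z2l by (metis dvdE power_mult power_one power_one_right)
  have m1p: "(- 1 :: complex) ^ (p ^ 1 - 1) = 1" using odd_p by simp
  have G0: "G.GS (- 1) \<noteq> 0" using lift[OF m1p] GS_m1_nonzero n_pos by (auto simp: zero_power)
  define \<epsilon> where "\<epsilon> = G.GS z / G.GS (- 1)"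
  have "\<epsilon> ^ n = rr j" unfolding \<epsilon>_def rr_def z_def [symmetric] lift[OF zp] lift[OF m1p] by (simp add: power_divide)
  hence eu: "root_of_unity \<epsilon>" using pj root_of_unity_power_iff[OF n_pos] by (metis pure_def)
  have l2': "2 * l dvd p ^ 1 - 1" using l2 by simp
  have eps: "G.GS z = \<epsilon> * G.GS (- 1)" using G0 by (simp add: \<epsilon>_def)
  have e_pow: "\<epsilon> ^ (2 * l) = 1" by (rule G.pure_ratio_pow[OF l20 _ l2' z2l eu eps G0]) simp
  obtain c where c: "g1 = of_nat c"
    using prime_field_obtain[OF prime_p char_p, of g1] G.g_in_F by auto
  have pc: "\<not> p dvd c" using c G.g_nonzero by (simp add: of_nat_eq_0_iff_char_dvd char_p)
  have "g1 ^ 1 = of_nat c" using c by simp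
  hence sc: "\<forall>i. [G.\<tau> (i + 1) = c * G.\<tau> i] (mod p)" using G.tau_scale by blast
  have "z ^ 1 = (- 1) ^ 1"
    by (rule G.pure_char_on_prime_field[OF l20 _ l2' z2l e_pow eps G0 pc sc]) simp
  hence "zeta (2 * l) ^ 2 = 1" by (simp add: z_eq)
  hence "2 * l dvd 2" using zeta_power_eq_1_iff[OF l20] by blast
  thus False using prime_gt_1_nat[OF l(1)] by (auto dest: dvd_imp_le)
qed

section \<open>Comparing the ratios with their predicted values\<close>

definition a :: nat where "a = nat (A mod int m)"

definition zz :: "nat \<Rightarrow> complex" where "zz j = zeta m ^ (j * a)"

text \<open>That \<open>E j = 1\<close> is the asserted value of the Gauss sum at \<open>\<eta>\<^sup>j\<close>.\<close>

definition E :: "nat \<Rightarrow> complex" where "E j = rr j / zz j"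

lemma zz_nonzero: "zz j \<noteq> 0"
  by (simp add: zz_def)

lemma zz_cong: "[i = j] (mod m) \<Longrightarrow> zz i = zz j"
  unfolding zz_def using m_pos by (intro power_eq_power_if_cong[of _ m] cong_scalar_right) simp

lemma zz_power: "zz j ^ c = zz (j * c)"
  by (simp add: zz_def power_mult [symmetric] mult_ac)

lemma cong_N_m: "[i = j] (mod N) \<Longrightarrow> [i = j] (mod m)"
  by (erule cong_dvd_modulus_nat) (unfold N_eq, rule dvd_triv_right)

lemma E_cong: "[i = j] (mod N) \<Longrightarrow> E i = E j"
  using rr_cong[of i j] zz_cong[OF cong_N_m, of i j] by (simp add: E_def)

lemma E_galois: "pure j \<Longrightarrow> coprime c N \<Longrightarrow> E (j * c) = E j ^ c"
  by (simp add: E_def rr_galois zz_power power_divide)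

lemma E_cong_power:
  assumes "i \<in> {1..r}" "pure j" "pure j'" "[j * ms i = j' * ms i] (mod N)"
  shows "E j ^ ms i = E j' ^ ms i"
  using rr_cong_power[OF assms] zz_cong[OF cong_N_m[OF assms(4)]] by (simp add: E_def power_divide zz_power)

text \<open>Modulo m only the i-th summand of j A survives: for k other than 1 and i the
  divisibility of j by \<open>ms k\<close> completes the factor m, and the summand at 1 vanishes
  with \<open>t 1\<close>.\<close>

lemma zz_value:
  assumes i: "i \<in> {1..r}" and j: "[j = 1] (mod ms i)" "\<And>k. k \<in> {2..r} \<Longrightarrow> k \<noteq> i \<Longrightarrow> ms k dvd j"
  shows "zz j = zeta (ms i) powi t i"
proof -
  define c where "c = (\<lambda>k. \<Prod>j\<in>{1..r} - {k}. ms j)"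
  have mc: "m = c k * ms k" if "k \<in> {1..r}" for k
    using that by (simp add: c_def m_eq prod.remove[of "{1..r}" k ms] mult.commute)
  have A: "A = (\<Sum>k\<in>{1..r}. t k * int (c k))" by (simp add: A_eq c_def)
  have zm: "zeta m ^ m = 1" using m_pos by simp
  have "[int (j * a) = int j * A] (mod int m)"
    using m_pos by (simp add: a_def cong_def mod_mult_right_eq)
  also have "int j * A = (\<Sum>k\<in>{1..r}. int j * (t k * int (c k)))" by (simp add: A sum_distrib_left)
  also have "[\<dots> = (\<Sum>k\<in>{1..r}. if k = i then t i * int (c i) else 0)] (mod int m)"
  proof (rule cong_sum)
    fix k assume k: "k \<in> {1..r}"
    show "[int j * (t k * int (c k)) = (if k = i then t i * int (c i) else 0)] (mod int m)"
    proof (cases "k = i")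
      case True
      have "int (ms i) dvd int j - 1" using j(1) by (metis cong_iff_dvd_diff cong_int_iff of_nat_1)
      then obtain x where x: "int j - 1 = int (ms i) * x" by blast
      have "int j * (t i * int (c i)) - t i * int (c i) = (int j - 1) * (t i * int (c i))" by (simp add: algebra_simps)
      also have "\<dots> = int m * (x * t i)" by (simp add: x mc[OF i])
      finally show ?thesis using True by (simp add: cong_iff_dvd_diff)
    next
      case False
      show ?thesis
      proof (cases "k = 1")
        case True
        thus ?thesis using False t_1 by simp
      next
        case k1: False
        have "ms k dvd j" using j(2)[of k] k k1 False by simp
        then obtain x where "j = ms k * x" by blast
        hence "int j * (t k * int (c k)) = int m * (int x * t k)" by (simp add: mc[OF k])
        hence "int m dvd int j * (t k * int (c k))" by (simp only: dvd_triv_left)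
        thus ?thesis using False by (simp only: if_False cong_0_iff)
      qed
    qed
  qed
  also have "(\<Sum>k\<in>{1..r}. if k = i then t i * int (c i) else 0) = int (c i) * t i" using i by simp
  finally have "zeta m powi int (j * a) = zeta m powi (int (c i) * t i)"
    by (rule power_int_cong[OF zm m_pos])
  moreover have "zeta m ^ c i = zeta (ms i)"
    using zeta_mult_power[of "c i" "ms i"] mc[OF i] m_pos by (cases "c i = 0") (simp_all add: mult.commute)
  ultimately show ?thesis by (simp only: zz_def power_int_of_nat power_int_mult)
qed

text \<open>Raising to the power m_1 makes the character quadratic, so the congruence modulo p_1
  gives \<open>rr j ^ ms 1 = 1\<close>. Frobenius gives \<open>rr j ^ (p - 1) = 1\<close>, and the
  two exponents are coprime.\<close>

lemma E_singleton:
  assumes "odd j" "supp j = {1}"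
  shows "E j = 1"
proof -
  have pj: "pure j" using pure_all assms by simp
  have dv: "ms k dvd j" if "k \<in> {1..r}" "k \<noteq> 1" for k using assms(2) that by (auto simp: supp_def)
  have "[j * ms 1 = m * ms 1] (mod N)"
    unfolding cong_N_iff
  proof (intro conjI ballI)
    show "even (j * ms 1) = even (m * ms 1)" using assms(1) m_odd by simp
    fix k assume k: "k \<in> {1..r}"
    have "ms k dvd j * ms 1" using dv[OF k] by (cases "k = 1") auto
    moreover have "ms k dvd m" using k by (simp add: m_eq dvd_prodI)
    hence "ms k dvd m * ms 1" by simp
    ultimately show "[j * ms 1 = m * ms 1] (mod ms k)" by (metis cong_0_iff cong_sym cong_trans)
  qed
  hence "rr j ^ ms 1 = 1" using rr_cong_power[OF one_in pj pure_m] by (simp add: rr_m)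
  moreover have "rr j ^ (p - 1) = 1"
  proof -
    have "rr j ^ (p - 1) * rr j = rr j" using rr_frobenius[OF pj] p_gt_1 by (metis power_minus_mult order.strict_trans zero_less_one)
    moreover have "rr j \<noteq> 0" using rr_pow[OF pj] N_pos by (auto simp: zero_power)
    ultimately show ?thesis by simp
  qed
  ultimately have r1: "rr j = 1" using coprime_ms_1_pred_p by (rule eq_1_if_coprime_powers)
  have "[int j * A = 0] (mod int m)"
  proof -
    have "int m dvd int j * (t k * (\<Prod>i\<in>{1..r} - {k}. int (ms i)))" if k: "k \<in> {1..r}" for k
    proof (cases "k = 1")
      case False
      obtain x where "j = ms k * x" using dv[OF k False] by blast
      hence "int j * (t k * (\<Prod>i\<in>{1..r} - {k}. int (ms i))) = int m * (int x * t k)"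
        using k by (simp add: m_eq prod.remove[of "{1..r}" k "\<lambda>i. int (ms i)"])
      thus ?thesis by (simp only: dvd_triv_left)
    qed (simp add: t_1)
    hence "int m dvd int j * A" unfolding A_eq sum_distrib_left by (intro dvd_sum) blast
    thus ?thesis by (simp add: cong_0_iff)
  qed
  hence "[int (j * a) = 0] (mod int m)" using m_pos by (simp add: a_def cong_def mod_mult_right_eq)
  hence "m dvd j * a" by (simp only: cong_0_iff int_dvd_int_iff)
  hence "zz j = 1" unfolding zz_def using zeta_power_eq_1_iff[OF m_pos] by blast
  thus ?thesis using r1 by (simp add: E_def)
qed

text \<open>The relation defining s_i settles one exponent with this support, since the comparison
  exponent is covered by \<open>E_singleton\<close>. All other odd full exponents with the support
  are conjugate to it.\<close>

lemma E_pair: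
  assumes "odd j" "full j" "supp j = {1, i}" "i \<noteq> 1"
  shows "E j = 1"
proof -
  have i: "i \<in> {1..r}" "i \<in> {2..r}" using assms(3,4) by (auto simp: supp_def)
  obtain e e1 where e: "[e = 1] (mod 2 * ms 1 * ms i)" "\<forall>k\<in>{1..r} - {1, i}. ms k dvd e"
    "[e1 = 1] (mod 2 * ms 1)" "\<forall>k\<in>{1..r} - {1}. ms k dvd e1"
    "GS (zeta N ^ e) = zeta (ms i) powi t i * GS (zeta N ^ e1)" using t_rel[OF i(2)] by blast
  have sub: "[e = 1] (mod d)" if "d dvd 2 * ms 1 * ms i" for d
    using cong_dvd_modulus_nat[OF e(1) that] .
  have sub1: "[e1 = 1] (mod d)" if "d dvd 2 * ms 1" for d
    using cong_dvd_modulus_nat[OF e(3) that] .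
  have ndvd: "\<not> ms k dvd x" if "[x = 1] (mod ms k)" "k \<in> {1..r}" for x k
    using cong_dvd_iff[OF that(1)] ms_gt_1[OF that(2)] by simp
  have oe: "odd e" using cong_dvd_iff[OF sub[of 2]] by simp
  have oe1: "odd e1" using cong_dvd_iff[OF sub1[of 2]] by simp
  have ms1: "[e = 1] (mod ms 1)" "[e = 1] (mod ms i)" "[e1 = 1] (mod ms 1)"
    by (intro sub sub1; simp)+
  have "supp e1 = {1}" using e(4) one_in ndvd[OF ms1(3) one_in] by (auto simp: supp_def)
  hence E1: "E e1 = 1" using E_singleton oe1 by blast
  have "zz e1 = zeta (ms 1) powi t 1" using e(4) by (intro zz_value one_in ms1(3)) auto
  hence "rr e1 = 1" using E1 by (simp add: E_def t_1)
  hence "rr e = zeta (ms i) powi t i" using e(5) GS_m1_nonzero by (simp add: GS_rr)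
  moreover have "zz e = zeta (ms i) powi t i" using e(2) by (intro zz_value i(1) ms1(2)) auto
  ultimately have Ee: "E e = 1" using zz_nonzero[of e] by (simp add: E_def)
  have se: "1 \<in> supp e" using ndvd[OF ms1(1) one_in] one_in by (simp add: supp_def)
  hence pe: "pure e" using pure_all oe by blast
  have cop: "coprime (pr k) j" if "k \<in> {1, i}" for k
  proof -
    have "k \<in> supp j" using that assms(3) by simp
    thus ?thesis using assms(2) by (auto simp: full_def supp_def)
  qed
  define D where "D = 2 * ms 1 * ms i"
  define C where "C = (\<Prod>k\<in>{1..r} - {1, i}. ms k)"
  have "coprime D C"
  proof -
    have "odd C" using ms_odd by (auto simp: C_def even_prod_iff)
    moreover have "coprime (ms k) C" if "k \<in> {1, i}" for k
      unfolding C_def using that i(1) one_in coprime_ms by (intro prod_coprime_right) auto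
    ultimately show ?thesis by (simp add: D_def)
  qed
  \<comment> \<open>The conjugating exponent: it equals j where e is 1, and 1 at the primes where
    both j and e vanish, which keeps it coprime to N.\<close>
  then obtain c where c: "[c = j] (mod D)" "[c = 1] (mod C)" using binary_chinese_remainder_nat by blast
  have c_ms: "[c = j] (mod ms k)" if "k \<in> {1, i}" for k
    using cong_dvd_modulus_nat[OF c(1), of "ms k"] that by (auto simp: D_def)
  have c_ms': "[c = 1] (mod ms k)" if "k \<in> {1..r} - {1, i}" for k
  proof -
    have "ms k dvd C" unfolding C_def by (rule dvd_prodI) (use that in auto)
    thus ?thesis using cong_dvd_modulus_nat[OF c(2)] by blast
  qed
  have "odd c"
  proof -
    have "[c = j] (mod 2)" using cong_dvd_modulus_nat[OF c(1), of 2] by (simp add: D_def)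
    thus ?thesis using assms(1) cong_dvd_iff[of c j 2] by simp
  qed
  have "coprime c (ms k)" if k: "k \<in> {1..r}" for k
  proof (cases "k \<in> {1, i}")
    case True
    have "coprime j (ms k)" using cop[OF True] by (simp add: ms_eq[OF k] coprime_commute)
    thus ?thesis using c_ms[OF True] by (metis cong_imp_coprime cong_sym)
  next
    case False
    thus ?thesis using c_ms'[of k] k by (metis DiffI cong_imp_coprime cong_sym coprime_1_left)
  qed
  hence "coprime c m" unfolding m_eq by (intro prod_coprime_right) auto
  hence cN: "coprime c N" using \<open>odd c\<close> by (simp add: N_eq)
  have "[e * c = j] (mod N)"
    unfolding cong_N_iff
  proof (intro conjI ballI)
    show "even (e * c) = even j" using oe \<open>odd c\<close> assms(1) by simp
    fix k assume k: "k \<in> {1..r}"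
    show "[e * c = j] (mod ms k)"
    proof (cases "k \<in> {1, i}")
      case True
      hence "[e = 1] (mod ms k)" using ms1 by auto
      hence "[e * c = 1 * j] (mod ms k)" using c_ms[OF True] by (rule cong_mult)
      thus ?thesis by simp
    next
      case False
      hence "ms k dvd j" using assms(3) k by (auto simp: supp_def)
      moreover have "ms k dvd e * c" using e(2) k False by simp
      ultimately show ?thesis by (metis cong_0_iff cong_sym cong_trans)
    qed
  qed
  hence "E j = E (e * c)" by (rule E_cong[OF cong_sym])
  also have "\<dots> = 1" using E_galois[OF pe cN] Ee by simp
  finally show ?thesis .
qed

lemma finite_supp: "finite (supp j)"
  by (simp add: supp_def)

text \<open>Replacing j by 0 modulo \<open>ms i\<close> removes i from the support and does not
  change the m_i-th power of the error, so \<open>E j ^ ms i = 1\<close> by induction. Two different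
  indices besides 1 give coprime exponents; fewer leave the cases already treated.\<close>

lemma E_full: "odd j \<Longrightarrow> full j \<Longrightarrow> 1 \<in> supp j \<Longrightarrow> E j = 1"
proof (induction "card (supp j)" arbitrary: j rule: less_induct)
  case less
  have pj: "pure j" using pure_all less.prems by blast
  have step: "E j ^ ms i = 1" if i: "i \<in> supp j" "i \<noteq> 1" for i
  proof -
    have ir: "i \<in> {1..r}" using i(1) by (simp add: supp_def)
    obtain j' where j': "[j' = j] (mod co i)" "[j' = 0] (mod ms i)" "even j' \<longleftrightarrow> even j"
      "\<And>k. k \<in> {1..r} \<Longrightarrow> k \<noteq> i \<Longrightarrow> [j' = j] (mod ms k)" using exists_cong[OF ir, where b = 0] by blast
    have di: "ms i dvd j'" using j'(2) by (simp add: cong_0_iff)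
    have dk: "ms k dvd j' \<longleftrightarrow> ms k dvd j" if "k \<in> {1..r}" "k \<noteq> i" for k
      using cong_dvd_iff[OF j'(4)[OF that]] .
    have supp': "supp j' = supp j - {i}" using di dk by (auto simp: supp_def)
    have "full j'" unfolding full_def
    proof
      fix k assume k: "k \<in> {1..r}"
      show "ms k dvd j' \<or> coprime (pr k) j'"
      proof (cases "k = i \<or> ms k dvd j'")
        case False
        hence "coprime (pr k) j" using less.prems(2) dk k by (auto simp: full_def)
        moreover have "[j' = j] (mod pr k)"
          using cong_dvd_modulus_nat[OF j'(4) pr_dvd_ms[OF k]] k False by blast
        ultimately show ?thesis by (metis cong_imp_coprime cong_sym coprime_commute)
      qed (use di in auto)
    qed
    moreover have "card (supp j') < card (supp j)" unfolding supp' using i(1) finite_supp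
      by (intro psubset_card_mono) auto
    moreover have "odd j'" using j'(3) less.prems(1) by simp
    moreover have "1 \<in> supp j'" using supp' less.prems(3) i(2) by simp
    ultimately have "E j' = 1" and pj': "pure j'" using less.hyps pure_all by blast+
    moreover have "[j * ms i = j' * ms i] (mod N)"
      unfolding N_co[OF ir] using cong_sym[OF j'(1)]
      by (simp add: cong_def mult.commute[of _ "ms i"] mult_mod_right [symmetric])
    ultimately show ?thesis using E_cong_power[OF ir pj pj'] by simp
  qed
  show ?case
  proof (cases "supp j = {1}")
    case True
    thus ?thesis using E_singleton less.prems by blast
  next
    case False
    then obtain i where i: "i \<in> supp j" "i \<noteq> 1" using less.prems(3) by auto
    show ?thesis
    proof (cases "supp j = {1, i}")
      case True
      thus ?thesis using E_pair less.prems i by blast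
    next
      case False
      then obtain k where k: "k \<in> supp j" "k \<noteq> 1" "k \<noteq> i" using less.prems(3) i by auto
      have "coprime (ms i) (ms k)" using coprime_ms i k by (auto simp: supp_def)
      thus ?thesis using eq_1_if_coprime_powers[OF step[OF i] step[OF k(1,2)]] by blast
    qed
  qed
qed

text \<open>The product formula gives \<open>E j\<close> up to a sign. Changing j to 1 modulo
  \<open>ms i\<close> lowers the gcd with m and preserves the m_i-th power, which is therefore 1; as
  m_i is odd, the sign is +.\<close>

lemma E_all: "odd j \<Longrightarrow> 1 \<in> supp j \<Longrightarrow> E j = 1"
proof (induction "gcd j m" arbitrary: j rule: less_induct)
  case less
  show ?case
  proof (cases "full j")
    case True
    thus ?thesis using E_full less.prems by blast
  next
    case False
    obtain i j' where i: "i \<in> {1..r}" "j = pr i * j'"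
      "\<And>k. odd (j' + k * (N div pr i))" "\<And>k. 1 \<in> supp (j' + k * (N div pr i))"
      "\<And>k. gcd (j' + k * (N div pr i)) m < gcd j m" "pr i dvd j" "\<not> ms i dvd j"
      using descend[OF less.prems False] by metis
    define l where "l = pr i"
    have E1: "E (j' + k * (N div l)) = 1" and pure: "pure (j' + k * (N div l))" for k
      using less.hyps i(3-5) pure_all unfolding l_def by blast+
    have rr_zz: "rr (j' + k * (N div l)) = zz (j' + k * (N div l))" for k
      using E1[of k] zz_nonzero by (simp add: E_def)
    obtain \<sigma> where s: "\<sigma> = 1 \<or> \<sigma> = - 1" "rr (l * j') = \<sigma> * (\<Prod>k<l. rr (j' + k * (N div l)))"
      unfolding l_def by (rule hd_step[OF i(1) pure[unfolded l_def]])
    \<comment> \<open>The exponents add up to j + h N, where l = 2 h + 1: the sum of the k is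
      divisible by l because l is odd.\<close>
    have "(\<Prod>k<l. zz (j' + k * (N div l))) = zz j"
    proof -
      have lN: "l dvd N" using pr_dvd_ms[OF i(1)] N_co[OF i(1)] by (simp add: l_def)
      obtain h where h: "l = 2 * h + 1" using pr_odd[OF i(1)] oddE l_def by metis
      have sum_k: "(\<Sum>k<l. k) = l * h"
      proof -
        have "2 * (\<Sum>k<x. k) = x * (x - 1)" for x :: nat by (induction x) (auto simp: algebra_simps split: nat_diff_split)
        from this[of l] show ?thesis by (simp add: h)
      qed
      have "(\<Prod>k<l. zz (j' + k * (N div l))) = zz (\<Sum>k<l. j' + k * (N div l))"
        by (simp add: zz_def power_sum sum_distrib_right)
      also have "(\<Sum>k<l. j' + k * (N div l)) = l * j' + l * h * (N div l)"
        by (simp only: sum.distrib sum_constant card_lessThan sum_distrib_right [symmetric] sum_k of_nat_id)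
      also have "\<dots> = j + h * N" using lN by (simp add: i(2) l_def [symmetric] mult_ac)
      also have "zz (j + h * N) = zz j" by (rule zz_cong) (simp add: N_eq cong_def mult.assoc [symmetric])
      finally show ?thesis .
    qed
    hence Es: "E j = \<sigma>" using s(2) zz_nonzero[of j] unfolding l_def i(2) [symmetric]
      by (simp add: rr_zz [unfolded l_def] E_def)
    have pj: "pure j" using pure_all less.prems by blast
    obtain j2 where j2: "[j2 = j] (mod co i)" "[j2 = 1] (mod ms i)" "even j2 \<longleftrightarrow> even j"
      "\<And>k. k \<in> {1..r} \<Longrightarrow> k \<noteq> i \<Longrightarrow> [j2 = j] (mod ms k)" using exists_cong[OF i(1), where b = 1] by blast
    have cop2: "coprime j2 (ms i)" using j2(2) by (metis cong_imp_coprime cong_sym coprime_1_left)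
    have supp2: "1 \<in> supp j2"
    proof (cases "i = 1")
      case True
      thus ?thesis using cong_dvd_iff[OF j2(2)] ms_gt_1[OF i(1)] i(1) by (simp add: supp_def)
    next
      case False
      thus ?thesis using cong_dvd_iff[OF j2(4)[OF one_in]] less.prems(2) by (simp add: supp_def)
    qed
    have "gcd j2 m dvd gcd j m"
    proof -
      have "coprime (gcd j2 m) (ms i)" using cop2 by (meson coprime_divisors dvd_refl gcd_dvd1)
      moreover have "gcd j2 m dvd ms i * co i" using N_co[OF i(1)] by (metis N_eq dvd_mult gcd_dvd2)
      ultimately have "gcd j2 m dvd co i" by (simp add: coprime_dvd_mult_right_iff)
      hence "[j2 = j] (mod gcd j2 m)" using cong_dvd_modulus_nat[OF j2(1)] by blast
      hence "gcd j2 m dvd j" using cong_dvd_iff by (metis gcd_dvd1)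
      thus ?thesis by simp
    qed
    moreover have "gcd j2 m \<noteq> gcd j m"
    proof
      assume "gcd j2 m = gcd j m"
      moreover have "pr i dvd m" by (rule pr_dvd_m[OF i(1)])
      hence "pr i dvd gcd j m" using i(6) by simp
      ultimately have "pr i dvd j2" by (metis gcd_dvd1 dvd_trans)
      thus False using cop2 pr_dvd_ms[OF i(1)] pr_prime[OF i(1)] by (meson coprime_common_divisor not_prime_unit)
    qed
    moreover have "gcd j m > 0" using m_pos by simp
    ultimately have "gcd j2 m < gcd j m" by (meson dvd_imp_le le_neq_implies_less)
    moreover have "odd j2" using j2(3) less.prems(1) by simp
    ultimately have E2: "E j2 = 1" and p2: "pure j2" using less.hyps supp2 pure_all by blast+
    have "[j * ms i = j2 * ms i] (mod N)"
      unfolding N_co[OF i(1)] using cong_sym[OF j2(1)]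
      by (simp add: cong_def mult.commute[of _ "ms i"] mult_mod_right [symmetric])
    hence "E j ^ ms i = 1" using E_cong_power[OF i(1) pj p2] E2 by simp
    thus ?thesis using s(1) ms_odd[OF i(1)] unfolding Es by auto
  qed
qed

theorem GS_eq:
  assumes "odd j" "\<not> ms 1 dvd j"
  shows "GS (zeta N ^ j) = zeta m ^ (j * a) * GS (- 1)"
proof -
  have "1 \<in> supp j" using assms(2) one_in by (simp add: supp_def)
  hence "rr j = zz j" using E_all[OF assms(1)] zz_nonzero[of j] by (simp add: E_def)
  thus ?thesis using GS_rr[of j] by (simp add: zz_def)
qed

end

section \<open>Characters and cyclotomic classes of a finite field\<close>

lemma CHAR_of_card_prime_power:
  assumes "prime p" "CARD('c::finite_field) = p ^ n"
  shows "CHAR('c) = p"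
proof -
  have "CHAR('c) dvd p ^ n" using CHAR_dvd_CARD[where ?'a = 'c] assms(2) by simp
  hence "CHAR('c) dvd p" using prime_dvd_power CHAR_prime by blast
  thus ?thesis using assms(1) by (metis CHAR_prime primes_dvd_imp_eq)
qed

text \<open>The passage from finite fields given as types, in which the theorem is stated, to
  subfields of an algebraically closed field, in which the Gauss sums are computed.\<close>

locale finite_field_hom =
  fixes p n :: nat and e :: "'c::finite_field \<Rightarrow> 'l::alg_closed_field"
  assumes prime_p': "prime p" and odd_p': "odd p" and n_pos': "n > 0" and card_c: "CARD('c) = p ^ n"
    and e_one: "e 1 = 1" and e_add: "e (x + y) = e x + e y" and e_mult: "e (x * y) = e x * e y"
begin

lemma char_c: "CHAR('c) = p"
  by (rule CHAR_of_card_prime_power[OF prime_p' card_c])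

lemma e_0: "e 0 = 0"
  using e_add[of 0 0] by (metis add_cancel_right_left add.right_neutral)

lemma e_minus: "e (- x) = - e x"
  using e_add[of x "- x"] by (simp add: e_0 eq_neg_iff_add_eq_0 add.commute)

lemma e_eq_0_iff: "e x = 0 \<longleftrightarrow> x = 0"
proof
  assume "e x = 0"
  show "x = 0"
  proof (rule ccontr)
    assume "x \<noteq> 0"
    hence "e x * e (inverse x) = 1" by (simp flip: e_mult add: e_one)
    thus False using \<open>e x = 0\<close> by simp
  qed
qed (simp add: e_0)

lemma e_eq_iff: "e x = e y \<longleftrightarrow> x = y"
proof -
  have "e (x - y) = e x - e y" using e_add[of x "- y"] by (simp add: e_minus)
  thus ?thesis using e_eq_0_iff[of "x - y"] by simp
qed

lemma e_power: "e (x ^ k) = e x ^ k"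
  by (induction k) (simp_all add: e_one e_mult)

lemma e_of_nat: "e (of_nat k) = of_nat k"
  by (induction k) (simp_all add: e_0 e_add e_one)

lemma e_sum: "e (\<Sum>i\<in>S. h i) = (\<Sum>i\<in>S. e (h i))"
  by (induction S rule: infinite_finite_induct) (simp_all add: e_0 e_add)

lemma char_l: "CHAR('l) = p"
proof (rule CHAR_eq_posI)
  show "p > 0" using prime_p' prime_gt_0_nat by blast
  show "of_nat p = (0::'l)" using e_of_nat[of p] char_c e_0 by (metis of_nat_CHAR)
  fix k assume k: "0 < k" "k < p"
  hence "(of_nat k :: 'c) \<noteq> 0" by (auto simp: of_nat_eq_0_iff_char_dvd char_c dest: dvd_imp_le)
  thus "of_nat k \<noteq> (0::'l)" using e_of_nat e_eq_0_iff by metis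
qed

end

locale field_model = finite_field_hom p n e
  for p n and e :: "'c::finite_field \<Rightarrow> 'l::alg_closed_field" +
  fixes \<gamma> :: 'c
  assumes prim: "primitive_element \<gamma>"
begin

lemma gamma_nonzero: "\<gamma> \<noteq> 0"
  using prim by (simp add: primitive_element_def)

lemma gamma_pow: "\<gamma> ^ (p ^ n - 1) = 1"
proof -
  have "\<gamma> ^ (p ^ n) = \<gamma>" using finite_field_power_card_eq_same[of \<gamma>] by (simp add: card_c)
  moreover have "p ^ n > 0" using prime_p' prime_gt_0_nat by simp
  ultimately have "\<gamma> ^ (p ^ n - 1) * \<gamma> = \<gamma>" by (simp add: power_minus_mult)
  thus ?thesis using gamma_nonzero by simp
qed

lemma bij_gamma: "bij_betw (\<lambda>i. \<gamma> ^ i) {..<p ^ n - 1} (UNIV - {0})"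
proof -
  have q1: "p ^ n - 1 > 0" using prime_gt_1_nat[OF prime_p'] n_pos' by (simp add: one_less_power)
  have img: "(\<lambda>i. \<gamma> ^ i) ` {..<p ^ n - 1} = UNIV - {0}"
  proof (intro equalityI subsetI)
    fix x :: 'c assume "x \<in> UNIV - {0}"
    then obtain k where "x = \<gamma> ^ k" using prim by (auto simp: primitive_element_def)
    moreover have "\<gamma> ^ k = \<gamma> ^ (k mod (p ^ n - 1))"
      by (rule power_eq_power_if_cong[OF gamma_pow]) (simp only: cong_mod_right cong_refl)
    ultimately show "x \<in> (\<lambda>i. \<gamma> ^ i) ` {..<p ^ n - 1}" using q1 by auto
  qed (use gamma_nonzero in auto)
  have "inj_on (\<lambda>i. \<gamma> ^ i) {..<p ^ n - 1}"
    by (rule eq_card_imp_inj_on) (simp_all add: img card_Diff_singleton card_c)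
  thus ?thesis using img by (simp add: bij_betw_def)
qed

lemma range_e: "range e = {x. x ^ (p ^ n) = x}"
proof -
  have q: "p ^ n > 1" using n_pos' by (intro one_less_power prime_gt_1_nat prime_p')
  have sub: "range e \<subseteq> {x. x ^ (p ^ n) = x}"
    using finite_field_power_card_eq_same[where ?'a = 'c] by (auto simp: e_power[symmetric] card_c)
  have "card (range e) = p ^ n" using e_eq_iff by (subst card_image) (auto simp: inj_on_def card_c)
  thus ?thesis using card_seteq[OF finite_power_fixed(1)[OF q] sub] finite_power_fixed(2)[OF q, where ?'a = 'l] by simp
qed

sublocale G: gen_field p n "e \<gamma>"
proof
  have "bij_betw e (UNIV - {0}) ({x. x ^ (p ^ n) = x} - {0})"
  proof (rule bij_betw_imageI)
    show "inj_on e (UNIV - {0})" by (rule inj_onI) (simp only: e_eq_iff)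
    have "e ` (UNIV - {0}) = range e - {0}"
    proof (intro equalityI subsetI)
      fix y assume "y \<in> range e - {0}"
      then obtain x where "y = e x" "x \<noteq> 0" using e_0 by auto
      thus "y \<in> e ` (UNIV - {0})" by blast
    qed (use e_eq_0_iff in auto)
    thus "e ` (UNIV - {0}) = {x. x ^ (p ^ n) = x} - {0}" by (simp only: range_e)
  qed
  from bij_betw_trans[OF bij_gamma this]
  show "bij_betw (\<lambda>i. e \<gamma> ^ i) {..<p ^ n - 1} ({x. x ^ (p ^ n) = x} - {0})"
    by (simp add: comp_def e_power)
qed (use prime_p' odd_p' char_l n_pos' in auto)

lemma field_degree_eq: "field_degree TYPE('c) = n"
proof -
  have "(THE k. CARD('c) = CHAR('c) ^ k) = n"
    using power_inject_exp[OF prime_gt_1_nat[OF prime_p']] by (intro the_equality) (auto simp: card_c char_c)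
  thus ?thesis by (simp add: field_degree_def)
qed

lemma canonical_char_eq: "canonical_char x = psi p n (e x)"
proof -
  have "e (trace x) = tr p n (e x)"
    by (simp add: trace_def tr_def field_degree_eq char_c e_sum e_power)
  hence "of_nat k = tr p n (e x) \<longleftrightarrow> of_nat k = trace x" for k
    using e_of_nat e_eq_iff by metis
  thus ?thesis by (simp add: canonical_char_def psi_def rep_def char_c)
qed

lemma e_in_F: "e x \<in> G.F"
  using range_e by blast

lemma cc_add: "canonical_char (x + y :: 'c) = canonical_char x * canonical_char y"
  unfolding canonical_char_eq e_add
  by (rule psi_add_eq[OF prime_p' char_l]) (use e_in_F in auto)

lemma cc_0: "canonical_char (0::'c) = 1"
  by (simp add: canonical_char_eq e_0 psi_0[OF prime_p' char_l])

lemma cc_gamma: "canonical_char (\<gamma> ^ i) = zeta p ^ G.\<tau> i"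
  by (simp add: canonical_char_eq e_power G.psi_g)

lemma sum_UNIV:
  fixes f :: "'c \<Rightarrow> complex"
  shows "(\<Sum>x\<in>UNIV. f x) = f 0 + (\<Sum>i<p ^ n - 1. f (\<gamma> ^ i))"
proof -
  have "(\<Sum>x\<in>UNIV. f x) = f 0 + (\<Sum>x\<in>UNIV - {0}. f x)" by (simp add: sum.remove)
  thus ?thesis using sum.reindex_bij_betw[OF bij_gamma, of f] by simp
qed

lemma sum_cc: "(\<Sum>x\<in>UNIV. canonical_char (x::'c)) = 0"
  using G.sum_psi by (simp add: sum_UNIV cc_0 cc_gamma)

lemma sum_cc_mult: "(\<Sum>a\<in>UNIV. canonical_char (a * x :: 'c)) = (if x = 0 then of_nat (p ^ n) else 0)"
proof (cases "x = 0")
  case False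
  have "bij_betw (\<lambda>a. a * x) UNIV UNIV"
    using False by (intro bij_betwI[of _ _ _ "\<lambda>a. a / x"]) auto
  from sum.reindex_bij_betw[OF this, of canonical_char] show ?thesis using sum_cc False by simp
qed (simp add: cc_0 card_c)

lemma cc_minus: "canonical_char (- x :: 'c) * canonical_char x = 1"
  using cc_add[of "- x" x] by (simp add: cc_0)

lemma nontrivial_cc_at: "a \<noteq> 0 \<Longrightarrow> nontrivial_char (canonical_char_at (a::'c))"
proof -
  assume a: "a \<noteq> 0"
  have "\<exists>x. canonical_char (a * x) \<noteq> 1"
  proof (rule ccontr)
    assume "\<not> ?thesis"
    hence "(\<Sum>x\<in>UNIV. canonical_char (x * a)) = of_nat (p ^ n)"
      by (simp add: mult.commute[of _ a] card_c)
    thus False using sum_cc_mult[of a] a prime_p' prime_gt_0_nat by auto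
  qed
  thus ?thesis by (simp add: nontrivial_char_def canonical_char_at_def cc_0 distrib_left cc_add)
qed

lemma character_sum_zero:
  fixes \<theta> :: "'c \<Rightarrow> complex"
  assumes "\<And>x y. \<theta> (x + y) = \<theta> x * \<theta> y" "\<theta> d \<noteq> 1"
  shows "(\<Sum>x\<in>UNIV. \<theta> x) = 0"
proof -
  have "bij_betw (\<lambda>x. d + x) UNIV UNIV" by (intro bij_betwI[of _ _ _ "\<lambda>x. x - d"]) auto
  from sum.reindex_bij_betw[OF this, of \<theta>] have "\<theta> d * (\<Sum>x\<in>UNIV. \<theta> x) = (\<Sum>x\<in>UNIV. \<theta> x)"
    by (simp add: assms(1) sum_distrib_left)
  hence "(\<theta> d - 1) * (\<Sum>x\<in>UNIV. \<theta> x) = 0" by (simp add: algebra_simps)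
  thus ?thesis using assms(2) by simp
qed

text \<open>A character different from all \<open>canonical_char_at a\<close> would be orthogonal to
  each of them. Summing these relations over a isolates its value at 0 and gives p^n = 0.\<close>

lemma characters_are_canonical:
  assumes "nontrivial_char (\<psi> :: 'c \<Rightarrow> complex)"
  obtains a where "a \<noteq> 0" "\<psi> = canonical_char_at a"
proof -
  have psi: "\<psi> 0 = 1" "\<And>x y. \<psi> (x + y) = \<psi> x * \<psi> y" and nt: "\<exists>x. \<psi> x \<noteq> 1"
    using assms by (auto simp: nontrivial_char_def)
  have "\<exists>a. \<psi> = canonical_char_at a"
  proof (rule ccontr)
    assume no: "\<not> ?thesis"
    have zero: "(\<Sum>x\<in>UNIV. \<psi> x * canonical_char (a * - x)) = 0" for a
    proof -
      have "\<exists>d. \<psi> d * canonical_char (a * - d) \<noteq> 1"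
      proof (rule ccontr)
        assume "\<not> ?thesis"
        hence one: "\<psi> x * canonical_char (a * - x) = 1" for x by blast
        have "\<psi> x = canonical_char (a * x)" for x
        proof -
          have "\<psi> x = \<psi> x * (canonical_char (- (a * x)) * canonical_char (a * x))" by (simp add: cc_minus)
          also have "\<dots> = canonical_char (a * x)" using one[of x] by (simp add: mult.assoc[symmetric])
          finally show ?thesis .
        qed
        hence "\<psi> = canonical_char_at a" by (auto simp: canonical_char_at_def)
        thus False using no by blast
      qed
      then obtain d where d: "\<psi> d * canonical_char (a * - d) \<noteq> 1" by blast
      have "\<psi> (x + y) * canonical_char (a * - (x + y)) =
          (\<psi> x * canonical_char (a * - x)) * (\<psi> y * canonical_char (a * - y))" for x y
      proof -
        have "a * - (x + y) = a * - x + a * - y" by (simp add: algebra_simps)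
        hence "canonical_char (a * - (x + y)) = canonical_char (a * - x) * canonical_char (a * - y)"
          by (simp only: cc_add)
        thus ?thesis by (simp only: psi(2) mult_ac)
      qed
      thus ?thesis using d by (rule character_sum_zero)
    qed
    have "0 = (\<Sum>a\<in>UNIV. \<Sum>x\<in>UNIV. \<psi> x * canonical_char (a * - x))" by (simp only: zero sum.neutral_const)
    also have "\<dots> = (\<Sum>x\<in>UNIV. \<Sum>a\<in>UNIV. \<psi> x * canonical_char (a * - x))" by (rule sum.swap)
    also have "\<dots> = (\<Sum>x\<in>UNIV. \<psi> x * (if - x = 0 then of_nat (p ^ n) else 0))"
      by (simp only: sum_distrib_left[symmetric] sum_cc_mult)
    also have "\<dots> = (\<Sum>x\<in>(UNIV :: 'c set). if x = 0 then of_nat (p ^ n) else 0)"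
      by (intro sum.cong refl) (simp add: psi(1))
    also have "\<dots> = of_nat (p ^ n)" by simp
    finally show False using prime_p' prime_gt_0_nat by auto
  qed
  then obtain a where a: "\<psi> = canonical_char_at a" by blast
  have "a \<noteq> 0" using nt by (auto simp: a canonical_char_at_def cc_0)
  thus ?thesis using that a by blast
qed

lemma gauss_sum_eq:
  assumes "mult_char \<chi>"
  shows "gauss_sum \<chi> = G.GS (\<chi> \<gamma>)"
proof -
  have pow: "\<chi> (\<gamma> ^ i) = \<chi> \<gamma> ^ i" for i
    using assms gamma_nonzero by (induction i) (auto simp: mult_char_def)
  have "gauss_sum \<chi> = (\<Sum>i<p ^ n - 1. canonical_char (\<gamma> ^ i) * \<chi> (\<gamma> ^ i))"
    unfolding gauss_sum_def by (rule sum.reindex_bij_betw[OF bij_gamma, symmetric])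
  thus ?thesis unfolding G.GS_def by (simp only: cc_gamma pow)
qed

lemma char_with_value:
  assumes z: "z ^ (p ^ n - 1) = 1" and k: "k > 0" "\<And>j. z ^ j = 1 \<longleftrightarrow> k dvd j"
  obtains \<chi> :: "'c \<Rightarrow> complex" where "mult_char \<chi>" "\<chi> \<gamma> = z" "mult_char_order \<chi> = k"
proof -
  define \<chi> where "\<chi> = (\<lambda>x. G.chi z (e x))"
  have val: "\<chi> (\<gamma> ^ i) = z ^ i" for i by (simp add: \<chi>_def e_power G.chi_g[OF z])
  have obt: "\<exists>i. x = \<gamma> ^ i" if "x \<noteq> 0" for x using prim that by (auto simp: primitive_element_def)
  have mc: "mult_char \<chi>" unfolding mult_char_def
  proof (intro conjI allI impI)
    show "\<chi> 1 = 1" using val[of 0] by simp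
    fix x y :: 'c assume "x \<noteq> 0" "y \<noteq> 0"
    then obtain i j where "x = \<gamma> ^ i" "y = \<gamma> ^ j" using obt by metis
    thus "\<chi> (x * y) = \<chi> x * \<chi> y" by (simp only: val power_add [symmetric])
  qed
  have iff: "(\<forall>x. x \<noteq> 0 \<longrightarrow> \<chi> x ^ j = 1) \<longleftrightarrow> k dvd j" for j
  proof
    assume "\<forall>x. x \<noteq> 0 \<longrightarrow> \<chi> x ^ j = 1"
    hence "\<chi> (\<gamma> ^ 1) ^ j = 1" using gamma_nonzero by simp
    hence "z ^ j = 1" unfolding val by simp
    thus "k dvd j" using k(2) by blast
  next
    assume "k dvd j"
    hence zj: "z ^ j = 1" using k(2) by blast
    show "\<forall>x. x \<noteq> 0 \<longrightarrow> \<chi> x ^ j = 1"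
    proof (intro allI impI)
      fix x :: 'c assume "x \<noteq> 0"
      then obtain i where "x = \<gamma> ^ i" using obt by blast
      thus "\<chi> x ^ j = 1" using zj val by (metis mult.commute power_mult power_one)
    qed
  qed
  have "mult_char_order \<chi> = k"
    unfolding mult_char_order_def iff using k(1) by (intro Least_equality) (auto dest: dvd_imp_le)
  thus ?thesis using that[OF mc] val[of 1] by simp
qed

end

section \<open>Character sums over a union of cyclotomic classes\<close>

lemma (in field_model) mem_cyclotomic_union:
  assumes N: "N > 0" "N dvd p ^ n - 1" and I: "I \<subseteq> {0..<N}"
  shows "\<gamma> ^ i \<in> (\<Union>x\<in>I. cyclotomic_class \<gamma> N x) \<longleftrightarrow> i mod N \<in> I"
    and "0 \<notin> (\<Union>x\<in>I. cyclotomic_class \<gamma> N x)"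
proof -
  have cls: "cyclotomic_class \<gamma> N x = range (\<lambda>j. \<gamma> ^ (x + N * j))" for x
    by (simp add: cyclotomic_class_def power_add power_mult)
  show "0 \<notin> (\<Union>x\<in>I. cyclotomic_class \<gamma> N x)" using gamma_nonzero by (auto simp: cls)
  have eq: "\<gamma> ^ i = \<gamma> ^ j \<longleftrightarrow> [i = j] (mod (p ^ n - 1))" for j
    using G.g_pow_eq_iff[of i j] e_eq_iff[of "\<gamma> ^ i" "\<gamma> ^ j"] by (simp only: e_power)
  show "\<gamma> ^ i \<in> (\<Union>x\<in>I. cyclotomic_class \<gamma> N x) \<longleftrightarrow> i mod N \<in> I"
  proof
    assume "\<gamma> ^ i \<in> (\<Union>x\<in>I. cyclotomic_class \<gamma> N x)"
    then obtain x j where x: "x \<in> I" "\<gamma> ^ i = \<gamma> ^ (x + N * j)" by (auto simp: cls)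
    hence "[i = x + N * j] (mod (p ^ n - 1))" unfolding eq by blast
    hence "[i = x + N * j] (mod N)" by (rule cong_dvd_modulus_nat[OF _ N(2)])
    hence "i mod N = x mod N" by (simp add: cong_def)
    thus "i mod N \<in> I" using x(1) I by (auto simp: subset_iff)
  next
    assume "i mod N \<in> I"
    moreover have "\<gamma> ^ i = \<gamma> ^ (i mod N + N * (i div N))" by (simp only: mod_mult_div_eq)
    ultimately show "\<gamma> ^ i \<in> (\<Union>x\<in>I. cyclotomic_class \<gamma> N x)" unfolding cls by blast
  qed
qed

text \<open>N - 1 stands for -1 modulo N throughout, so that exponents remain natural
  numbers.\<close>

lemma cong_pred_mult: "N > 0 \<Longrightarrow> N dvd i + (N - 1) * x \<longleftrightarrow> [i = x] (mod (N::nat))"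
proof -
  assume N: "N > 0"
  have eq: "int (i + (N - 1) * x) = (int i - int x) + int N * int x"
    using N by (cases N) (simp_all add: algebra_simps)
  have "int N dvd int (i + (N - 1) * x) \<longleftrightarrow> int N dvd int i - int x"
    unfolding eq by (rule dvd_add_left_iff) (rule dvd_triv_left)
  thus ?thesis by (metis cong_iff_dvd_diff cong_int_iff int_dvd_int_iff)
qed

lemma sum_zeta_powers:
  assumes "n > 0"
  shows "(\<Sum>j<n. zeta n ^ (j * v)) = (if n dvd v then of_nat n else 0)"
proof -
  have eq: "zeta n ^ (j * v) = (zeta n ^ v) ^ j" for j by (metis mult.commute power_mult)
  have one: "(zeta n ^ v) ^ n = 1" using zeta_power_self[OF assms] by (metis mult.commute power_mult power_one)
  show ?thesis
  proof (cases "n dvd v")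
    case True
    thus ?thesis unfolding eq using zeta_power_eq_1_iff[OF assms, of v] by simp
  next
    case False
    hence "zeta n ^ v \<noteq> 1" using zeta_power_eq_1_iff[OF assms] by blast
    thus ?thesis unfolding eq using geometric_sum[of "zeta n ^ v" n] one False by simp
  qed
qed

text \<open>The indicator of \<open>i mod N\<close> in I is expanded in N-th roots of unity;
  multiplication by \<gamma>^c is a shift of logarithms and contributes \<zeta>_N^(-j c).\<close>

lemma (in field_model) sum_cyclotomic_union:
  assumes N: "N > 0" "N dvd p ^ n - 1" and I: "I \<subseteq> {0..<N}"
  shows "of_nat N * (\<Sum>y\<in>(\<Union>x\<in>I. cyclotomic_class \<gamma> N x). canonical_char (\<gamma> ^ c * y)) =
    (\<Sum>j<N. G.GS (zeta N ^ j) * (\<Sum>x\<in>I. zeta N ^ (j * ((N - 1) * (x + c)))))"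
proof -
  define D where "D = (\<Union>x\<in>I. cyclotomic_class \<gamma> N x)"
  have mem: "\<gamma> ^ i \<in> D \<longleftrightarrow> i mod N \<in> I" for i unfolding D_def by (rule mem_cyclotomic_union(1)[OF N I])
  have D0: "D \<subseteq> UNIV - {0}" using mem_cyclotomic_union(2)[OF N I] unfolding D_def by blast
  have finI: "finite I" using I finite_subset by blast
  let ?Q = "p ^ n - 1"
  have ind: "of_nat N * (if i mod N \<in> I then 1 else 0) = (\<Sum>x\<in>I. \<Sum>j<N. zeta N ^ (j * (i + (N - 1) * x)))" for i
  proof -
    have "(\<Sum>x\<in>I. \<Sum>j<N. zeta N ^ (j * (i + (N - 1) * x))) = (\<Sum>x\<in>I. if x = i mod N then of_nat N else 0)"
    proof (rule sum.cong[OF refl])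
      fix x assume "x \<in> I"
      hence "x < N" using I by auto
      hence "[i = x] (mod N) \<longleftrightarrow> x = i mod N" by (auto simp: cong_def)
      thus "(\<Sum>j<N. zeta N ^ (j * (i + (N - 1) * x))) = (if x = i mod N then of_nat N else 0)"
        unfolding sum_zeta_powers[OF N(1)] cong_pred_mult[OF N(1)] by simp
    qed
    thus ?thesis using finI by simp
  qed
  have "(\<Sum>y\<in>D. canonical_char (\<gamma> ^ c * y)) = (\<Sum>y\<in>UNIV - {0}. if y \<in> D then canonical_char (\<gamma> ^ c * y) else 0)"
    by (rule sum.mono_neutral_cong_left) (use D0 in auto)
  also have "\<dots> = (\<Sum>i<?Q. if \<gamma> ^ i \<in> D then canonical_char (\<gamma> ^ c * \<gamma> ^ i) else 0)"
    by (rule sum.reindex_bij_betw[OF bij_gamma, symmetric])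
  also have "\<dots> = (\<Sum>i<?Q. (if i mod N \<in> I then 1 else 0) * zeta p ^ G.\<tau> (i + c))"
    unfolding mem power_add [symmetric] cc_gamma by (intro sum.cong refl) (simp add: add.commute)
  finally have "of_nat N * (\<Sum>y\<in>D. canonical_char (\<gamma> ^ c * y)) =
      (\<Sum>i<?Q. (of_nat N * (if i mod N \<in> I then 1 else 0)) * zeta p ^ G.\<tau> (i + c))"
    by (simp only: sum_distrib_left mult.assoc)
  also have "\<dots> = (\<Sum>i<?Q. \<Sum>x\<in>I. \<Sum>j<N. zeta N ^ (j * (i + (N - 1) * x)) * zeta p ^ G.\<tau> (i + c))"
    unfolding ind by (simp only: sum_distrib_right)
  also have "\<dots> = (\<Sum>x\<in>I. \<Sum>i<?Q. \<Sum>j<N. zeta N ^ (j * (i + (N - 1) * x)) * zeta p ^ G.\<tau> (i + c))"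
    by (rule sum.swap)
  also have "\<dots> = (\<Sum>x\<in>I. \<Sum>j<N. \<Sum>i<?Q. zeta N ^ (j * (i + (N - 1) * x)) * zeta p ^ G.\<tau> (i + c))"
    by (intro sum.cong refl sum.swap)
  also have "\<dots> = (\<Sum>j<N. \<Sum>x\<in>I. \<Sum>i<?Q. zeta N ^ (j * (i + (N - 1) * x)) * zeta p ^ G.\<tau> (i + c))"
    by (rule sum.swap)
  also have "\<dots> = (\<Sum>j<N. G.GS (zeta N ^ j) * (\<Sum>x\<in>I. zeta N ^ (j * ((N - 1) * (x + c)))))"
  proof (rule sum.cong[OF refl])
    fix j
    define z where "z = zeta N ^ j"
    have zN: "z ^ N = 1" unfolding z_def using zeta_power_self[OF N(1)] by (metis mult.commute power_mult power_one)
    have zQ: "z ^ ?Q = 1" using N(2) zN by (metis dvdE power_mult power_one)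
    define T where "T = (\<Sum>i<?Q. zeta p ^ G.\<tau> (i + c) * z ^ i)"
    have "z ^ c * T = G.GS z" unfolding T_def by (rule G.GS_shift[OF zQ])
    hence "z ^ ((N - 1) * c) * (z ^ c * T) = z ^ ((N - 1) * c) * G.GS z" by (rule arg_cong)
    moreover have "z ^ ((N - 1) * c) * z ^ c = 1"
    proof -
      have "(N - 1) * c + c = N * c" using N(1) by (cases N) simp_all
      hence "z ^ ((N - 1) * c) * z ^ c = z ^ (N * c)" by (simp only: power_add [symmetric])
      hence "z ^ ((N - 1) * c) * z ^ c = (z ^ N) ^ c" by (simp only: power_mult [of z N])
      thus ?thesis by (simp only: zN power_one)
    qed
    ultimately have T: "T = z ^ ((N - 1) * c) * G.GS z" by (simp only: mult.assoc [symmetric] mult_1_left)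
    have "(\<Sum>i<?Q. zeta N ^ (j * (i + (N - 1) * x)) * zeta p ^ G.\<tau> (i + c)) = z ^ ((N - 1) * x) * T" for x
    proof -
      have "zeta N ^ (j * (i + (N - 1) * x)) * zeta p ^ G.\<tau> (i + c) =
          z ^ ((N - 1) * x) * (zeta p ^ G.\<tau> (i + c) * z ^ i)" for i
        by (simp only: power_mult z_def [symmetric] power_add mult_ac)
      thus ?thesis unfolding T_def by (simp only: sum_distrib_left)
    qed
    hence "(\<Sum>x\<in>I. \<Sum>i<?Q. zeta N ^ (j * (i + (N - 1) * x)) * zeta p ^ G.\<tau> (i + c)) =
        (\<Sum>x\<in>I. G.GS z * (z ^ ((N - 1) * x) * z ^ ((N - 1) * c)))"
      unfolding T by (simp only: mult_ac)
    also have "\<dots> = (\<Sum>x\<in>I. G.GS z * zeta N ^ (j * ((N - 1) * (x + c))))"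
      by (simp only: power_add [symmetric] distrib_left [symmetric] power_mult [of "zeta N" j] z_def [symmetric])
    finally show "(\<Sum>x\<in>I. \<Sum>i<?Q. zeta N ^ (j * (i + (N - 1) * x)) * zeta p ^ G.\<tau> (i + c)) =
        G.GS (zeta N ^ j) * (\<Sum>x\<in>I. zeta N ^ (j * ((N - 1) * (x + c))))"
      unfolding z_def by (simp only: sum_distrib_left)
  qed
  finally show ?thesis unfolding D_def .
qed

text \<open>Fourier counting of representations. Skewness gives the character sum over -D as -1 - S
  b, so every nontrivial character contributes S b (-1 - S b) = (1 - w^2) / 4, which does not see
  the sign \<sigma>; hence no dependence on g remains.\<close>

lemma card_difference_constant:
  fixes D :: "'c::finite_field set"
  assumes M: "field_model p n (e :: 'c \<Rightarrow> 'l::alg_closed_field) \<gamma>"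
    and skew: "D \<union> uminus ` D = UNIV - {0}" "D \<inter> uminus ` D = {}"
    and w: "\<And>b. b \<noteq> 0 \<Longrightarrow> \<exists>\<sigma>\<in>{1, - 1}. (\<Sum>x\<in>D. canonical_char (b * x)) = (- 1 + \<sigma> * w) / 2"
    and g: "g \<noteq> 0"
  shows "of_nat (p ^ n) * (of_nat (card {(x, y). x \<in> D \<and> y \<in> D \<and> x - y = g}) :: complex) =
      of_nat (card D) ^ 2 - (1 - w ^ 2) / 4"
proof -
  interpret field_model p n e \<gamma> by (rule M)
  define S where "S = (\<lambda>b. \<Sum>x\<in>D. canonical_char (b * x))"
  have compl: "(\<Sum>y\<in>D. canonical_char (b * - y)) = - 1 - S b" if b: "b \<noteq> 0" for b
  proof -
    have "(\<Sum>y\<in>uminus ` D. canonical_char (b * y)) = (\<Sum>y\<in>D. canonical_char (b * - y))"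
      by (subst sum.reindex) (auto simp: inj_on_def)
    moreover have "(\<Sum>y\<in>UNIV - {0}. canonical_char (b * y)) = S b + (\<Sum>y\<in>uminus ` D. canonical_char (b * y))"
      unfolding skew(1)[symmetric] S_def by (rule sum.union_disjoint) (use skew(2) in auto)
    moreover have "(\<Sum>y\<in>UNIV - {0}. canonical_char (b * y)) = - 1"
      using sum_cc_mult[of b] b by (simp add: sum_diff1 mult.commute[of _ b] cc_0)
    ultimately show ?thesis by (simp add: algebra_simps)
  qed
  have S_prod: "S b * (\<Sum>y\<in>D. canonical_char (b * - y)) = (1 - w ^ 2) / 4" if b: "b \<noteq> 0" for b
  proof -
    obtain \<sigma> where s: "\<sigma> \<in> {1, - 1 :: complex}" "S b = (- 1 + \<sigma> * w) / 2"
      using w[OF b] unfolding S_def by blast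
    have "S b * (- 1 - S b) = (1 - (\<sigma> * \<sigma>) * w ^ 2) / 4"
      unfolding s(2) by (simp add: field_simps power2_eq_square)
    moreover have "\<sigma> * \<sigma> = 1" using s(1) by auto
    ultimately show ?thesis unfolding compl[OF b] by simp
  qed
  have "of_nat (p ^ n) * (of_nat (card {(x, y). x \<in> D \<and> y \<in> D \<and> x - y = g}) :: complex) =
      (\<Sum>(x, y)\<in>D \<times> D. if x - y - g = 0 then of_nat (p ^ n) else 0)"
  proof -
    have eq: "{(x, y). x \<in> D \<and> y \<in> D \<and> x - y = g} = {z\<in>D \<times> D. fst z - snd z - g = 0}" by auto
    have "(\<Sum>z\<in>D \<times> D. if fst z - snd z - g = 0 then of_nat (p ^ n) else (0::complex)) =
        (\<Sum>z\<in>{z\<in>D \<times> D. fst z - snd z - g = 0}. of_nat (p ^ n))"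
      by (rule sum.inter_filter [symmetric]) simp
    also have "\<dots> = of_nat (p ^ n) * of_nat (card {(x, y). x \<in> D \<and> y \<in> D \<and> x - y = g})"
      unfolding eq by (simp only: sum_constant mult.commute)
    finally show ?thesis by (simp only: case_prod_unfold)
  qed
  also have "\<dots> = (\<Sum>(x, y)\<in>D \<times> D. \<Sum>b\<in>UNIV. canonical_char (b * (x - y - g)))"
    by (simp only: sum_cc_mult)
  also have "\<dots> = (\<Sum>b\<in>UNIV. \<Sum>(x, y)\<in>D \<times> D. canonical_char (b * (x - y - g)))"
    unfolding case_prod_unfold by (rule sum.swap)
  also have "\<dots> = (\<Sum>b\<in>UNIV. S b * (\<Sum>y\<in>D. canonical_char (b * - y)) * canonical_char (b * - g))"
  proof (rule sum.cong[OF refl])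
    fix b
    have "canonical_char (b * (x - y - g)) = canonical_char (b * x) * canonical_char (b * - y) * canonical_char (b * - g)" for x y
    proof -
      have "b * (x - y - g) = b * x + b * - y + b * - g" by (simp add: algebra_simps)
      thus ?thesis by (simp only: cc_add)
    qed
    hence "(\<Sum>(x, y)\<in>D \<times> D. canonical_char (b * (x - y - g))) =
        (\<Sum>(x, y)\<in>D \<times> D. canonical_char (b * x) * canonical_char (b * - y) * canonical_char (b * - g))"
      by (simp only:)
    also have "\<dots> = (\<Sum>(x, y)\<in>D \<times> D. canonical_char (b * x) * canonical_char (b * - y)) * canonical_char (b * - g)"
      by (simp only: sum_distrib_right case_prod_unfold)
    also have "(\<Sum>(x, y)\<in>D \<times> D. canonical_char (b * x) * canonical_char (b * - y)) =
        S b * (\<Sum>y\<in>D. canonical_char (b * - y))"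
      unfolding S_def sum_product by (rule sum.cartesian_product [symmetric])
    finally show "(\<Sum>(x, y)\<in>D \<times> D. canonical_char (b * (x - y - g))) =
        S b * (\<Sum>y\<in>D. canonical_char (b * - y)) * canonical_char (b * - g)" .
  qed
  also have "\<dots> = S 0 * (\<Sum>y\<in>D. canonical_char (0 * - y)) * canonical_char (0 * - g) +
      (\<Sum>b\<in>UNIV - {0}. S b * (\<Sum>y\<in>D. canonical_char (b * - y)) * canonical_char (b * - g))"
    by (rule sum.remove) simp_all
  also have "(\<Sum>b\<in>UNIV - {0}. S b * (\<Sum>y\<in>D. canonical_char (b * - y)) * canonical_char (b * - g)) =
      (\<Sum>b\<in>UNIV - {0}. (1 - w ^ 2) / 4 * canonical_char (b * - g))"
  proof (rule sum.cong[OF refl])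
    fix b :: 'c assume "b \<in> UNIV - {0}"
    hence "b \<noteq> 0" by simp
    from S_prod[OF this] show "S b * (\<Sum>y\<in>D. canonical_char (b * - y)) * canonical_char (b * - g) =
        (1 - w ^ 2) / 4 * canonical_char (b * - g)" by (rule arg_cong)
  qed
  also have "(\<Sum>b\<in>UNIV - {0}. (1 - w ^ 2) / 4 * canonical_char (b * - g)) =
      (1 - w ^ 2) / 4 * (\<Sum>b\<in>UNIV - {0}. canonical_char (b * - g))"
    by (rule sum_distrib_left [symmetric])
  also have "(\<Sum>b\<in>UNIV - {0}. canonical_char (b * - g)) = - 1"
    using sum_cc_mult[of "- g"] g by (simp add: sum_diff1 cc_0)
  finally show ?thesis by (simp add: S_def cc_0 power2_eq_square)
qed

lemma skew_hadamardI:
  fixes D :: "'c::finite_field set"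
  assumes M: "field_model p n (e :: 'c \<Rightarrow> 'l::alg_closed_field) \<gamma>"
    and skew: "D \<union> uminus ` D = UNIV - {0}" "D \<inter> uminus ` D = {}"
    and w: "\<And>b. b \<noteq> 0 \<Longrightarrow> \<exists>\<sigma>\<in>{1, - 1}. (\<Sum>x\<in>D. canonical_char (b * x)) = (- 1 + \<sigma> * w) / 2"
  shows "skew_hadamard_difference_set D"
proof -
  interpret field_model p n e \<gamma> by (rule M)
  let ?c = "\<lambda>g. card {(x, y). x \<in> D \<and> y \<in> D \<and> x - y = g}"
  have "?c g = ?c 1" if "g \<noteq> 0" for g
  proof -
    have eq: "of_nat (p ^ n) * (of_nat (?c g) :: complex) = of_nat (p ^ n) * of_nat (?c 1)"
      using card_difference_constant[OF M skew w that] card_difference_constant[OF M skew w, of 1] by simp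
    have nz: "(of_nat (p ^ n) :: complex) \<noteq> 0" using prime_gt_0_nat[OF prime_p'] by simp
    have "(of_nat (?c g) :: complex) = of_nat (?c 1)" using eq unfolding mult_left_cancel[OF nz] .
    thus ?thesis by (simp only: of_nat_eq_iff)
  qed
  hence "\<exists>l. \<forall>g. g \<noteq> 0 \<longrightarrow> ?c g = l" by blast
  thus ?thesis using skew unfolding skew_hadamard_difference_set_def by blast
qed

section \<open>The character values of the difference set\<close>

text \<open>Summing over k first leaves only the element x0 of I congruent to b modulo m. Then
  \<zeta>_N^(b - x0) is a sign, positive exactly when b and x0 agree modulo N.\<close>

lemma odd_exponent_sum:
  assumes m: "m > 0" and N: "N = 2 * m" and I: "I \<subseteq> {0..<N}" "card I = m" "(\<lambda>x. x mod m) ` I = {0..<m}"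
  shows "(\<Sum>x\<in>I. \<Sum>k<m. zeta N ^ ((2 * k + 1) * (b + (N - 1) * x))) = of_nat m * (if b mod N \<in> I then 1 else - 1)"
proof -
  have N0: "N > 0" using m N by simp
  have finI: "finite I" using I(1) finite_subset by blast
  have inj: "inj_on (\<lambda>x. x mod m) I" by (rule eq_card_imp_inj_on[OF finI]) (simp add: I)
  have zz: "zeta N ^ 2 = zeta m" using zeta_mult_power[of 2 m] by (simp add: N mult.commute)
  have "b mod m \<in> (\<lambda>x. x mod m) ` I" using m by (simp add: I(3))
  then obtain x0 where x0: "x0 \<in> I" "b mod m = x0 mod m" by blast
  have inner: "(\<Sum>k<m. zeta N ^ ((2 * k + 1) * (b + (N - 1) * x))) =
      (if x = x0 then of_nat m * zeta N ^ (b + (N - 1) * x0) else 0)" if x: "x \<in> I" for x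
  proof -
    let ?v = "b + (N - 1) * x"
    have "m dvd ?v \<longleftrightarrow> x = x0"
    proof -
      have "[?v = b + (m - 1) * x] (mod m)"
      proof -
        have "N - 1 = m + (m - 1)" using m N by simp
        hence "?v = (b + (m - 1) * x) + m * x" by (simp add: algebra_simps)
        thus ?thesis by (simp only: cong_def mod_mult_self2)
      qed
      hence "m dvd ?v \<longleftrightarrow> m dvd b + (m - 1) * x" by (rule cong_dvd_iff)
      also have "\<dots> \<longleftrightarrow> b mod m = x mod m" unfolding cong_pred_mult[OF m] cong_def ..
      also have "\<dots> \<longleftrightarrow> x = x0" using x0 x inj by (auto dest: inj_onD)
      finally show ?thesis .
    qed
    moreover have "(\<Sum>k<m. zeta N ^ ((2 * k + 1) * ?v)) = zeta N ^ ?v * (\<Sum>k<m. zeta m ^ (k * ?v))"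
    proof -
      have "zeta N ^ ((2 * k + 1) * ?v) = zeta N ^ ?v * zeta m ^ (k * ?v)" for k
      proof -
        have "(2 * k + 1) * ?v = ?v + 2 * (k * ?v)" by (simp add: algebra_simps)
        hence "zeta N ^ ((2 * k + 1) * ?v) = zeta N ^ ?v * (zeta N ^ 2) ^ (k * ?v)"
          by (simp only: power_add power_mult [of "zeta N" 2])
        thus ?thesis by (simp only: zz)
      qed
      thus ?thesis by (simp only: sum_distrib_left)
    qed
    ultimately show ?thesis unfolding sum_zeta_powers[OF m] by simp
  qed
  have "(\<Sum>x\<in>I. \<Sum>k<m. zeta N ^ ((2 * k + 1) * (b + (N - 1) * x))) =
      (\<Sum>x\<in>I. if x = x0 then of_nat m * zeta N ^ (b + (N - 1) * x0) else 0)"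
    by (intro sum.cong refl inner)
  also have "\<dots> = of_nat m * zeta N ^ (b + (N - 1) * x0)" using finI x0(1) by simp
  also have "zeta N ^ (b + (N - 1) * x0) = (if b mod N \<in> I then 1 else - 1)"
  proof -
    have x0N: "x0 < N" using x0(1) I(1) by auto
    have "b mod N \<in> I \<longleftrightarrow> b mod N = x0"
    proof
      assume h: "b mod N \<in> I"
      have "(b mod N) mod m = x0 mod m" using x0(2) by (simp add: N mod_mod_cancel)
      thus "b mod N = x0" using inj h x0(1) by (auto dest: inj_onD)
    qed (use x0(1) in auto)
    also have "\<dots> \<longleftrightarrow> N dvd b + (N - 1) * x0" unfolding cong_pred_mult[OF N0] cong_def using x0N by auto
    finally have iff: "b mod N \<in> I \<longleftrightarrow> N dvd b + (N - 1) * x0" .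
    have "m dvd b + (N - 1) * x0"
    proof -
      have "N - 1 = m + (m - 1)" using m N by simp
      hence "b + (N - 1) * x0 = (b + (m - 1) * x0) + m * x0" by (simp add: algebra_simps)
      moreover have "m dvd b + (m - 1) * x0" unfolding cong_pred_mult[OF m] cong_def by (rule x0(2))
      ultimately show ?thesis by (simp only: dvd_add dvd_triv_left)
    qed
    hence "(zeta N ^ (b + (N - 1) * x0)) ^ 2 = 1"
      using zeta_power_eq_1_iff[OF m] zz by (metis mult.commute power_mult)
    hence "zeta N ^ (b + (N - 1) * x0) = 1 \<or> zeta N ^ (b + (N - 1) * x0) = - 1" by (simp add: power2_eq_1_iff)
    moreover have "zeta N ^ (b + (N - 1) * x0) = 1 \<longleftrightarrow> b mod N \<in> I"
      unfolding iff by (rule zeta_power_eq_1_iff[OF N0])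
    ultimately show ?thesis by auto
  qed
  finally show ?thesis .
qed

text \<open>An even power of \<zeta>_N is a power of \<zeta>_m and sees I only modulo m, where it is
  a complete residue system.\<close>

lemma even_exponent_sum:
  assumes m: "m > 0" and N: "N = 2 * m" and I: "I \<subseteq> {0..<N}" "card I = m" "(\<lambda>x. x mod m) ` I = {0..<m}"
    and k: "0 < k" "k < m"
  shows "(\<Sum>x\<in>I. zeta N ^ (2 * k * ((N - 1) * (x + c)))) = 0"
proof -
  have finI: "finite I" using I(1) finite_subset by blast
  have inj: "inj_on (\<lambda>x. x mod m) I" by (rule eq_card_imp_inj_on[OF finI]) (simp add: I)
  define y where "y = zeta m ^ (k * (N - 1))"
  have zz: "zeta N ^ 2 = zeta m" using zeta_mult_power[of 2 m] by (simp add: N mult.commute)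
  have ym: "y ^ m = 1" unfolding y_def using zeta_power_self[OF m] by (metis mult.commute power_mult power_one)
  have "\<not> m dvd k * (N - 1)"
  proof
    assume "m dvd k * (N - 1)"
    moreover have "coprime m (N - 1)"
    proof -
      have "coprime N (N - 1)" by (rule coprime_diff_one_right_nat) (use m N in simp)
      thus ?thesis using N by (metis coprime_mult_left_iff)
    qed
    ultimately have "m dvd k" by (simp add: coprime_dvd_mult_left_iff)
    thus False using k by (auto dest: dvd_imp_le)
  qed
  hence y1: "y \<noteq> 1" unfolding y_def using zeta_power_eq_1_iff[OF m] by blast
  have "(\<Sum>x\<in>I. zeta N ^ (2 * k * ((N - 1) * (x + c)))) = (\<Sum>x\<in>I. y ^ c * y ^ (x mod m))"
  proof (rule sum.cong[OF refl])
    fix x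
    have "zeta N ^ (2 * k * ((N - 1) * (x + c))) = (zeta N ^ 2) ^ (k * (N - 1) * (x + c))"
      by (simp only: power_mult [symmetric] mult.assoc)
    also have "\<dots> = y ^ (x + c)" by (simp only: zz y_def power_mult [of "zeta m" "k * (N - 1)"])
    also have "\<dots> = y ^ c * y ^ x" by (simp add: power_add)
    also have "y ^ x = y ^ (x mod m)" by (rule power_eq_power_if_cong[OF ym]) (simp only: cong_mod_right cong_refl)
    finally show "zeta N ^ (2 * k * ((N - 1) * (x + c))) = y ^ c * y ^ (x mod m)" .
  qed
  also have "\<dots> = y ^ c * (\<Sum>r\<in>(\<lambda>x. x mod m) ` I. y ^ r)"
    by (simp only: sum_distrib_left [symmetric] sum.reindex[OF inj] comp_def)
  also have "(\<Sum>r\<in>(\<lambda>x. x mod m) ` I. y ^ r) = 0"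
    unfolding I(3) atLeast0LessThan using geometric_sum[OF y1, of m] ym by simp
  finally show ?thesis by simp
qed

text \<open>\<zeta>_N^j is a primitive root of unity of order 2 h with h = m / gcd(j, m). The
  hypothesis concerns only \<open>zeta (2 * h)\<close>; Galois conjugation extends it to the other
  primitive roots of that order.\<close>

lemma vanishing_exponent_sum:
  assumes m: "odd m" and N: "N = 2 * m" and j: "odd j" "\<not> m dvd j"
    and h: "m div gcd j m dvd M" and van: "\<forall>h. h > 1 \<longrightarrow> h dvd M \<longrightarrow> (\<Sum>x\<in>I. zeta (2 * h) ^ x) = 0"
  shows "(\<Sum>x\<in>I. zeta N ^ (j * ((N - 1) * (x + c)))) = 0"
proof -
  define d where "d = gcd j m"
  have m0: "m > 0" using m by (cases m) auto
  obtain j0 h where jh: "j = d * j0" "m = d * h" "coprime j0 h"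
    using gcd_coprime_exists[of j m] m0 unfolding d_def by (metis gcd_eq_0_iff mult.commute not_gr0)
  have d0: "d > 0" using m0 by (simp add: d_def)
  have hM: "h dvd M" using h jh(2) d0 unfolding d_def [symmetric] by simp
  have "h \<noteq> 0" using m0 jh(2) by auto
  moreover have "h \<noteq> 1" using j(2) jh by auto
  ultimately have h1: "h > 1" by linarith
  define P where "P = (\<Sum>x\<in>I. monom 1 x :: int poly)"
  have P: "ipoly P y = (\<Sum>x\<in>I. y ^ x)" for y by (simp add: P_def)
  have h20: "2 * h > 0" using h1 by simp
  have "coprime (j0 * (N - 1)) (2 * h)"
  proof -
    have "odd j0" "odd h" using j(1) m jh by auto
    hence "coprime j0 (2 * h)" using jh(3) by simp
    moreover have "coprime (N - 1) N" by (rule coprime_diff_one_left_nat) (use m0 N in simp)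
    hence "coprime (N - 1) (2 * h)" using N jh(2) by (simp add: mult.left_commute)
    ultimately show ?thesis by simp
  qed
  hence "ipoly P (zeta (2 * h) ^ (j0 * (N - 1))) = 0"
    using ipoly_root_power_coprime[OF h20 zeta_power_self[OF h20], of "j0 * (N - 1)" P] van h1 hM by (simp add: P)
  hence zero: "(\<Sum>x\<in>I. (zeta (2 * h) ^ (j0 * (N - 1))) ^ x) = 0" by (simp only: P)
  have zN: "zeta N ^ d = zeta (2 * h)" using zeta_mult_power[OF d0, of "2 * h"] by (simp add: N jh(2) mult_ac)
  have "(\<Sum>x\<in>I. zeta N ^ (j * ((N - 1) * (x + c)))) =
      (\<Sum>x\<in>I. (zeta (2 * h) ^ (j0 * (N - 1))) ^ c * (zeta (2 * h) ^ (j0 * (N - 1))) ^ x)"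
  proof (rule sum.cong[OF refl])
    fix x
    have "j * ((N - 1) * (x + c)) = d * (j0 * (N - 1) * (c + x))" by (simp only: jh(1) mult_ac add.commute)
    hence "zeta N ^ (j * ((N - 1) * (x + c))) = (zeta (2 * h) ^ (j0 * (N - 1))) ^ (c + x)"
      by (simp only: power_mult [of "zeta N" d] zN power_mult [of "zeta (2 * h)"])
    thus "zeta N ^ (j * ((N - 1) * (x + c))) =
        (zeta (2 * h) ^ (j0 * (N - 1))) ^ c * (zeta (2 * h) ^ (j0 * (N - 1))) ^ x"
      by (simp only: power_add)
  qed
  also have "\<dots> = 0" by (simp only: sum_distrib_left [symmetric] zero mult_zero_right)
  finally show ?thesis .
qed

text \<open>n_J times its inverse is 1 modulo 2 m_J and divisible by the remaining prime powers.
  These congruences are all that is used about \<eta>_(2 m_J) later on.\<close>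

lemma sub_char_exponent:
  fixes ms :: "nat \<Rightarrow> nat" and \<eta> :: "'b::finite_field \<Rightarrow> complex"
  assumes odd: "\<And>i. i \<in> {1..r} \<Longrightarrow> odd (ms i)"
    and cop: "\<And>i k. i \<in> {1..r} \<Longrightarrow> k \<in> {1..r} \<Longrightarrow> i \<noteq> k \<Longrightarrow> coprime (ms i) (ms k)"
    and N: "N = 2 * (\<Prod>i\<in>{1..r}. ms i)" and J: "J \<subseteq> {1..r}"
    and eta: "mult_char \<eta>" "\<eta> \<omega> = zeta N"
  obtains e where "mult_char (sub_char \<eta> ms r J)" "sub_char \<eta> ms r J \<omega> = zeta N ^ e"
    "[e = 1] (mod 2 * (\<Prod>i\<in>J. ms i))" "\<And>k. k \<in> {1..r} - J \<Longrightarrow> ms k dvd e"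
proof -
  define mJ where "mJ = (\<Prod>i\<in>J. int (ms i))"
  define nJ where "nJ = (\<Prod>i\<in>{1..r} - J. int (ms i))"
  have pos: "ms i > 0" if "i \<in> {1..r}" for i using odd[OF that] by (cases "ms i") auto
  have finJ: "finite J" using J finite_subset by blast
  have mJ0: "mJ > 0" unfolding mJ_def using pos J by (intro prod_pos) auto
  have full: "(\<Prod>i\<in>{1..r}. int (ms i)) = nJ * mJ"
    unfolding nJ_def mJ_def using prod.subset_diff[OF J, of "\<lambda>i. int (ms i)"] by simp
  have nJ_eq: "(\<Prod>i\<in>{1..r}. int (ms i)) div mJ = nJ" unfolding full using mJ0 by simp
  have N_int: "int N = 2 * mJ * nJ" using full by (simp add: N)
  have N0: "N > 0" unfolding N using pos by (simp add: prod_pos)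
  define w where "w = nJ * modular_inverse (2 * mJ) nJ"
  have "coprime nJ (2 * mJ)"
  proof -
    have "odd nJ" unfolding nJ_def using odd by (auto simp: even_prod_iff)
    moreover have "coprime nJ mJ" unfolding nJ_def mJ_def
    proof (intro prod_coprime_left prod_coprime_right)
      fix i k assume ik: "i \<in> {1..r} - J" "k \<in> J"
      hence "coprime (ms i) (ms k)" using J by (intro cop) auto
      thus "coprime (int (ms i)) (int (ms k))" by simp
    qed
    ultimately show ?thesis by simp
  qed
  hence w1: "[w = 1] (mod 2 * mJ)" unfolding w_def by (rule cong_modular_inverse1)
  define e where "e = nat (w mod int N)"
  have e_int: "int e = w mod int N" using N0 by (simp add: e_def)
  have sc: "sub_char \<eta> ms r J = (\<lambda>x. \<eta> x powi w)"
    by (simp add: sub_char_def Let_def mJ_def [symmetric] nJ_eq w_def)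
  have "mult_char (sub_char \<eta> ms r J)"
    unfolding sc mult_char_def using eta(1) by (simp add: mult_char_def power_int_mult_distrib)
  moreover have "sub_char \<eta> ms r J \<omega> = zeta N ^ e"
  proof -
    have "zeta N powi w = zeta N powi int e"
      by (rule power_int_cong[OF zeta_power_self[OF N0] N0]) (simp add: e_int cong_def)
    thus ?thesis by (simp add: sc eta(2))
  qed
  moreover have "[e = 1] (mod 2 * (\<Prod>i\<in>J. ms i))"
  proof -
    have "[int e = w] (mod 2 * mJ)"
      unfolding e_int N_int by (simp add: cong_def mod_mod_cancel)
    hence "[int e = int 1] (mod int (2 * (\<Prod>i\<in>J. ms i)))" using cong_trans[OF _ w1] by (simp add: mJ_def)
    thus ?thesis by (simp only: cong_int_iff)
  qed
  moreover have "ms k dvd e" if k: "k \<in> {1..r} - J" for k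
  proof -
    have kn: "int (ms k) dvd nJ" unfolding nJ_def using k by (intro dvd_prodI) auto
    hence "int (ms k) dvd w" "int (ms k) dvd int N" by (simp_all add: w_def N_int)
    hence "int (ms k) dvd int e" unfolding e_int by (simp add: dvd_mod_iff)
    thus ?thesis by (simp only: int_dvd_int_iff)
  qed
  ultimately show ?thesis using that by blast
qed

theorem theorem4p16:
  fixes p f r N m s :: nat
    and pr u ms :: "nat \<Rightarrow> nat"
    and I :: "nat set"
    and \<gamma> :: "'a::finite_field"
    and \<iota> :: "'b::finite_field \<Rightarrow> 'a"
    and \<omega> :: 'b
    and \<eta> :: "'b \<Rightarrow> complex"
    and t :: "nat \<Rightarrow> int"
    and A :: int
  assumes "prime p" and "p mod 4 = 3"
    and "r \<ge> 1"
    and "\<forall>i\<in>{1..r}. prime (pr i) \<and> odd (pr i) \<and> u i \<ge> 1 \<and> ms i = pr i ^ u i"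
    and "inj_on pr {1..r}"
    and "m = (\<Prod>i\<in>{1..r}. ms i)" and "N = 2 * m"
    and "f = ord N p" and "odd f"
    and "CARD('b) = p ^ f"
    and "(N, f, p) \<in> pure_triples_star TYPE('b)"
    and "property_star TYPE('b) ms r f p"
    and "I \<subseteq> {0..<N}" and "card I = m"
    and "(\<lambda>x. x mod m) ` I = {0..<m}"
    and "\<forall>h. h > 1 \<longrightarrow> h dvd (\<Prod>i\<in>{2..r}. ms i) \<longrightarrow> (\<Sum>x\<in>I. zeta (2 * h) ^ x) = 0"
    and "s > 0" and "odd s"
    and "CARD('a) = p ^ (f * s)"
    and "primitive_element \<gamma>"
    and "field_embedding \<iota>"
    and "\<iota> \<omega> = \<gamma> ^ ((p ^ (f * s) - 1) div (p ^ f - 1))"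
    and "mult_char \<eta>" and "\<eta> \<omega> = zeta N"
    and "t 1 = 0"
    and "\<forall>i\<in>{2..r}. gauss_sum (sub_char \<eta> ms r {1, i}) =
                      zeta (ms i) powi t i * gauss_sum (sub_char \<eta> ms r {1})"
    and "A = (\<Sum>i\<in>{1..r}. t i * (\<Prod>j\<in>{1..r} - {i}. int (ms j)))"
  shows "let D = (\<Union>x\<in>I. cyclotomic_class \<gamma> N x);
             I' = (\<lambda>x. nat ((- int x + 2 * A * int s) mod int N)) ` I
         in skew_hadamard_difference_set D \<and>
            dual (sqrt_neg_power p (f * s)) D =
              {canonical_char_at a | a. a \<in> (\<Union>i\<in>I'. cyclotomic_class \<gamma> N i)}"
proof -
  have p_odd: "odd p" using assms(2) by presburger
  have f_pos: "f > 0" using assms(9) by (cases f) auto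
  have fs_pos: "f * s > 0" using f_pos assms(17) by simp
  have fs_odd: "odd (f * s)" using assms(9,18) by simp

  \<comment> \<open>Both fields inside one algebraic closure\<close>
  define eA where "eA = (to_ac :: 'a \<Rightarrow> 'a alg_closure)"
  interpret MA: field_model p "f * s" eA \<gamma>
    by unfold_locales (use assms(1,19,20) fs_pos p_odd in \<open>simp_all add: eA_def\<close>)
  \<comment> \<open>The smaller field is embedded through \<iota>, so that \<omega> becomes the norm
    of \<gamma>, as the lifting theorem requires.\<close>
  define eB where "eB = (\<lambda>x. eA (\<iota> x))"
  interpret HB: finite_field_hom p f eB
    by unfold_locales (use assms(1,10,21) f_pos p_odd in
      \<open>simp_all add: eB_def eA_def field_embedding_def\<close>)
  have eB_omega: "eB \<omega> = eA \<gamma> ^ ((p ^ (f * s) - 1) div (p ^ f - 1))"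
    by (simp add: eB_def assms(22) MA.e_power)
  have GB: "gen_field p f (eB \<omega>)"
    unfolding eB_omega by (rule MA.G.sub_gen_field[OF refl f_pos])
  interpret GB: gen_field p f "eB \<omega>" by (rule GB)
  have "primitive_element \<omega>"
    unfolding primitive_element_def
  proof (intro conjI allI impI)
    show "\<omega> \<noteq> 0" using GB.g_nonzero HB.e_0 by auto
    fix x :: 'b assume "x \<noteq> 0"
    hence "eB x \<noteq> 0" by (simp add: HB.e_eq_0_iff)
    moreover have "eB x \<in> GB.F"
      using finite_field_power_card_eq_same[of x] by (simp add: HB.e_power [symmetric] assms(10))
    ultimately obtain k where "eB x = eB \<omega> ^ k" using GB.F_obtain by blast
    hence "x = \<omega> ^ k" by (simp only: HB.e_power [symmetric] HB.e_eq_iff)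
    thus "\<exists>k. x = \<omega> ^ k" by blast
  qed
  then interpret MB: field_model p f eB \<omega> by unfold_locales
  have pr: "prime (pr i)" "odd (pr i)" "u i \<ge> 1" "ms i = pr i ^ u i" if "i \<in> {1..r}" for i
    using assms(4) that by auto
  have ms_odd: "odd (ms i)" if "i \<in> {1..r}" for i using pr[OF that] by simp
  have ms_cop: "coprime (ms i) (ms k)" if "i \<in> {1..r}" "k \<in> {1..r}" "i \<noteq> k" for i k
  proof -
    have "pr i \<noteq> pr k" using inj_onD[OF assms(5)] that by blast
    hence "coprime (pr i) (pr k)" using pr(1) that by (intro primes_coprime) auto
    thus ?thesis by (simp add: pr(4)[OF that(1)] pr(4)[OF that(2)])
  qed
  have N_dvd: "N dvd p ^ f - 1"
    using assms(11) by (auto simp: pure_triples_star_def pure_triples_def)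
  \<comment> \<open>Purity is defined with p^(-f/2), the locale with \<open>GB.GS (- 1)\<close>,
    which is \<i>^f p^(f/2); the two normalizations differ by a power of \<i>.\<close>
  have root: "root_of_unity (GB.GS z / GB.GS (- 1))"
    if J: "J \<subseteq> {1..r}" "1 \<in> J" and z: "\<And>k. z ^ k = 1 \<longleftrightarrow> 2 * (\<Prod>i\<in>J. ms i) dvd k" for J z
  proof -
    define k where "k = 2 * (\<Prod>i\<in>J. ms i)"
    have "ms i > 0" if "i \<in> J" for i using ms_odd[of i] J(1) that by (cases "ms i") auto
    hence k0: "k > 0" unfolding k_def by (simp add: prod_pos)
    have "(\<Prod>i\<in>J. ms i) dvd m" unfolding assms(6) by (rule prod_dvd_prod_subset) (use J in auto)
    hence "k dvd p ^ f - 1" using N_dvd unfolding k_def assms(7) by (meson dvd_trans mult_dvd_mono dvd_refl)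
    hence zq: "z ^ (p ^ f - 1) = 1" using z by (simp add: k_def)
    obtain \<chi> :: "'b \<Rightarrow> complex" where chi: "mult_char \<chi>" "\<chi> \<omega> = z" "mult_char_order \<chi> = k"
      using MB.char_with_value[OF zq k0] z unfolding k_def by blast
    have "(k, f, p) \<in> pure_triples TYPE('b)"
      using assms(12) J unfolding property_star_def k_def by blast
    hence ru: "root_of_unity (of_real (real p powr (- real f / 2)) * GB.GS z)"
      using chi MB.gauss_sum_eq[OF chi(1)] by (auto simp: pure_triples_def)
    have p0: "real p > 0" using assms(1) prime_gt_0_nat by simp
    have quotient: "GB.GS z / GB.GS (- 1) = of_real P * GB.GS z * inverse \<i> ^ f"
      if "GB.GS (- 1) = \<i> ^ f * of_real R" "P = inverse R" for P R
      unfolding that divide_inverse inverse_mult_distrib power_inverse of_real_inverse by (simp only: mult_ac)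
    have GS1: "GB.GS (- 1) = \<i> ^ f * of_real (sqrt (real p) ^ f)"
    proof -
      have "csqrt (- of_nat p) = \<i> * of_real (sqrt (real p))"
        using csqrt_of_real_nonpos[of "- real p"] by simp
      thus ?thesis using GB.GS_quadratic[OF assms(2,9)] by (simp add: power_mult_distrib)
    qed
    have powr: "real p powr (- real f / 2) = inverse (sqrt (real p) ^ f)"
    proof -
      have "sqrt (real p) ^ f = (real p powr (1 / 2)) powr real f"
        using p0 by (simp add: powr_half_sqrt powr_realpow)
      also have "\<dots> = real p powr (real f / 2)" by (simp add: powr_powr)
      finally show ?thesis by (simp add: powr_minus)
    qed
    have "root_of_unity (inverse \<i>)"
      unfolding root_of_unity_def by (intro exI[of _ 4]) (simp add: power4_eq_xxxx)
    hence "root_of_unity (inverse \<i> ^ f)"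
      unfolding root_of_unity_power_iff[OF f_pos] .
    from root_of_unity_mult[OF ru this] show ?thesis unfolding quotient[OF GS1 powr] .
  qed
  have rel: "\<exists>e e1. [e = 1] (mod 2 * ms 1 * ms i) \<and> (\<forall>k\<in>{1..r} - {1, i}. ms k dvd e) \<and>
      [e1 = 1] (mod 2 * ms 1) \<and> (\<forall>k\<in>{1..r} - {1}. ms k dvd e1) \<and>
      GB.GS (zeta N ^ e) = zeta (ms i) powi t i * GB.GS (zeta N ^ e1)" if i: "i \<in> {2..r}" for i
  proof -
    have NN: "N = 2 * (\<Prod>i\<in>{1..r}. ms i)" by (simp add: assms(6,7))
    obtain e where e: "mult_char (sub_char \<eta> ms r {1, i})" "sub_char \<eta> ms r {1, i} \<omega> = zeta N ^ e"
      "[e = 1] (mod 2 * (\<Prod>i\<in>{1, i}. ms i))" "\<And>k. k \<in> {1..r} - {1, i} \<Longrightarrow> ms k dvd e"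
      using sub_char_exponent[OF ms_odd ms_cop NN _ assms(23,24), of "{1, i}"] i by auto
    obtain e1 where e1: "mult_char (sub_char \<eta> ms r {1})" "sub_char \<eta> ms r {1} \<omega> = zeta N ^ e1"
      "[e1 = 1] (mod 2 * (\<Prod>i\<in>{1}. ms i))" "\<And>k. k \<in> {1..r} - {1} \<Longrightarrow> ms k dvd e1"
      using sub_char_exponent[OF ms_odd ms_cop NN _ assms(23,24), of "{1}"] assms(3) by auto
    have "GB.GS (zeta N ^ e) = zeta (ms i) powi t i * GB.GS (zeta N ^ e1)"
      using assms(26) i MB.gauss_sum_eq[OF e(1)] MB.gauss_sum_eq[OF e1(1)] e(2) e1(2) by simp
    moreover have "[e = 1] (mod 2 * ms 1 * ms i)" using e(3) i by (simp add: mult.assoc)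
    moreover have "[e1 = 1] (mod 2 * ms 1)" using e1(3) by simp
    ultimately show ?thesis using e(4) e1(4) by blast
  qed
  interpret PS: pure_setup p f "eB \<omega>" r m N pr u ms t A
    by unfold_locales (use assms(2,3,5,6,7,9,25,27) pr N_dvd root rel in blast)+

  \<comment> \<open>The character values of D\<close>
  define D where "D = (\<Union>x\<in>I. cyclotomic_class \<gamma> N x)"
  define I' where "I' = (\<lambda>x. nat ((- int x + 2 * A * int s) mod int N)) ` I"
  define w where "w = sqrt_neg_power p (f * s)"
  have m0: "m > 0" and N0: "N > 0" using PS.m_pos PS.N_pos by blast+
  have q1: "p ^ f - 1 > 0" by (rule GB.q1_pos)
  have N_dvd_Q: "N dvd p ^ (f * s) - 1"
  proof -
    have "p ^ f - 1 dvd p ^ (f * s) - 1"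
      using geometric_nat[of "p ^ f" s] GB.q_gt_1 by (metis dvd_triv_left less_imp_le power_mult)
    thus ?thesis using N_dvd by (rule dvd_trans[rotated])
  qed
  have lift: "MA.G.GS z = GB.GS z ^ s" if "z ^ N = 1" for z
  proof -
    have "z ^ (p ^ f - 1) = 1" using N_dvd that by (metis dvdE power_mult power_one)
    from GB.GS_lift[OF MA.G.gen_field_axioms assms(17) eB_omega[symmetric] this] show ?thesis
      using assms(18) by simp
  qed
  have w: "MA.G.GS (- 1) = w"
    unfolding w_def sqrt_neg_power_def by (rule MA.G.GS_quadratic[OF assms(2) fs_odd])
  have w2: "w ^ 2 = - of_nat (p ^ (f * s))"
    using MA.G.GS_minus_one_square_neg[OF assms(2) fs_odd] by (simp only: w)
  have w0: "w \<noteq> 0"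
  proof
    assume "w = 0"
    hence "of_nat (p ^ (f * s)) = (0::complex)" using w2 by simp
    thus False using assms(1) prime_gt_0_nat by simp
  qed
  have finI: "finite I" using assms(13) finite_subset by blast
  \<comment> \<open>The tested exponent represents 2 A s - c modulo N: the prediction \<zeta>_m^(j A
    s) is \<zeta>_N^(2 j A s), and c enters with a minus sign.\<close>
  define \<sigma> where "\<sigma> = (\<lambda>c. if (2 * PS.a * s + (N - 1) * c) mod N \<in> I then 1 else - 1 :: complex)"
  have char_sum: "(\<Sum>y\<in>D. canonical_char (\<gamma> ^ c * y)) = (- 1 + \<sigma> c * w) / 2" for c
  proof -
    define T where "T = (\<lambda>j. \<Sum>x\<in>I. zeta N ^ (j * ((N - 1) * (x + c))))"
    define b where "b = 2 * PS.a * s + (N - 1) * c"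
    have even_term: "MA.G.GS (zeta N ^ (2 * k)) * T (2 * k) = (if k = 0 then - of_nat m else 0)" if "k < m" for k
    proof (cases "k = 0")
      case True
      thus ?thesis using assms(14) by (simp add: T_def MA.G.GS_1)
    next
      case False
      hence "T (2 * k) = 0" unfolding T_def
        using even_exponent_sum[OF m0 assms(7,13,14,15) _ that] by simp
      thus ?thesis using False by simp
    qed
    have odd_term: "MA.G.GS (zeta N ^ (2 * k + 1)) * T (2 * k + 1) =
        w * (\<Sum>x\<in>I. zeta N ^ ((2 * k + 1) * (b + (N - 1) * x)))" if k: "k < m" for k
    proof -
      define j where "j = 2 * k + 1"
      have oj: "odd j" by (simp add: j_def)
      have zj: "(zeta N ^ j) ^ N = 1" by (rule PS.zN_power_pow)
      have zm: "zeta N ^ 2 = zeta m" using zeta_mult_power[of 2 m] by (simp add: assms(7) mult.commute)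
      \<comment> \<open>For m_1 dividing j nothing is claimed about the Gauss sum unless j = m,
        where the character is quadratic and the predicted root of unity is 1.\<close>
      have cases: "T j = 0 \<or> MA.G.GS (zeta N ^ j) = zeta N ^ (j * (2 * PS.a * s)) * w"
      proof (cases "ms 1 dvd j")
        case False
        have "MA.G.GS (zeta N ^ j) = (zeta m ^ (j * PS.a) * GB.GS (- 1)) ^ s"
          unfolding lift[OF zj] PS.GS_eq[OF oj False] ..
        also have "\<dots> = (zeta m ^ (j * PS.a)) ^ s * w"
        proof -
          have "(- 1 :: complex) ^ N = 1" using PS.N_even by simp
          thus ?thesis using lift[of "- 1"] w by (simp add: power_mult_distrib)
        qed
        also have "(zeta m ^ (j * PS.a)) ^ s = zeta N ^ (j * (2 * PS.a * s))"
          unfolding zm [symmetric] power_mult [symmetric] by (simp only: mult_ac)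
        finally show ?thesis by blast
      next
        case dv: True
        show ?thesis
        proof (cases "m dvd j")
          case True
          have "j < 2 * m" using k by (simp add: j_def)
          moreover obtain x where x: "j = m * x" using True by blast
          ultimately have "x < 2" "x \<noteq> 0" using oj m0 by (auto simp: x odd_pos)
          hence jm: "j = m" using x by (cases "x = 1") auto
          have "zeta N ^ (j * (2 * PS.a * s)) = (zeta N ^ N) ^ (PS.a * s)"
            unfolding power_mult [symmetric] by (simp only: jm assms(7) mult_ac)
          hence "zeta N ^ (j * (2 * PS.a * s)) = 1" by (simp only: PS.zN_pow power_one)
          thus ?thesis using w by (simp add: jm PS.zN_m)
        next
          case False
          have "{1..r} = insert 1 {2..r}" using assms(3) by auto
          hence m_split: "m = ms 1 * (\<Prod>i\<in>{2..r}. ms i)" by (simp add: assms(6))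
          have "m div gcd j m dvd (\<Prod>i\<in>{2..r}. ms i)"
          proof -
            have "ms 1 dvd gcd j m" using dv m_split by simp
            hence "m dvd gcd j m * (\<Prod>i\<in>{2..r}. ms i)"
              by (subst (1) m_split) (rule mult_dvd_mono[OF _ dvd_refl])
            moreover have "gcd j m * (m div gcd j m) = m" by simp
            ultimately have "gcd j m * (m div gcd j m) dvd gcd j m * (\<Prod>i\<in>{2..r}. ms i)" by (simp only:)
            moreover have "gcd j m > 0" using m0 by simp
            ultimately show ?thesis by (simp only: nat_mult_dvd_cancel1)
          qed
          hence "T j = 0" unfolding T_def
            by (intro vanishing_exponent_sum[OF PS.m_odd assms(7) oj False _ assms(16)])
          thus ?thesis by blast
        qed
      qed
      have T_sum: "zeta N ^ (j * (2 * PS.a * s)) * T j = (\<Sum>x\<in>I. zeta N ^ (j * (b + (N - 1) * x)))"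
      proof -
        have "zeta N ^ (j * (2 * PS.a * s)) * zeta N ^ (j * ((N - 1) * (x + c))) = zeta N ^ (j * (b + (N - 1) * x))" for x
          unfolding power_add [symmetric] b_def by (simp add: algebra_simps)
        thus ?thesis by (simp only: T_def sum_distrib_left)
      qed
      have "MA.G.GS (zeta N ^ j) * T j = w * (zeta N ^ (j * (2 * PS.a * s)) * T j)"
        using cases by (auto simp: mult_ac)
      thus ?thesis unfolding T_sum unfolding j_def .
    qed
    have "of_nat N * (\<Sum>y\<in>D. canonical_char (\<gamma> ^ c * y)) = (\<Sum>j<2 * m. MA.G.GS (zeta N ^ j) * T j)"
      unfolding D_def T_def MA.sum_cyclotomic_union[OF N0 N_dvd_Q assms(13)] by (simp only: assms(7))
    also have "\<dots> = (\<Sum>k<m. (if k = 0 then - of_nat m else 0) + w * (\<Sum>x\<in>I. zeta N ^ ((2 * k + 1) * (b + (N - 1) * x))))"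
      unfolding sum_double by (intro sum.cong refl) (simp only: even_term odd_term lessThan_iff)
    also have "\<dots> = - of_nat m + w * (\<Sum>k<m. \<Sum>x\<in>I. zeta N ^ ((2 * k + 1) * (b + (N - 1) * x)))"
      using m0 by (simp add: sum.distrib sum_distrib_left)
    also have "(\<Sum>k<m. \<Sum>x\<in>I. zeta N ^ ((2 * k + 1) * (b + (N - 1) * x))) = of_nat m * \<sigma> c"
      unfolding \<sigma>_def b_def [symmetric] odd_exponent_sum[OF m0 assms(7,13,14,15), of b, symmetric] by (rule sum.swap)
    finally have "of_nat m * (2 * (\<Sum>y\<in>D. canonical_char (\<gamma> ^ c * y))) = of_nat m * (- 1 + \<sigma> c * w)"
      by (simp add: assms(7) algebra_simps)
    moreover have "(of_nat m :: complex) \<noteq> 0" using m0 by simp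
    ultimately have "2 * (\<Sum>y\<in>D. canonical_char (\<gamma> ^ c * y)) = - 1 + \<sigma> c * w" by (metis mult_left_cancel)
    thus ?thesis by (simp add: field_simps)
  qed
  have sigma: "\<sigma> c = 1 \<longleftrightarrow> c mod N \<in> I'" for c
  proof -
    define b where "b = 2 * PS.a * s + (N - 1) * c"
    have b_cong: "[int b = 2 * A * int s - int c] (mod int N)"
    proof -
      have "[int PS.a = A] (mod int m)" unfolding PS.a_def using m0 by (simp add: cong_def)
      hence "int m dvd int PS.a - A" by (simp add: cong_iff_dvd_diff)
      hence "2 * int m dvd 2 * (int PS.a - A)" by (rule mult_dvd_mono[OF dvd_refl])
      hence "int N dvd 2 * (int PS.a - A)" by (simp only: assms(7) of_nat_mult of_nat_numeral)
      hence d1: "int N dvd 2 * (int PS.a - A) * int s + int N * int c"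
        by (rule dvd_add[OF dvd_mult2 dvd_triv_left])
      have "int b = 2 * int PS.a * int s + (int N - 1) * int c"
        using N0 by (cases N) (simp_all add: b_def)
      hence "int b - (2 * A * int s - int c) = 2 * (int PS.a - A) * int s + int N * int c"
        by (simp add: algebra_simps)
      thus ?thesis using d1 by (simp only: cong_iff_dvd_diff)
    qed
    have "c mod N \<in> I' \<longleftrightarrow> (\<exists>x\<in>I. int (c mod N) = (- int x + 2 * A * int s) mod int N)"
    proof -
      have "c mod N = nat (z mod int N) \<longleftrightarrow> int (c mod N) = z mod int N" for z
        using N0 by (simp add: nat_eq_iff2 eq_commute [of "int c mod int N"] zmod_int)
      thus ?thesis by (simp only: I'_def image_iff)
    qed
    also have "\<dots> \<longleftrightarrow> (\<exists>x\<in>I. [int c = - int x + 2 * A * int s] (mod int N))"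
      by (simp only: cong_def zmod_int)
    also have "\<dots> \<longleftrightarrow> (\<exists>x\<in>I. [int b = int x] (mod int N))"
    proof (intro bex_cong refl)
      fix x
      have "[int c = - int x + 2 * A * int s] (mod int N) \<longleftrightarrow> [2 * A * int s - int c = int x] (mod int N)"
      proof -
        have "2 * A * int s - int c - int x = - (int c - (- int x + 2 * A * int s))" by simp
        thus ?thesis by (simp only: cong_iff_dvd_diff dvd_minus_iff)
      qed
      also have "\<dots> \<longleftrightarrow> [int b = int x] (mod int N)" using b_cong by (meson cong_sym cong_trans)
      finally show "[int c = - int x + 2 * A * int s] (mod int N) \<longleftrightarrow> [int b = int x] (mod int N)" .
    qed
    also have "\<dots> \<longleftrightarrow> b mod N \<in> I"
    proof -
      have "[int b = int x] (mod int N) \<longleftrightarrow> b mod N = x" if "x \<in> I" for x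
        using assms(13) that unfolding cong_int_iff by (auto simp: cong_def)
      thus ?thesis by auto
    qed
    finally show ?thesis by (simp add: \<sigma>_def b_def)
  qed

  \<comment> \<open>D and -D partition the nonzero elements\<close>
  have obt: "\<exists>c. x = \<gamma> ^ c" if "x \<noteq> 0" for x
    using assms(20) that by (auto simp: primitive_element_def)
  have mem: "\<gamma> ^ i \<in> D \<longleftrightarrow> i mod N \<in> I" for i
    unfolding D_def by (rule MA.mem_cyclotomic_union(1)[OF N0 N_dvd_Q assms(13)])
  have D0: "0 \<notin> D" unfolding D_def by (rule MA.mem_cyclotomic_union(2)[OF N0 N_dvd_Q assms(13)])
  \<comment> \<open>-1 is \<gamma>^h with h = m c. Since w^2 is negative, h and hence c are odd, so
    modulo N the exponent moves by exactly m.\<close>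
  have half: "- (\<gamma> ^ i) \<in> D \<longleftrightarrow> (i + m) mod N \<in> I" for i
  proof -
    define h where "h = (p ^ (f * s) - 1) div 2"
    have "eA (\<gamma> ^ h) = eA (- 1)" using MA.G.minus_one_eq by (simp add: h_def MA.e_power MA.e_minus MA.e_one)
    hence gh: "\<gamma> ^ h = - 1" by (simp only: MA.e_eq_iff)
    obtain c where c: "p ^ (f * s) - 1 = N * c" using N_dvd_Q by blast
    hence hc: "h = m * c" by (simp add: h_def assms(7))
    have "odd h"
    proof
      assume "even h"
      hence "MA.G.GS (- 1) ^ 2 = of_nat (p ^ (f * s))" using MA.G.GS_minus_one_square by (simp add: h_def)
      hence "w ^ 2 = - (w ^ 2)" unfolding w w2 by simp
      hence "w ^ 2 + w ^ 2 = 0" unfolding eq_neg_iff_add_eq_0 .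
      hence "2 * w ^ 2 = 0" by (simp only: mult_2)
      thus False using w0 by simp
    qed
    hence "odd c" by (simp add: hc)
    then obtain d where "c = 2 * d + 1" using oddE by blast
    hence "i + h = (i + m) + N * d" by (simp add: hc assms(7) algebra_simps)
    hence "(i + h) mod N = (i + m) mod N" by (simp only: mod_mult_self2)
    moreover have "- (\<gamma> ^ i) = \<gamma> ^ (i + h)" by (simp add: power_add gh)
    ultimately show ?thesis using mem[of "i + h"] by simp
  qed
  have inj: "inj_on (\<lambda>x. x mod m) I" by (rule eq_card_imp_inj_on[OF finI]) (simp add: assms(14,15))
  \<comment> \<open>By condition (1), I contains exactly one of the two residues modulo N = 2 m that
    lie above a given residue modulo m.\<close>
  have xor: "(i mod N \<in> I) \<noteq> ((i + m) mod N \<in> I)" for i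
  proof -
    have red: "(j mod N) mod m = j mod m" for j by (simp add: assms(7) mod_mod_cancel)
    have ne: "i mod N \<noteq> (i + m) mod N"
    proof
      assume "i mod N = (i + m) mod N"
      hence "[i + 0 = i + m] (mod N)" by (simp add: cong_def)
      hence "[0 = m] (mod N)" by (simp only: cong_add_lcancel_nat)
      hence "N dvd m" by (simp only: cong_sym_eq [of 0] cong_0_iff)
      thus False using m0 by (auto simp: assms(7) dest: dvd_imp_le)
    qed
    have "i mod m \<in> (\<lambda>x. x mod m) ` I" using m0 by (simp add: assms(15))
    then obtain x where x: "x \<in> I" "i mod m = x mod m" by blast
    have xN: "x < N" using x(1) assms(13) by auto
    have "x = i mod N \<or> x = (i + m) mod N"
    proof -
      define y where "y = i mod N"
      have y: "y < N" "y mod m = x mod m" using N0 x(2) red[of i] by (simp_all add: y_def)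
      have "(i + m) mod N = (y + m) mod N" by (simp add: y_def mod_add_left_eq)
      moreover have "x = y \<or> x = (y + m) mod N"
      proof -
        obtain \<rho> x1 y1 where xy: "x = \<rho> + m * x1" "y = \<rho> + m * y1"
          by (metis mod_mult_div_eq y(2))
        have "m * x1 < m * 2" "m * y1 < m * 2" using xN y(1) unfolding xy assms(7) by linarith+
        hence "x1 < 2" "y1 < 2" by simp_all
        then consider "x1 = y1" | "x1 = 0" "y1 = 1" | "x1 = 1" "y1 = 0" by linarith
        thus ?thesis
        proof cases
          case 1
          thus ?thesis by (simp add: xy)
        next
          case 2
          hence "y + m = x + N" by (simp add: xy assms(7))
          hence "(y + m) mod N = x" using xN by simp
          thus ?thesis by simp
        next
          case 3
          hence "x = y + m" by (simp add: xy)
          thus ?thesis using xN by simp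
        qed
      qed
      ultimately show ?thesis by (simp add: y_def)
    qed
    moreover have "\<not> (i mod N \<in> I \<and> (i + m) mod N \<in> I)"
    proof
      assume h: "i mod N \<in> I \<and> (i + m) mod N \<in> I"
      have "(i mod N) mod m = ((i + m) mod N) mod m" unfolding red by simp
      thus False using inj_onD[OF inj] h ne by blast
    qed
    ultimately show ?thesis using x(1) by auto
  qed
  have neg_mem: "x \<in> uminus ` D \<longleftrightarrow> - x \<in> D" for x by (auto simp: image_iff) (metis add.inverse_inverse)
  have xor': "(x \<in> D) \<noteq> (- x \<in> D)" if "x \<noteq> 0" for x
    using obt[OF that] mem half xor by metis
  have skew1: "D \<union> uminus ` D = UNIV - {0}"
  proof (intro equalityI subsetI)
    fix x assume "x \<in> D \<union> uminus ` D"
    thus "x \<in> UNIV - {0}" using D0 by (auto simp: neg_mem)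
  next
    fix x :: 'a assume "x \<in> UNIV - {0}"
    thus "x \<in> D \<union> uminus ` D" using xor'[of x] by (auto simp: neg_mem)
  qed
  have skew2: "D \<inter> uminus ` D = {}"
  proof (intro equals0I)
    fix x assume x: "x \<in> D \<inter> uminus ` D"
    hence "x \<noteq> 0" using D0 by auto
    thus False using xor'[of x] x by (auto simp: neg_mem)
  qed
  have "skew_hadamard_difference_set D"
  proof (rule skew_hadamardI[OF MA.field_model_axioms skew1 skew2])
    fix b :: 'a assume "b \<noteq> 0"
    then obtain c where c: "b = \<gamma> ^ c" using obt by blast
    have "\<sigma> c \<in> {1, - 1}" by (simp add: \<sigma>_def)
    thus "\<exists>\<sigma>\<in>{1, - 1}. (\<Sum>x\<in>D. canonical_char (b * x)) = (- 1 + \<sigma> * w) / 2"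
      using char_sum[of c] unfolding c by blast
  qed

  \<comment> \<open>The dual\<close>
  moreover have "dual w D = {canonical_char_at a | a. a \<in> (\<Union>i\<in>I'. cyclotomic_class \<gamma> N i)}"
  proof -
    have I'_sub: "I' \<subseteq> {0..<N}" using N0 by (auto simp: I'_def nat_less_iff)
    have mem': "\<gamma> ^ i \<in> (\<Union>i\<in>I'. cyclotomic_class \<gamma> N i) \<longleftrightarrow> i mod N \<in> I'" for i
      by (rule MA.mem_cyclotomic_union(1)[OF N0 N_dvd_Q I'_sub])
    have zero': "0 \<notin> (\<Union>i\<in>I'. cyclotomic_class \<gamma> N i)"
      by (rule MA.mem_cyclotomic_union(2)[OF N0 N_dvd_Q I'_sub])
    have val: "(\<Sum>x\<in>D. canonical_char_at (\<gamma> ^ c) x) = (- 1 + w) / 2 \<longleftrightarrow> c mod N \<in> I'" for c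
    proof -
      have "(- 1 + \<sigma> c * w) / 2 = (- 1 + w) / 2 \<longleftrightarrow> \<sigma> c = 1" using w0 by auto
      thus ?thesis using char_sum[of c] sigma[of c] by (simp add: canonical_char_at_def)
    qed
    show ?thesis
    proof (intro equalityI subsetI)
      fix \<psi> assume "\<psi> \<in> dual w D"
      hence psi: "nontrivial_char \<psi>" "(\<Sum>x\<in>D. \<psi> x) = (- 1 + w) / 2" by (auto simp: dual_def)
      obtain a where a: "a \<noteq> 0" "\<psi> = canonical_char_at a" using MA.characters_are_canonical[OF psi(1)] by blast
      obtain c where c: "a = \<gamma> ^ c" using obt[OF a(1)] by blast
      have "c mod N \<in> I'" using psi(2) val[of c] unfolding a(2) c by blast
      thus "\<psi> \<in> {canonical_char_at a | a. a \<in> (\<Union>i\<in>I'. cyclotomic_class \<gamma> N i)}"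
        using mem'[of c] a(2) c by blast
    next
      fix \<psi> assume "\<psi> \<in> {canonical_char_at a | a. a \<in> (\<Union>i\<in>I'. cyclotomic_class \<gamma> N i)}"
      then obtain a where a: "a \<in> (\<Union>i\<in>I'. cyclotomic_class \<gamma> N i)" "\<psi> = canonical_char_at a" by blast
      have a0: "a \<noteq> 0" using a(1) zero' by auto
      obtain c where c: "a = \<gamma> ^ c" using obt[OF a0] by blast
      have "(\<Sum>x\<in>D. \<psi> x) = (- 1 + w) / 2" using a(1) mem'[of c] val[of c] unfolding a(2) c by blast
      thus "\<psi> \<in> dual w D" using MA.nontrivial_cc_at[OF a0] a(2) by (simp add: dual_def)
    qed
  qed
  ultimately show ?thesis unfolding Let_def D_def I'_def w_def by blast
qed

end
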